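(* Let $1<p<\infty$ and $\max\{1,p-1\}<q<\infty$. Assume that $|F|\in L^{\frac{pq}2}_{\mathrm{loc}}(\Omega_T)$ and that $u\in L^{\frac{pq}2}_{\mathrm{loc}}(0,T;W^{1,\frac{pq}2}_{\mathrm{loc}}(\Omega;\mathbb{R}^N))$ satisfies $$\iint_{\Omega_T}\bigl(-u\cdot\varphi_t+\mathcal{A}(z,\nabla u)\cdot\nabla\varphi\bigr)\,dz=\iint_{\Omega_T}|F|^{p-2}F\cdot\nabla\varphi\,dz$$ for every $\varphi\in C_0^\infty(\Omega_T;\mathbb{R}^N)$. Then there exists a constant $c=c(n,p,L)$ such that $$\frac1{|I|}\int_I|u(x,t)-u_I(x)|^q\,dt\le c\,|I|^{\frac q2}\,\frac1{|I|}\int_I g(x,t)^q\,dt$$ for every parabolic cylinder $Q=Q_r=B\times I$ such that $2Q\Subset\Omega_T$ and almost every $x\in B$, where $$g(x,t)=\begin{cases}\Bigl(M^*\bigl((|\nabla u|+|F|)1_{2Q}\bigr)(x,t)+1\Bigr)^{\frac p2},&1<p<2,\\[1ex]\Bigl(M^*\Bigl(\bigl(\tfrac{|u|}r+|\nabla u|+|F|\bigr)^{p-1}1_{2Q}\Bigr)(x,t)+1\Bigr)^{\frac p{2(p-1)}},&2<p<\infty.\end{cases}$$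
   Context: $\Omega\subset\mathbb{R}^n$, $n\ge1$, is a bounded open domain, $T>0$, $\Omega_T=\Omega\times(0,T)$, $N\ge1$, $0<\nu<L<\infty$. $\mathcal{A}:\Omega_T\times\mathbb{R}^{Nn}\to\mathbb{R}^{Nn}$ is a Carathéodory vector field ($\mathcal{A}(\cdot,\xi)$ is measurable for every fixed $\xi$, $\mathcal{A}(z,\cdot)$ is continuous for a.e. $z$) with $\nu|\xi|^p\le\mathcal{A}(z,\xi)\cdot\xi$ and $|\mathcal{A}(z,\xi)|\le L|\xi|^{p-1}$ for a.e. $z\in\Omega_T$ and every $\xi\in\mathbb{R}^{Nn}$. $F:\Omega_T\to\mathbb{R}^{Nn}$ is measurable. We write $z=(x,t)$, $dz=dx\,dt$, and $\nabla$ is the gradient in $x$. For $1\le m<\infty$, $u\in L^m_{\mathrm{loc}}(0,T;W^{1,m}_{\mathrm{loc}}(\Omega;\mathbb{R}^N))$ means that for all $\Omega'\Subset\Omega$ and $0<t_1<t_2<T$ one has $u(\cdot,t)\in W^{1,m}(\Omega';\mathbb{R}^N)$ for a.e. $t\in(t_1,t_2)$ and $\int_{t_1}^{t_2}\int_{\Omega'}(|u|^m+|\nabla u|^m)\,dx\,dt<\infty$. Parabolic cylinders: $Q_r=B\times I$ with $B=B_r(x_0)=\{y\in\mathbb{R}^n:|y-x_0|<r\}$, $I=(t_0-r^2,t_0+r^2)$, and $2Q_r=B_{2r}(x_0)\times(t_0-(2r)^2,t_0+(2r)^2)$. $2Q\Subset\Omega_T$ means that the closure of $2Q$ is a compact subset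 of $\Omega_T$. $u_I(x)=\frac1{|I|}\int_I u(x,t)\,dt$ (componentwise). Functions multiplied by the characteristic function $1_{2Q}$ are extended by zero outside $2Q$. The strong maximal function of $f\in L^1_{\mathrm{loc}}(\mathbb{R}^{n+1})$ is $M^*f(z)=\sup\frac1{|B'\times I'|}\iint_{B'\times I'}|f|\,d\zeta$, the supremum taken over all cylinders $B'\times I'\ni z$ with $B'\subset\mathbb{R}^n$ an open ball of radius $\rho>0$ and $I'=(\tau-s,\tau+s)\subset\mathbb{R}$, $s>0$ ($\rho$ and $s$ independent of each other).
   Formalization: The factor c is replaced by c^q with c=c(n,p,L), since for 1<p<2 no factor c(n,p,L) independent of q can hold as q→∞; the case p=2, where g is undefined, and exponents pq/2<1, where the function space is undefined, are excluded. *)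

theory Defs
  imports "HOL-Analysis.Analysis"
begin

(* R^N and R^{Nn} for a variable number N of components: sequences in 'b (reals, resp. real^'n)
   vanishing from index N on.  N is a term rather than a type, so that a constant can be chosen
   independently of N.  On "vecs N" the product topology and Borel algebra of nat => 'b are the
   Euclidean ones. *)
definition vecs :: "nat \<Rightarrow> (nat \<Rightarrow> 'b::zero) set" where
  "vecs N = {v. \<forall>i\<ge>N. v i = 0}"

definition vnorm :: "nat \<Rightarrow> (nat \<Rightarrow> 'b::real_normed_vector) \<Rightarrow> real" where
  "vnorm N v = L2_set (\<lambda>i. norm (v i)) {..<N}"

definition vinner :: "nat \<Rightarrow> (nat \<Rightarrow> 'b::real_inner) \<Rightarrow> (nat \<Rightarrow> 'b) \<Rightarrow> real" where
  "vinner N v w = (\<Sum>i<N. v i \<bullet> w i)"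

definition cpt_contained :: "'a::topological_space set \<Rightarrow> 'a set \<Rightarrow> bool" where
  "cpt_contained S S' \<longleftrightarrow> compact (closure S) \<and> closure S \<subseteq> S'"

definition dir_deriv :: "('a::euclidean_space \<Rightarrow> real) \<Rightarrow> 'a \<Rightarrow> 'a \<Rightarrow> real" where
  "dir_deriv f b z = frechet_derivative f (at z) b"

primrec Ck :: "nat \<Rightarrow> ('a::euclidean_space \<Rightarrow> real) \<Rightarrow> bool" where
  "Ck 0 f \<longleftrightarrow> continuous_on UNIV f"
| "Ck (Suc k) f \<longleftrightarrow> (\<forall>x. f differentiable (at x)) \<and> (\<forall>b\<in>Basis. Ck k (dir_deriv f b))"

(* C_0^infinity(S); the functions are extended by zero to the whole space. *)
definition test_functions :: "'a::euclidean_space set \<Rightarrow> ('a \<Rightarrow> real) set" where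
  "test_functions S = {\<phi>. (\<forall>k. Ck k \<phi>) \<and> cpt_contained {x. \<phi> x \<noteq> 0} S}"

(* f in W^{1,m}(S) with weak gradient G. *)
definition W1 ::
  "real \<Rightarrow> 'a::euclidean_space set \<Rightarrow> ('a \<Rightarrow> real) \<Rightarrow> ('a \<Rightarrow> 'a) \<Rightarrow> bool" where
  "W1 m S f G \<longleftrightarrow>
     f \<in> borel_measurable (lebesgue_on S) \<and> integrable (lebesgue_on S) (\<lambda>x. \<bar>f x\<bar> powr m) \<and>
     G \<in> borel_measurable (lebesgue_on S) \<and> integrable (lebesgue_on S) (\<lambda>x. norm (G x) powr m) \<and>
     (\<forall>\<psi>\<in>test_functions S. \<forall>b\<in>Basis.
        (\<integral>x. f x * dir_deriv \<psi> b x \<partial>lebesgue_on S) = - (\<integral>x. (G x \<bullet> b) * \<psi> x \<partial>lebesgue_on S))"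

(* |F| in L^m_loc(S), in terms of the scalar function f = |F|. *)
definition Lloc :: "real \<Rightarrow> 'a::euclidean_space set \<Rightarrow> ('a \<Rightarrow> real) \<Rightarrow> bool" where
  "Lloc m S f \<longleftrightarrow> f \<in> borel_measurable (lebesgue_on S) \<and>
     (\<forall>K. compact K \<and> K \<subseteq> S \<longrightarrow> integrable (lebesgue_on K) (\<lambda>z. \<bar>f z\<bar> powr m))"

definition spacetime :: "(real^'n) set \<Rightarrow> real \<Rightarrow> ((real^'n) \<times> real) set" where
  "spacetime \<Omega> T = \<Omega> \<times> {0<..<T}"

(* u in L^m_loc(0,T; W^{1,m}_loc(Omega; R^N)), a space that is only considered for m >= 1.
   Du is (a version of) the spatial gradient, determined a.e. by u; its i-th entry is the gradient
   of the i-th component of u. *)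
definition LW_loc ::
  "real \<Rightarrow> nat \<Rightarrow> (real^'n) set \<Rightarrow> real \<Rightarrow> ((real^'n) \<times> real \<Rightarrow> nat \<Rightarrow> real)
     \<Rightarrow> ((real^'n) \<times> real \<Rightarrow> nat \<Rightarrow> real^'n) \<Rightarrow> bool" where
  "LW_loc m N \<Omega> T u Du \<longleftrightarrow> 1 \<le> m \<and>
     u \<in> spacetime \<Omega> T \<rightarrow> vecs N \<and> u \<in> borel_measurable (lebesgue_on (spacetime \<Omega> T)) \<and>
     Du \<in> spacetime \<Omega> T \<rightarrow> vecs N \<and> Du \<in> borel_measurable (lebesgue_on (spacetime \<Omega> T)) \<and>
     (\<forall>\<Omega>' t1 t2. open \<Omega>' \<and> cpt_contained \<Omega>' \<Omega> \<and> 0 < t1 \<and> t1 < t2 \<and> t2 < T \<longrightarrow>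
        (AE t in lebesgue_on {t1<..<t2}. \<forall>i<N. W1 m \<Omega>' (\<lambda>x. u (x,t) i) (\<lambda>x. Du (x,t) i)) \<and>
        integrable (lebesgue_on (\<Omega>' \<times> {t1<..<t2}))
          (\<lambda>z. vnorm N (u z) powr m + vnorm N (Du z) powr m))"

definition caratheodory_field ::
  "nat \<Rightarrow> real \<Rightarrow> real \<Rightarrow> real \<Rightarrow> ((real^'n) \<times> real) set
     \<Rightarrow> ((real^'n) \<times> real \<Rightarrow> (nat \<Rightarrow> real^'n) \<Rightarrow> (nat \<Rightarrow> real^'n)) \<Rightarrow> bool" where
  "caratheodory_field N p \<nu> L \<Omega>T A \<longleftrightarrow>
     A \<in> \<Omega>T \<rightarrow> vecs N \<rightarrow> vecs N \<and>
     (\<forall>\<xi>\<in>vecs N. (\<lambda>z. A z \<xi>) \<in> borel_measurable (lebesgue_on \<Omega>T)) \<and>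
     (AE z in lebesgue_on \<Omega>T. continuous_on (vecs N) (A z)) \<and>
     (AE z in lebesgue_on \<Omega>T. \<forall>\<xi>\<in>vecs N.
        \<nu> * vnorm N \<xi> powr p \<le> vinner N (A z \<xi>) \<xi> \<and>
        vnorm N (A z \<xi>) \<le> L * vnorm N \<xi> powr (p - 1))"

definition time_deriv :: "((real^'n) \<times> real \<Rightarrow> real) \<Rightarrow> (real^'n) \<times> real \<Rightarrow> real" where
  "time_deriv \<phi> z = dir_deriv \<phi> (0, 1) z"

definition space_grad :: "((real^'n) \<times> real \<Rightarrow> real) \<Rightarrow> (real^'n) \<times> real \<Rightarrow> real^'n" where
  "space_grad \<phi> z = (\<chi> j. dir_deriv \<phi> (axis j 1, 0) z)"

(* phi i is the i-th component of the test function. *)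
definition weak_solution ::
  "nat \<Rightarrow> real \<Rightarrow> ((real^'n) \<times> real) set
     \<Rightarrow> ((real^'n) \<times> real \<Rightarrow> (nat \<Rightarrow> real^'n) \<Rightarrow> (nat \<Rightarrow> real^'n))
     \<Rightarrow> ((real^'n) \<times> real \<Rightarrow> nat \<Rightarrow> real^'n)
     \<Rightarrow> ((real^'n) \<times> real \<Rightarrow> nat \<Rightarrow> real) \<Rightarrow> ((real^'n) \<times> real \<Rightarrow> nat \<Rightarrow> real^'n) \<Rightarrow> bool" where
  "weak_solution N p \<Omega>T A F u Du \<longleftrightarrow>
     (\<forall>\<phi>. (\<forall>i<N. \<phi> i \<in> test_functions \<Omega>T) \<longrightarrow>
        (\<integral>z. - vinner N (u z) (\<lambda>i. time_deriv (\<phi> i) z)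
             + vinner N (A z (Du z)) (\<lambda>i. space_grad (\<phi> i) z) \<partial>lebesgue_on \<Omega>T)
        = (\<integral>z. vinner N (\<lambda>i. vnorm N (F z) powr (p - 2) *\<^sub>R F z i) (\<lambda>i. space_grad (\<phi> i) z)
             \<partial>lebesgue_on \<Omega>T))"

definition time_interval :: "real \<Rightarrow> real \<Rightarrow> real set" where
  "time_interval t0 r = {t0 - r\<^sup>2<..<t0 + r\<^sup>2}"

definition cylinder :: "real^'n \<Rightarrow> real \<Rightarrow> real \<Rightarrow> ((real^'n) \<times> real) set" where
  "cylinder x0 t0 r = ball x0 r \<times> time_interval t0 r"

(* Averages of nonnegative functions, with values in [0, infinity]. *)
definition eavg :: "'a::euclidean_space set \<Rightarrow> ('a \<Rightarrow> ennreal) \<Rightarrow> ennreal" where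
  "eavg S f = (\<integral>\<^sup>+x\<in>S. f x \<partial>lebesgue) / emeasure lebesgue S"

definition strong_maximal :: "((real^'n) \<times> real \<Rightarrow> real) \<Rightarrow> (real^'n) \<times> real \<Rightarrow> ennreal" where
  "strong_maximal f z =
     Sup {eavg (ball y \<rho> \<times> {\<tau> - s<..<\<tau> + s}) (\<lambda>\<zeta>. ennreal \<bar>f \<zeta>\<bar>) | y \<rho> \<tau> s.
            0 < \<rho> \<and> 0 < s \<and> z \<in> ball y \<rho> \<times> {\<tau> - s<..<\<tau> + s}}"

(* Only used with exponent a > 0. *)
definition epowr :: "ennreal \<Rightarrow> real \<Rightarrow> ennreal" where
  "epowr x a = (if x = \<infinity> then \<infinity> else ennreal (enn2real x powr a))"

(* The function g belonging to Q_r(x0,t0).  It is only defined for p < 2 and p > 2. *)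
definition majorant ::
  "nat \<Rightarrow> real \<Rightarrow> ((real^'n) \<times> real \<Rightarrow> nat \<Rightarrow> real) \<Rightarrow> ((real^'n) \<times> real \<Rightarrow> nat \<Rightarrow> real^'n)
     \<Rightarrow> ((real^'n) \<times> real \<Rightarrow> nat \<Rightarrow> real^'n) \<Rightarrow> real^'n \<Rightarrow> real \<Rightarrow> real
     \<Rightarrow> (real^'n) \<times> real \<Rightarrow> ennreal" where
  "majorant N p u Du F x0 t0 r z =
     (let Q2 = cylinder x0 t0 (2 * r) in
      if p < 2 then
        epowr (strong_maximal (\<lambda>\<zeta>. (vnorm N (Du \<zeta>) + vnorm N (F \<zeta>)) * indicator Q2 \<zeta>) z + 1) (p / 2)
      else
        epowr (strong_maximal (\<lambda>\<zeta>. (vnorm N (u \<zeta>) / r + vnorm N (Du \<zeta>) + vnorm N (F \<zeta>)) powr (p - 1)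
                                    * indicator Q2 \<zeta>) z + 1) (p / (2 * (p - 1))))"

definition time_mean :: "real set \<Rightarrow> ((real^'n) \<times> real \<Rightarrow> nat \<Rightarrow> real) \<Rightarrow> real^'n \<Rightarrow> nat \<Rightarrow> real" where
  "time_mean I u x i = (\<integral>t. u (x,t) i \<partial>lebesgue_on I) / measure lebesgue I"

end

theory Submission
  imports Defs
begin

text \<open>
  The estimate is the integrated form of a pointwise bound: for almost every \<open>x\<close> in \<open>B\<close> and almost
  all times \<open>s\<close>, \<open>t\<close> in \<open>I\<close>,
  \<open>\<bar>u(x,s) - u(x,t)\<bar> \<le> C \<bar>s - t\<bar>^(1/2) (g(x,s) + g(x,t))\<close>.
  Given this, the distance of \<open>u(x,t)\<close> from the mean over \<open>I\<close> is at most a constant times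
  \<open>\<bar>I\<bar>^(1/2)\<close> times \<open>g(x,t)\<close> plus the mean of \<open>g\<close>, and taking \<open>q\<close>-th powers and
  averaging finishes the proof (\<open>mean_oscillation_le\<close>).

  For the pointwise bound, compare \<open>u(x,s)\<close> with a smooth average of \<open>u(\<cdot>,s)\<close> over a box of side
  \<open>\<rho>\<close> next to \<open>x\<close>. Let \<open>m\<close> be such that the averages of the gradient over all cylinders around
  the points \<open>(x,s)\<close> and \<open>(x,t)\<close> are at most \<open>m\<close>, and those of the flux
  \<open>L\<bar>\<nabla>u\<bar>^(p-1) + \<bar>F\<bar>^(p-1)\<close> at most \<open>m^(p-1)\<close>, up to constants. Passing to the average costs
  \<open>\<rho> m\<close>, as in the Poincare inequality (\<open>moll_halve_width\<close>). Moving the average from \<open>s\<close> to \<open>t\<close>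
  costs \<open>\<bar>s - t\<bar> m^(p-1) / \<rho>\<close>, because the equation expresses the difference by the flux through
  the gradient of the averaging kernel (\<open>moll_time_difference\<close>). The choice
  \<open>\<rho> = \<bar>s - t\<bar>^(1/2) m^((p-2)/2)\<close> balances the two and gives \<open>\<bar>s - t\<bar>^(1/2) m^(p/2)\<close>
  (\<open>time_oscillation\<close>).

  The box has to stay inside the doubled ball. If \<open>p < 2\<close>, this is ensured by \<open>m \<ge> 1\<close>, which is the
  purpose of the summand 1 in \<open>g\<close>. If \<open>p > 2\<close>, the side \<open>\<rho>\<close> may exceed \<open>r\<close>; but then the trivial
  bound of \<open>\<bar>u(x,s)\<bar>\<close> by a multiple of \<open>r m\<close>, hence of \<open>\<rho> m\<close>, is enough, and this is the purpose
  of the summand \<open>\<bar>u\<bar>/r\<close> in \<open>g\<close>. That \<open>m\<close> can be read off from a single maximal function, of the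
  gradient if \<open>p < 2\<close> and of its power \<open>p - 1\<close> if \<open>p > 2\<close>, rests on the elementary inequality
  \<open>y^a \<le> 1 + y^b\<close> for \<open>0 < a \<le> b\<close>, used in place of the inequalities of Jensen and Hoelder
  (\<open>controlled_of_maximal\<close>).

  All averages are taken in space and time, with kernels of independent spatial and temporal widths,
  which is why the strong maximal function appears. For a fixed temporal width \<open>\<sigma>\<close> the spatial width is
  halved repeatedly from \<open>\<rho>\<close> down to \<open>\<sigma>\<close>; the costs form a geometric series. What remains is an
  average over a cube in space-time, and it converges to \<open>u\<close> at every Lebesgue point of \<open>u\<close> with
  respect to cubes as \<open>\<sigma>\<close> tends to 0 (\<open>moll_tendsto\<close>). So no exceptional sets of times depending on
  the position or the scale arise: one null set in space-time suffices, and Fubini's theorem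
  distributes it over the slices.
\<close>

section \<open>Smooth functions and test functions\<close>

text \<open>
  The functions \<open>exp(-1/s)/s^m\<close>, extended by 0: up to linear combinations the family is closed under
  differentiation, which yields derivatives of all orders at once.
\<close>

definition flat :: "nat \<Rightarrow> real \<Rightarrow> real" where
  "flat m s = (if 0 < s then exp (- inverse s) * inverse s ^ m else 0)"

lemma flat_tendsto_0: "((\<lambda>s. exp (- inverse s) * inverse s ^ m) \<longlongrightarrow> 0) (at_right (0::real))"
proof -
  have "((\<lambda>s. (inverse s) ^ m / exp (inverse s)) \<longlongrightarrow> 0) (at_right (0::real))"
    by (rule filterlim_compose[OF tendsto_power_div_exp_0 filterlim_inverse_at_top_right])
  then show ?thesis
    by (simp add: exp_minus divide_inverse mult.commute)
qed

lemma flat_has_derivative: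
  "(flat m has_real_derivative (flat (m + 2) s - real m * flat (m + 1) s)) (at s)"
proof -
  consider "s < 0" | "s = 0" | "0 < s" by linarith
  then show ?thesis
  proof cases
    case 1
    have "(flat m has_real_derivative 0) (at s)"
      by (rule has_field_derivative_transform_within_open[of "\<lambda>_. 0" _ _ "{..<0}"])
         (use 1 in \<open>auto simp: flat_def\<close>)
    with 1 show ?thesis by (simp add: flat_def)
  next
    case 2
    have "((\<lambda>h. flat m h / h) \<longlongrightarrow> 0) (at_right 0)"
    proof (rule Lim_transform_eventually[OF flat_tendsto_0[of "Suc m"]])
      show "\<forall>\<^sub>F h in at_right 0. exp (- inverse h) * inverse h ^ Suc m = flat m h / h"
        using eventually_at_right_less[of "0::real"]
        by eventually_elim (simp add: flat_def divide_inverse)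
    qed
    moreover have "((\<lambda>h. flat m h / h) \<longlongrightarrow> 0) (at_left 0)"
    proof (rule Lim_transform_eventually[OF tendsto_const])
      show "\<forall>\<^sub>F h in at_left 0. 0 = flat m h / h"
        by (auto simp: eventually_at_left_field flat_def intro!: exI[of _ "-1"])
    qed
    ultimately have "((\<lambda>h. flat m h / h) \<longlongrightarrow> 0) (at 0)"
      by (simp add: filterlim_split_at)
    with 2 show ?thesis by (simp add: DERIV_def) (simp add: flat_def)
  next
    case 3
    have "((\<lambda>s. exp (- inverse s) * inverse s ^ m) has_real_derivative
        (flat (m + 2) s - real m * flat (m + 1) s)) (at s)"
    proof -
      have "((\<lambda>s. exp (- inverse s) * inverse s ^ m) has_real_derivative
          exp (- inverse s) * (inverse s)\<^sup>2 * inverse s ^ m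
          + exp (- inverse s) * (real m * inverse s ^ (m - 1) * - (inverse s)\<^sup>2)) (at s)"
        using 3 by (auto intro!: derivative_eq_intros simp: power2_eq_square)
      moreover have "exp (- inverse s) * (inverse s)\<^sup>2 * inverse s ^ m
          + exp (- inverse s) * (real m * inverse s ^ (m - 1) * - (inverse s)\<^sup>2)
          = flat (m + 2) s - real m * flat (m + 1) s"
        using 3 by (cases m) (simp_all add: flat_def power2_eq_square mult_ac)
      ultimately show ?thesis by simp
    qed
    then show ?thesis
      by (rule has_field_derivative_transform_within_open[of _ _ _ "{0<..}"])
         (use 3 in \<open>auto simp: flat_def\<close>)
  qed
qed

lemma continuous_on_flat: "continuous_on S (flat m)"
  by (meson DERIV_isCont continuous_at_imp_continuous_on flat_has_derivative)

lemma flat_nonneg: "0 \<le> flat m s" by (simp add: flat_def)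
lemma flat_pos: "0 < s \<Longrightarrow> 0 < flat m s" by (simp add: flat_def)

text \<open>
  A smooth probability density on the unit interval; \<open>ramp\<close> below is its distribution function.
\<close>

definition hump :: "real \<Rightarrow> real" where
  "hump s = flat 0 s * flat 0 (1 - s) / integral {0..1} (\<lambda>s. flat 0 s * flat 0 (1 - s))"

definition ramp :: "real \<Rightarrow> real" where
  "ramp s = integral {-1..s} hump"

lemma hump_mass_pos: "0 < integral {0..1} (\<lambda>s. flat 0 s * flat 0 (1 - s))"
proof -
  have c: "continuous_on {0..1::real} (\<lambda>s. flat 0 s * flat 0 (1 - s))"
    by (intro continuous_intros continuous_on_compose2[OF continuous_on_flat[of UNIV]]) auto
  have "0 \<le> integral {0..1} (\<lambda>s. flat 0 s * flat 0 (1 - s))"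
    by (intro integral_nonneg integrable_continuous_real c) (simp add: flat_nonneg)
  moreover have "integral {0..1} (\<lambda>s. flat 0 s * flat 0 (1 - s)) \<noteq> 0"
  proof
    assume "integral {0..1} (\<lambda>s. flat 0 s * flat 0 (1 - s)) = 0"
    then have "flat 0 (1/2) * flat 0 (1 - 1/2) = 0"
      using integral_eq_0_iff[OF c] by (auto simp: flat_nonneg)
    moreover have "flat 0 (1/2) > 0" by (simp add: flat_pos)
    ultimately show False by simp
  qed
  ultimately show ?thesis by linarith
qed

lemma continuous_on_hump: "continuous_on S hump"
  unfolding hump_def using hump_mass_pos
  by (intro continuous_intros continuous_on_compose2[OF continuous_on_flat[of UNIV]]) auto

lemma hump_nonneg: "0 \<le> hump s"
  using hump_mass_pos by (simp add: hump_def flat_nonneg)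

lemma hump_eq_0: "s \<notin> {0<..<1} \<Longrightarrow> hump s = 0"
  by (auto simp: hump_def flat_def)

lemma ramp_has_derivative: "(ramp has_real_derivative hump s) (at s)"
proof (cases "s < 0")
  case True
  have "ramp x = 0" if "x < 0" for x
  proof -
    have "integral {-1..x} hump = integral {-1..x} (\<lambda>_. 0)"
      using that by (intro integral_cong) (auto simp: hump_eq_0)
    then show ?thesis by (simp add: ramp_def)
  qed
  then have "(ramp has_real_derivative 0) (at s)"
    using True by (intro has_field_derivative_transform_within_open[of "\<lambda>_. 0" 0 s "{..<0}" ramp]) simp_all
  with True show ?thesis by (simp add: hump_eq_0)
next
  case False
  have "(ramp has_real_derivative hump s) (at s within {-1..s+1})"
    unfolding ramp_def[abs_def]
    by (rule integral_has_real_derivative) (use False continuous_on_hump in auto)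
  then show ?thesis
    using False at_within_interior[of s "{-1..s+1}"] by simp
qed

lemma ramp_mono: "x \<le> y \<Longrightarrow> ramp x \<le> ramp y"
  by (meson DERIV_nonneg_imp_nondecreasing hump_nonneg ramp_has_derivative)

lemma ramp_eq_0: "s \<le> 0 \<Longrightarrow> ramp s = 0"
proof -
  assume "s \<le> 0"
  have "integral {-1..s} hump = integral {-1..s} (\<lambda>_. 0)"
      using \<open>s \<le> 0\<close> by (intro integral_cong) (auto simp: hump_eq_0)
  then show ?thesis by (simp add: ramp_def)
qed

lemma integral_hump: "integral {0..1} hump = 1"
  using hump_mass_pos unfolding hump_def by simp

lemma ramp_eq_1: "1 \<le> s \<Longrightarrow> ramp s = 1"
proof -
  assume "1 \<le> s"
  have i: "hump integrable_on {a..b}" for a b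
    by (simp add: continuous_on_hump integrable_continuous_real)
  have "integral {-1..s} hump = integral {-1..0} hump + integral {0..s} hump"
    using \<open>1 \<le> s\<close> i by (simp add: Henstock_Kurzweil_Integration.integral_combine)
  also have "integral {0..s} hump = integral {0..1} hump + integral {1..s} hump"
    using \<open>1 \<le> s\<close> i by (simp add: Henstock_Kurzweil_Integration.integral_combine)
  also have "integral {1..s} hump = integral {1..s} (\<lambda>_. 0)"
    by (intro integral_cong) (auto simp: hump_eq_0)
  also have "integral {-1..0} hump = 0" using ramp_eq_0[of 0] by (simp add: ramp_def)
  finally show ?thesis by (simp add: ramp_def integral_hump)
qed

lemma ramp_bounds: "0 \<le> ramp s" "ramp s \<le> 1"
  using ramp_mono[of "min s 0" s] ramp_eq_0[of "min s 0"] ramp_mono[of s "max s 1"] ramp_eq_1[of "max s 1"]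
  by auto

text \<open>
  An algebra of functions that is closed under directional derivatives and large enough to contain every
  kernel and cut-off of the proof. Membership is easy to establish, and closure under derivatives gives
  differentiability of all orders. Functions of the ramp are generators in their own right, because
  taking antiderivatives is not an operation of the algebra.
\<close>

inductive smooth :: "('a::euclidean_space \<Rightarrow> real) \<Rightarrow> bool" where
  smooth_const: "smooth (\<lambda>z. c)"
| smooth_flat: "smooth (\<lambda>z. flat m (z \<bullet> v + c))"
| smooth_ramp: "smooth (\<lambda>z. ramp (z \<bullet> v + c))"
| smooth_add: "smooth f \<Longrightarrow> smooth g \<Longrightarrow> smooth (\<lambda>z. f z + g z)"
| smooth_mult: "smooth f \<Longrightarrow> smooth g \<Longrightarrow> smooth (\<lambda>z. f z * g z)"

lemma smooth_hump: "smooth (\<lambda>z. hump (z \<bullet> v + c))"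
proof -
  have "smooth (\<lambda>z. flat 0 (z \<bullet> v + c) * flat 0 (z \<bullet> (- v) + (1 - c))
         * inverse (integral {0..1} (\<lambda>s. flat 0 s * flat 0 (1 - s))))"
    by (intro smooth.intros)
  then show ?thesis by (simp add: hump_def[abs_def] divide_inverse algebra_simps)
qed

text \<open>
  Stated with one derivative family for all points and directions, so that the induction provides
  differentiability and membership of the derivatives in the algebra simultaneously.
\<close>

lemma smooth_has_derivative:
  assumes "smooth f"
  shows "\<exists>f'. (\<forall>z. (f has_derivative f' z) (at z)) \<and> (\<forall>b. smooth (\<lambda>z. f' z b))"
  using assms
proof induction
  case (smooth_const c)
  show ?case by (rule exI[of _ "\<lambda>_ _. 0"]) (auto intro: smooth.intros)
next
  case (smooth_flat m v c)
  define d where "d s = flat (m + 2) s + (- real m) * flat (m + 1) s" for s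
  have D: "(flat m has_real_derivative d s) (at s)" for s
    using flat_has_derivative[of m s] by (simp add: d_def)
  have "((\<lambda>z. flat m (z \<bullet> v + c)) has_derivative (\<lambda>b. d (z \<bullet> v + c) * (b \<bullet> v))) (at z)" for z
    by (rule has_derivative_compose[of "\<lambda>z. z \<bullet> v + c" _ _ _ "flat m",
        OF _ D[unfolded has_field_derivative_def], THEN has_derivative_eq_rhs])
       (auto intro!: derivative_eq_intros)
  moreover have "smooth (\<lambda>z. d (z \<bullet> v + c) * (b \<bullet> v))" for b
    unfolding d_def by (intro smooth.intros)
  ultimately show ?case by (intro exI[of _ "\<lambda>z b. d (z \<bullet> v + c) * (b \<bullet> v)"]) auto
next
  case (smooth_ramp v c)
  have "((\<lambda>z. ramp (z \<bullet> v + c)) has_derivative (\<lambda>b. hump (z \<bullet> v + c) * (b \<bullet> v))) (at z)" for z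
    by (rule has_derivative_compose[of "\<lambda>z. z \<bullet> v + c" _ _ _ ramp,
        OF _ ramp_has_derivative[unfolded has_field_derivative_def], THEN has_derivative_eq_rhs])
       (auto intro!: derivative_eq_intros)
  moreover have "smooth (\<lambda>z. hump (z \<bullet> v + c) * (b \<bullet> v))" for b
    by (intro smooth.intros smooth_hump)
  ultimately show ?case by (intro exI[of _ "\<lambda>z b. hump (z \<bullet> v + c) * (b \<bullet> v)"]) auto
next
  case (smooth_add f g)
  then obtain f' g' where *: "\<And>z. (f has_derivative f' z) (at z)" "\<And>b. smooth (\<lambda>z. f' z b)"
    "\<And>z. (g has_derivative g' z) (at z)" "\<And>b. smooth (\<lambda>z. g' z b)" by metis
  show ?case
    by (rule exI[of _ "\<lambda>z b. f' z b + g' z b"]) (use * in \<open>auto intro: smooth.intros derivative_intros\<close>)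
next
  case (smooth_mult f g)
  then obtain f' g' where *: "\<And>z. (f has_derivative f' z) (at z)" "\<And>b. smooth (\<lambda>z. f' z b)"
    "\<And>z. (g has_derivative g' z) (at z)" "\<And>b. smooth (\<lambda>z. g' z b)" by metis
  show ?case
    by (rule exI[of _ "\<lambda>z b. f z * g' z b + f' z b * g z"])
       (use * smooth_mult.hyps in \<open>auto intro!: smooth.smooth_add smooth.smooth_mult derivative_intros\<close>)
qed

lemma smooth_differentiable: "smooth f \<Longrightarrow> f differentiable at z"
  using smooth_has_derivative differentiable_def by blast

lemma smooth_dir_deriv: "smooth f \<Longrightarrow> smooth (dir_deriv f b)"
proof -
  assume "smooth f"
  then obtain f' where f': "\<And>z. (f has_derivative f' z) (at z)" "\<And>b. smooth (\<lambda>z. f' z b)"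
    using smooth_has_derivative by blast
  have "dir_deriv f b = (\<lambda>z. f' z b)"
    using frechet_derivative_at[OF f'(1)] by (auto simp: dir_deriv_def fun_eq_iff)
  with f'(2) show ?thesis by simp
qed

lemma smooth_continuous_on: "smooth f \<Longrightarrow> continuous_on S f"
  by (meson continuous_at_imp_continuous_on differentiable_imp_continuous_within smooth_differentiable)

lemma smooth_Ck: "smooth f \<Longrightarrow> Ck k f"
  by (induction k arbitrary: f) (auto intro: smooth_continuous_on smooth_differentiable smooth_dir_deriv)

lemma smooth_test_function:
  assumes "smooth f" "compact K" "K \<subseteq> S" "\<And>z. z \<notin> K \<Longrightarrow> f z = 0"
  shows "f \<in> test_functions S"
proof -
  have "closure {z. f z \<noteq> 0} \<subseteq> K"
    using assms by (intro closure_minimal compact_imp_closed) auto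
  moreover from this have "compact (closure {z. f z \<noteq> 0})"
    using \<open>compact K\<close> by (metis closed_closure compact_Int_closed inf.absorb_iff2)
  ultimately show ?thesis
    using assms by (auto simp: test_functions_def cpt_contained_def smooth_Ck)
qed

lemma smooth_diff: "smooth f \<Longrightarrow> smooth g \<Longrightarrow> smooth (\<lambda>z. f z - g z)"
  using smooth_add[OF _ smooth_mult[OF smooth_const[of "-1"]]] by fastforce

lemma smooth_prod: "finite S \<Longrightarrow> (\<And>i. i \<in> S \<Longrightarrow> smooth (f i)) \<Longrightarrow> smooth (\<lambda>z. \<Prod>i\<in>S. f i z)"
  by (induction S rule: finite_induct) (auto intro: smooth_const smooth_mult)

lemma smooth_imp_measurable: "smooth f \<Longrightarrow> f \<in> borel_measurable borel"
  by (simp add: borel_measurable_continuous_onI smooth_continuous_on)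

lemma smooth_compose_linear:
  fixes f :: "'b::euclidean_space \<Rightarrow> real" and l :: "'a::euclidean_space \<Rightarrow> 'b"
  assumes "smooth f" and adjoint: "\<And>z v. l z \<bullet> v = z \<bullet> l' v"
  shows "smooth (\<lambda>z. f (l z))"
  using assms(1) by induction (simp_all add: adjoint smooth.intros)

lemma smooth_compose_fst:
  fixes f :: "'a::euclidean_space \<Rightarrow> real"
  assumes "smooth f" shows "smooth (\<lambda>z::'a \<times> 'b::euclidean_space. f (fst z))"
  by (rule smooth_compose_linear[OF assms, where l'="\<lambda>v. (v, 0)"]) (simp add: inner_prod_def)

lemma smooth_compose_snd:
  fixes f :: "'b::euclidean_space \<Rightarrow> real"
  assumes "smooth f" shows "smooth (\<lambda>z::'a::euclidean_space \<times> 'b. f (snd z))"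
  by (rule smooth_compose_linear[OF assms, where l'="\<lambda>v. (0, v)"]) (simp add: inner_prod_def)

text \<open>
  All test functions in space-time below are products of a function of space and a function of time; the
  direction \<open>(a, 0)\<close> gives the spatial gradient and \<open>(0, 1)\<close> the time derivative.
\<close>

lemma dir_deriv_tensor:
  fixes \<alpha> :: "'a::euclidean_space \<Rightarrow> real" and \<theta> :: "'b::euclidean_space \<Rightarrow> real"
  assumes "smooth \<alpha>" "smooth \<theta>"
  shows "dir_deriv (\<lambda>z. \<alpha> (fst z) * \<theta> (snd z)) (a, b) z
       = dir_deriv \<alpha> a (fst z) * \<theta> (snd z) + \<alpha> (fst z) * dir_deriv \<theta> b (snd z)"
proof -
  obtain \<alpha>' where a: "\<And>z. (\<alpha> has_derivative \<alpha>' z) (at z)"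
    using smooth_has_derivative assms by blast
  obtain \<theta>' where t: "\<And>z. (\<theta> has_derivative \<theta>' z) (at z)"
    using smooth_has_derivative assms by blast
  have "((\<lambda>z. \<alpha> (fst z) * \<theta> (snd z)) has_derivative
      (\<lambda>h. \<alpha> (fst z) * \<theta>' (snd z) (snd h) + \<alpha>' (fst z) (fst h) * \<theta> (snd z))) (at z)"
    by (intro has_derivative_mult has_derivative_compose[OF has_derivative_fst[OF has_derivative_ident] a]
        has_derivative_compose[OF has_derivative_snd[OF has_derivative_ident] t])
  note eqs = frechet_derivative_at[OF this, symmetric] frechet_derivative_at[OF a, symmetric]
    frechet_derivative_at[OF t, symmetric]
  show ?thesis by (simp add: dir_deriv_def eqs)
qed

lemma dir_deriv_cmult:
  assumes "smooth f"
  shows "dir_deriv (\<lambda>z. c * f z) b z = c * dir_deriv f b z"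
proof -
  obtain f' where f': "\<And>z. (f has_derivative f' z) (at z)" using smooth_has_derivative[OF assms] by blast
  have "((\<lambda>z. c * f z) has_derivative (\<lambda>h. c * f' z h)) (at z)" by (intro has_derivative_mult_right f')
  from frechet_derivative_at[OF this, symmetric] frechet_derivative_at[OF f', symmetric]
  show ?thesis by (simp add: dir_deriv_def)
qed

lemma dir_deriv_zero: "smooth f \<Longrightarrow> dir_deriv f 0 z = 0"
  unfolding dir_deriv_def by (rule linear_0[OF linear_frechet_derivative[OF smooth_differentiable]])

lemma dir_deriv_eq_0_outside:
  assumes "closed K" "\<And>z. z \<notin> K \<Longrightarrow> f z = 0" "z \<notin> K"
  shows "dir_deriv f b z = 0"
proof -
  have "(f has_derivative (\<lambda>_. 0)) (at z)"
    using has_derivative_transform_within_open[where s="- K" and f="\<lambda>_. 0" and g=f and x=z, OF has_derivative_const] assms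
    by (simp add: open_Compl)
  from frechet_derivative_at[OF this, symmetric] show ?thesis by (simp add: dir_deriv_def)
qed

lemma test_function_support:
  assumes "f \<in> test_functions S"
  obtains K where "compact K" "K \<subseteq> S" "\<And>z. z \<notin> K \<Longrightarrow> f z = 0"
proof (rule that)
  show "compact (closure {z. f z \<noteq> 0})" "closure {z. f z \<noteq> 0} \<subseteq> S"
    using assms by (auto simp: test_functions_def cpt_contained_def)
  show "f z = 0" if "z \<notin> closure {z. f z \<noteq> 0}" for z
    using that closure_subset[of "{z. f z \<noteq> 0}"] by auto
qed

lemma bounded_of_compact_support:
  fixes f :: "'a::topological_space \<Rightarrow> real"
  assumes "continuous_on UNIV f" "compact K" "\<And>z. z \<notin> K \<Longrightarrow> f z = 0"
  obtains B where "\<And>z. \<bar>f z\<bar> \<le> B" "0 \<le> B"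
proof -
  have "bounded (f ` K)"
    using assms by (intro compact_imp_bounded compact_continuous_image) (auto intro: continuous_on_subset)
  then obtain B where B: "\<And>z. z \<in> K \<Longrightarrow> \<bar>f z\<bar> \<le> B" unfolding bounded_iff by auto
  show thesis
  proof (rule that)
    show "\<bar>f z\<bar> \<le> max B 0" for z
      using B[of z] assms(3)[of z] by (cases "z \<in> K") auto
  qed simp
qed

lemma test_function_bounded:
  assumes "smooth f" "f \<in> test_functions S"
  obtains B where "\<And>z. \<bar>f z\<bar> \<le> B" "0 \<le> B"
  using test_function_support[OF assms(2)] bounded_of_compact_support[OF smooth_continuous_on[OF assms(1)]] by metis

lemma test_function_dir_deriv_bounded:
  assumes "smooth f" "f \<in> test_functions S"
  obtains B where "\<And>z. \<bar>dir_deriv f b z\<bar> \<le> B" "0 \<le> B"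
proof -
  obtain K where K: "compact K" "\<And>z. z \<notin> K \<Longrightarrow> f z = 0" using test_function_support[OF assms(2)] by metis
  have "dir_deriv f b z = 0" if "z \<notin> K" for z
    using dir_deriv_eq_0_outside[OF compact_imp_closed[OF K(1)] K(2) that] .
  from bounded_of_compact_support[OF smooth_continuous_on[OF smooth_dir_deriv[OF assms(1)]] K(1) this] that
  show thesis by metis
qed

section \<open>Smooth kernels on boxes\<close>

lemma dir_deriv_along_line:
  assumes "f differentiable at z"
  shows "((\<lambda>h. f (z + h *\<^sub>R b)) has_real_derivative dir_deriv f b z) (at 0)"
proof -
  have f: "(f has_derivative frechet_derivative f (at z)) (at (z + 0 *\<^sub>R b))"
    using assms frechet_derivative_works by auto
  have "((\<lambda>h. z + h *\<^sub>R b) has_derivative (\<lambda>h. h *\<^sub>R b)) (at 0)"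
    by (auto intro!: derivative_eq_intros)
  from has_derivative_compose[where g=f, OF this f]
  have "((\<lambda>h. f (z + h *\<^sub>R b)) has_derivative (\<lambda>h. frechet_derivative f (at z) (h *\<^sub>R b))) (at 0)" .
  moreover have "frechet_derivative f (at z) (h *\<^sub>R b) = dir_deriv f b z * h" for h
    using linear_frechet_derivative[OF assms] by (simp add: linear_scale dir_deriv_def)
  ultimately show ?thesis by (simp add: has_field_derivative_def)
qed

lemma dir_deriv_real:
  assumes "(f has_real_derivative d) (at s)"
  shows "dir_deriv f 1 s = d"
  using frechet_derivative_at[OF assms[unfolded has_field_derivative_def], symmetric]
  by (simp add: dir_deriv_def)

lemma dir_deriv_prod_coordinates:
  fixes f :: "'n::finite \<Rightarrow> real \<Rightarrow> real" and y :: "real^'n"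
  assumes "smooth (\<lambda>y::real^'n. \<Prod>j\<in>UNIV. f j (y $ j))"
    and "(f i has_real_derivative d) (at (y $ i))"
  shows "dir_deriv (\<lambda>y::real^'n. \<Prod>j\<in>UNIV. f j (y $ j)) (axis i 1) y
       = d * (\<Prod>j\<in>UNIV - {i}. f j (y $ j))"
proof -
  have eq: "(\<Prod>j\<in>UNIV. f j ((y + h *\<^sub>R axis i 1) $ j))
      = f i (y $ i + h) * (\<Prod>j\<in>UNIV - {i}. f j (y $ j))" for h
    by (subst prod.remove[of UNIV i]) (auto simp: axis_def intro!: prod.cong)
  have "((\<lambda>h. f i (y $ i + h) * (\<Prod>j\<in>UNIV - {i}. f j (y $ j))) has_real_derivative
      d * (\<Prod>j\<in>UNIV - {i}. f j (y $ j))) (at 0)"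
    by (intro DERIV_cmult_right) (use assms(2) DERIV_shift[of "f i" d 0 "y $ i"] in \<open>simp add: add.commute\<close>)
  with dir_deriv_along_line[OF smooth_differentiable[OF assms(1)], of y "axis i 1"]
  show ?thesis unfolding eq by (rule DERIV_unique)
qed

definition hump' :: "real \<Rightarrow> real" where "hump' = dir_deriv hump 1"

lemma smooth_hump_real: "smooth hump"
  using smooth_hump[of "1::real" 0] by simp

lemma hump_has_derivative: "(hump has_real_derivative hump' s) (at s)"
  using dir_deriv_along_line[OF smooth_differentiable[OF smooth_hump_real], of s 1]
    DERIV_shift[of hump "hump' s" 0 s]
  by (simp add: hump'_def add.commute[of s])

lemma hump'_eq_0: assumes "s \<notin> {0..1}" shows "hump' s = 0"
proof -
  have "(hump has_real_derivative 0) (at s)"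
    by (rule has_field_derivative_transform_within_open[of "\<lambda>_. 0" _ _ "- {0..1}"])
       (use assms in \<open>auto simp: hump_eq_0\<close>)
  then show ?thesis using hump_has_derivative DERIV_unique by blast
qed

text \<open>
  The bound is at least 1 so that it can also serve as a bound for the ramp.
\<close>

definition hump_bound :: real where
  "hump_bound = (SOME C. 1 \<le> C \<and> (\<forall>s. hump s \<le> C \<and> \<bar>hump' s\<bar> \<le> C))"

lemma hump_bound: "1 \<le> hump_bound" "hump s \<le> hump_bound" "\<bar>hump' s\<bar> \<le> hump_bound"
proof -
  have "continuous_on {0..1} hump'"
    unfolding hump'_def by (intro smooth_continuous_on smooth_dir_deriv smooth_hump_real)
  then have "bounded (hump' ` {0..1})" "bounded (hump ` {0..1})"
    by (auto intro!: compact_imp_bounded compact_continuous_image continuous_on_hump)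
  then obtain B1 B2 where B: "\<And>s. s \<in> {0..1} \<Longrightarrow> \<bar>hump' s\<bar> \<le> B1" "\<And>s. s \<in> {0..1} \<Longrightarrow> \<bar>hump s\<bar> \<le> B2"
    unfolding bounded_iff by (metis imageI real_norm_def)
  have "hump s \<le> max 1 (max B1 B2) \<and> \<bar>hump' s\<bar> \<le> max 1 (max B1 B2)" for s
  proof (cases "s \<in> {0..1}")
    case True
    then show ?thesis using B[of s] by auto
  next
    case False
    then show ?thesis using hump'_eq_0[of s] hump_eq_0[of s] by auto
  qed
  then have "\<exists>C. 1 \<le> C \<and> (\<forall>s. hump s \<le> C \<and> \<bar>hump' s\<bar> \<le> C)"
    by (intro exI[of _ "max 1 (max B1 B2)"]) auto
  from someI_ex[OF this, folded hump_bound_def]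
  show "1 \<le> hump_bound" "hump s \<le> hump_bound" "\<bar>hump' s\<bar> \<le> hump_bound" by auto
qed

text \<open>
  The hump scaled to the interval \<open>(t, t + s)\<close>, with integral 1.
\<close>

definition pulse :: "real \<Rightarrow> real \<Rightarrow> real \<Rightarrow> real" where
  "pulse t s \<tau> = hump ((\<tau> - t) / s) / s"

text \<open>
  A probability density on the box with corner \<open>x\<close> and side lengths \<open>w\<close>. The product structure lets
  each side length be changed separately, and the position of \<open>x\<close> at a corner matches the cubes
  \<open>cbox z (z + d *\<^sub>R One)\<close> used for Lebesgue points below.
\<close>

definition kern :: "real^'n \<Rightarrow> ('n \<Rightarrow> real) \<Rightarrow> real^'n \<Rightarrow> real" where
  "kern x w y = (\<Prod>j\<in>UNIV. pulse (x $ j) (w j) (y $ j))"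

lemma pulse_nonneg: "0 < s \<Longrightarrow> 0 \<le> pulse t s \<tau>"
  by (simp add: pulse_def hump_nonneg)

lemma pulse_le: "0 < s \<Longrightarrow> pulse t s \<tau> \<le> hump_bound / s"
  by (simp add: pulse_def hump_bound divide_right_mono)

lemma pulse_eq_0: "0 < s \<Longrightarrow> \<tau> \<notin> {t<..<t + s} \<Longrightarrow> pulse t s \<tau> = 0"
  by (auto simp: pulse_def intro!: hump_eq_0) (auto simp: field_simps)

lemma pulse_nonzeroD: "pulse t s \<tau> \<noteq> 0 \<Longrightarrow> 0 < s \<Longrightarrow> t < \<tau> \<and> \<tau> < t + s"
  using pulse_eq_0[of s \<tau> t] by auto

lemma smooth_pulse_real: "smooth (pulse t s)"
proof -
  have "smooth (\<lambda>\<tau>::real. hump (\<tau> \<bullet> (1 / s) + (- t / s)) * (1 / s))"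
    by (intro smooth_mult smooth_hump smooth_const)
  then show ?thesis by (simp add: pulse_def[abs_def] diff_divide_distrib)
qed

lemma smooth_coordinate:
  assumes "smooth (f :: real \<Rightarrow> real)"
  shows "smooth (\<lambda>y::real^'n. f (y $ j))"
  by (rule smooth_compose_linear[OF assms, where l'="axis j"]) (simp add: inner_axis)

lemma smooth_kern: "smooth (kern x w)"
  unfolding kern_def[abs_def] by (intro smooth_prod smooth_coordinate smooth_pulse_real) auto

lemma kern_nonneg: "(\<And>j. 0 < w j) \<Longrightarrow> 0 \<le> kern x w y"
  by (auto simp: kern_def intro!: prod_nonneg pulse_nonneg)

lemma kern_nonzeroD:
  assumes "kern x w y \<noteq> 0" "\<And>j. 0 < w j"
  shows "x $ j < y $ j \<and> y $ j < x $ j + w j"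
proof -
  have "pulse (x $ j) (w j) (y $ j) \<noteq> 0" using assms(1) by (auto simp: kern_def)
  then show ?thesis using pulse_eq_0[OF assms(2)[of j]] by (metis greaterThanLessThan_iff)
qed

lemma pulse_has_derivative:
  "(pulse t s has_real_derivative hump' ((\<tau> - t) / s) / s / s) (at \<tau>)"
proof -
  have "((\<lambda>\<tau>. hump ((\<tau> - t) / s) / s) has_real_derivative (hump' ((\<tau> - t) / s) * (1 / s)) / s) (at \<tau>)"
    by (intro DERIV_cdivide DERIV_chain2[where f=hump, OF hump_has_derivative])
       (auto intro!: derivative_eq_intros)
  then show ?thesis by (simp add: pulse_def[abs_def])
qed

lemma ramp_scaled_has_derivative:
  "s \<noteq> 0 \<Longrightarrow> ((\<lambda>\<tau>. ramp ((\<tau> - t) / s)) has_real_derivative pulse t s \<tau>) (at \<tau>)"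
proof -
  assume "s \<noteq> 0"
  then have "((\<lambda>\<tau>. ramp ((\<tau> - t) / s)) has_real_derivative (hump ((\<tau> - t) / s) * (1 / s))) (at \<tau>)"
    by (intro DERIV_chain2[where f=ramp, OF ramp_has_derivative])
       (auto intro!: derivative_eq_intros)
  then show ?thesis by (simp add: pulse_def)
qed

lemma smooth_ramp_scaled: "smooth (\<lambda>\<tau>::real. ramp ((\<tau> - t) / s))"
  using smooth_ramp[of "1 / s :: real" "- t / s"] by (simp add: diff_divide_distrib)

lemma box_subset_ball:
  fixes x :: "real^'n"
  assumes "\<And>j. x $ j \<le> y $ j \<and> y $ j \<le> x $ j + \<rho>" "0 < \<rho>"
  shows "dist x y \<le> real CARD('n) * \<rho>"
proof -
  have "norm (y - x) \<le> (\<Sum>j\<in>UNIV. \<bar>(y - x) $ j\<bar>)" by (rule norm_le_l1_cart)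
  also have "\<dots> \<le> (\<Sum>j\<in>(UNIV::'n set). \<rho>)" by (intro sum_mono) (use assms in \<open>auto simp: abs_le_iff\<close>, smt (verit) assms)
  finally show ?thesis by (simp add: dist_norm norm_minus_commute)
qed

lemma nn_integral_pulse:
  assumes "0 < s" shows "(\<integral>\<^sup>+\<tau>. ennreal (pulse t s \<tau>) \<partial>lborel) = 1"
proof -
  have "(\<integral>\<^sup>+\<tau>. ennreal (pulse t s \<tau>) \<partial>lborel)
      = (\<integral>\<^sup>+\<tau>. ennreal (pulse t s \<tau>) * indicator {t..t + s} \<tau> \<partial>lborel)"
    using pulse_eq_0[OF assms] by (intro nn_integral_cong) (auto simp: indicator_def)
  also have "\<dots> = ennreal (ramp ((t + s - t) / s) - ramp ((t - t) / s))"
    using assms ramp_scaled_has_derivative pulse_nonneg[OF assms]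
    by (intro nn_integral_FTC_Icc) (auto intro: smooth_imp_measurable smooth_pulse_real has_field_derivative_at_within)
  also have "\<dots> = 1" using assms by (simp add: ramp_eq_1 ramp_eq_0)
  finally show ?thesis .
qed

text \<open>
  The product of the two kernels is a product over the coordinates of space-time, so its mass is the
  product of the masses of the pulses.
\<close>

lemma nn_integral_kern_pulse:
  fixes x :: "real^'n"
  assumes "0 < h"
  shows "(\<integral>\<^sup>+z. ennreal (kern x (\<lambda>_. h) (fst z) * pulse t h (snd z)) \<partial>lborel) = 1"
proof -
  have "kern x (\<lambda>_. h) (fst z) * pulse t h (snd z)
      = (\<Prod>b\<in>Basis. pulse ((x, t) \<bullet> b) h (z \<bullet> b))" for z
  proof -
    have "(\<Prod>b\<in>(Basis::((real^'n)\<times>real) set). pulse ((x, t) \<bullet> b) h (z \<bullet> b))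
      = (\<Prod>b\<in>(Basis::(real^'n) set). pulse (x \<bullet> b) h (fst z \<bullet> b)) * pulse t h (snd z)"
      unfolding Basis_prod_def
      by (cases z, subst prod.union_disjoint) (auto simp: prod.reindex inj_on_def)
    also have "(\<Prod>b\<in>(Basis::(real^'n) set). pulse (x \<bullet> b) h (fst z \<bullet> b)) = kern x (\<lambda>_. h) (fst z)"
    proof -
      have B: "(Basis::(real^'n) set) = (\<lambda>j. axis j 1) ` UNIV" by (auto simp: Basis_vec_def)
      have "inj (\<lambda>j. axis j (1::real) :: real^'n)" by (simp add: inj_on_def axis_eq_axis)
      then show ?thesis
        unfolding B by (subst prod.reindex) (simp_all add: kern_def inner_axis)
    qed
    finally show ?thesis by simp
  qed
  then have "(\<integral>\<^sup>+z. ennreal (kern x (\<lambda>_. h) (fst z) * pulse t h (snd z)) \<partial>lborel)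
    = (\<integral>\<^sup>+z. (\<Prod>b\<in>Basis. ennreal (pulse ((x, t) \<bullet> b) h (z \<bullet> b))) \<partial>lborel)"
    using assms by (simp add: prod_ennreal pulse_nonneg)
  also have "\<dots> = (\<Prod>b\<in>Basis. \<integral>\<^sup>+\<tau>. ennreal (pulse ((x, t) \<bullet> b) h \<tau>) \<partial>lborel)"
    by (intro nn_integral_lborel_prod)
       (auto intro!: measurable_compose[OF _ measurable_ennreal] intro: smooth_imp_measurable smooth_pulse_real)
  also have "\<dots> = 1" using assms by (simp add: nn_integral_pulse)
  finally show ?thesis .
qed

lemma pulse_abs_le:
  assumes "\<rho> / 2 \<le> w" "0 < \<rho>"
  shows "\<bar>pulse t w \<tau>\<bar> \<le> 2 * hump_bound / \<rho>"
proof -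
  have w: "0 < w" using assms by linarith
  have "pulse t w \<tau> \<le> hump_bound / w" by (rule pulse_le[OF w])
  also have "\<dots> \<le> hump_bound / (\<rho> / 2)"
    using assms hump_bound(1) by (intro divide_left_mono) (auto intro: mult_pos_pos w)
  finally show ?thesis using pulse_nonneg[OF w, of t \<tau>] by (simp add: mult.commute)
qed

lemma kern_abs_le:
  fixes x :: "real^'n"
  assumes "\<And>j. \<rho> / 2 \<le> w j" "0 < \<rho>"
  shows "\<bar>kern x w y\<bar> \<le> (2 * hump_bound / \<rho>) ^ CARD('n)"
proof -
  have "\<bar>kern x w y\<bar> = (\<Prod>j\<in>UNIV. \<bar>pulse (x $ j) (w j) (y $ j)\<bar>)" by (simp add: kern_def abs_prod)
  also have "\<dots> \<le> (\<Prod>j\<in>(UNIV::'n set). 2 * hump_bound / \<rho>)"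
    by (intro prod_mono) (simp add: pulse_abs_le[OF assms])
  finally show ?thesis by simp
qed

lemma measurable_tensor:
  assumes "\<alpha> \<in> borel_measurable borel" "\<theta> \<in> borel_measurable borel"
  shows "(\<lambda>z::'a::euclidean_space \<times> 'b::euclidean_space. (\<alpha> (fst z) * \<theta> (snd z)) :: real) \<in> borel_measurable borel"
  using assms by (auto intro!: borel_measurable_times measurable_compose[OF measurable_fst] measurable_compose[OF measurable_snd] simp: borel_prod[symmetric])

lemma kern_pulse_measurable:
  "(\<lambda>z. kern x w (fst z) * pulse t s (snd z)) \<in> borel_measurable borel"
  by (intro measurable_tensor smooth_imp_measurable smooth_kern smooth_pulse_real)

lemma kern_pulse_abs_le:
  fixes x :: "real^'n"
  assumes "\<And>j. \<rho> / 2 \<le> w j" "0 < \<rho>" "0 < s"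
  shows "\<bar>kern x w y * pulse t s \<tau>\<bar> \<le> (2 * hump_bound / \<rho>) ^ CARD('n) * (hump_bound / s)"
  unfolding abs_mult using assms kern_abs_le[OF assms(1,2)] pulse_le[OF assms(3), of t \<tau>] pulse_nonneg[OF assms(3), of t \<tau>] hump_bound(1)
  by (intro mult_mono) auto

lemma box_in_ball:
  fixes x :: "real^'n"
  assumes "\<And>j. x $ j \<le> y $ j \<and> y $ j \<le> x $ j + \<rho>" "0 < \<rho>"
  shows "y \<in> ball x (2 * real CARD('n) * \<rho>)"
proof -
  have "dist x y \<le> real CARD('n) * \<rho>" by (rule box_subset_ball[OF assms])
  also have "\<dots> < 2 * real CARD('n) * \<rho>" using \<open>0 < \<rho>\<close> by simp
  finally show ?thesis by simp
qed

lemma kern_dir_deriv_le: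
  fixes x y :: "real^'n"
  assumes "0 < \<rho>"
  shows "\<bar>dir_deriv (kern x (\<lambda>_. \<rho>)) (axis i 1) y\<bar> \<le> hump_bound ^ CARD('n) / \<rho> ^ Suc CARD('n)"
proof -
  let ?n = "CARD('n)"
  let ?f = "\<lambda>j. pulse (x $ j) \<rho>"
  have "smooth (\<lambda>y. \<Prod>j\<in>UNIV. ?f j (y $ j))"
    using smooth_kern[of x "\<lambda>_. \<rho>"] by (simp add: kern_def[abs_def])
  from dir_deriv_prod_coordinates[OF this pulse_has_derivative, of i y]
  have "\<bar>dir_deriv (kern x (\<lambda>_. \<rho>)) (axis i 1) y\<bar>
     = \<bar>hump' ((y $ i - x $ i) / \<rho>) / \<rho> / \<rho>\<bar> * (\<Prod>j\<in>UNIV - {i}. \<bar>?f j (y $ j)\<bar>)"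
    unfolding kern_def[abs_def] by (simp only: abs_mult abs_prod)
  also have "\<dots> \<le> (hump_bound / \<rho> / \<rho>) * (\<Prod>j\<in>UNIV - {i}. hump_bound / \<rho>)"
  proof (rule mult_mono)
    show "\<bar>hump' ((y $ i - x $ i) / \<rho>) / \<rho> / \<rho>\<bar> \<le> hump_bound / \<rho> / \<rho>"
      using assms hump_bound(3) by (simp add: divide_right_mono)
    show "(\<Prod>j\<in>UNIV - {i}. \<bar>?f j (y $ j)\<bar>) \<le> (\<Prod>j\<in>UNIV - {i}. hump_bound / \<rho>)"
      by (rule prod_mono) (simp add: pulse_le[OF assms] pulse_nonneg[OF assms])
  qed (use assms hump_bound(1) in \<open>simp_all add: prod_nonneg\<close>)
  also have "\<dots> = (hump_bound / \<rho>) * (hump_bound / \<rho>) ^ (?n - 1) / \<rho>"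
    by (simp add: card_Diff_singleton)
  also have "(hump_bound / \<rho>) * (hump_bound / \<rho>) ^ (?n - 1) = (hump_bound / \<rho>) ^ ?n"
    by (simp add: power_eq_if)
  also have "(hump_bound / \<rho>) ^ ?n / \<rho> = hump_bound ^ ?n / \<rho> ^ Suc ?n"
    by (simp add: power_divide)
  finally show ?thesis .
qed

lemma kern_dir_deriv_eq_0:
  fixes x y :: "real^'n"
  assumes "0 < \<rho>" "\<not> (\<forall>j. x $ j \<le> y $ j \<and> y $ j \<le> x $ j + \<rho>)"
  shows "dir_deriv (kern x (\<lambda>_. \<rho>)) b y = 0"
proof (rule dir_deriv_eq_0_outside)
  let ?B = "cbox x (\<chi> j. x $ j + \<rho>)"
  show "closed ?B" by (rule closed_cbox)
  show "y \<notin> ?B" using assms(2) by (simp add: mem_box_cart)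
  show "kern x (\<lambda>_. \<rho>) z = 0" if "z \<notin> ?B" for z
  proof (rule ccontr)
    assume "kern x (\<lambda>_. \<rho>) z \<noteq> 0"
    then have "x $ j < z $ j \<and> z $ j < x $ j + \<rho>" for j
      by (rule kern_nonzeroD) (rule assms(1))
    then have "x $ j \<le> z $ j \<and> z $ j \<le> x $ j + \<rho>" for j
      by (simp add: order_less_imp_le)
    then have "z \<in> ?B" by (simp add: mem_box_cart)
    with that show False by simp
  qed
qed

section \<open>Averages over cylinders centred at a point\<close>

lemma borel_measurable_lebesgue_on:
  "g \<in> borel_measurable borel \<Longrightarrow> g \<in> borel_measurable (lebesgue_on S)"
  by (intro measurable_restrict_space1 measurable_completion) simp

lemma integrable_mult_bounded:
  fixes f g :: "'a::euclidean_space \<Rightarrow> real"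
  assumes "integrable (lebesgue_on S) f" "g \<in> borel_measurable borel" "\<And>z. \<bar>g z\<bar> \<le> B"
  shows "integrable (lebesgue_on S) (\<lambda>z. f z * g z)"
proof (rule Bochner_Integration.integrable_bound)
  show "integrable (lebesgue_on S) (\<lambda>z. B * f z)" using assms by simp
  show "(\<lambda>z. f z * g z) \<in> borel_measurable (lebesgue_on S)"
    using assms borel_measurable_lebesgue_on by (intro borel_measurable_times) auto
  have "0 \<le> B" using assms(3) by (meson abs_ge_zero order_trans)
  then show "AE z in lebesgue_on S. norm (f z * g z) \<le> norm (B * f z)"
    using mult_right_mono[OF assms(3) abs_ge_zero] by (intro AE_I2) (simp add: abs_mult mult.commute)
qed

text \<open>
  Cylinders centred at a point of space-time, with independent radius and half-length. Every support that
  occurs is contained in such a cylinder, and these are admissible in the strong maximal function.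
\<close>

definition bicyl :: "(real^'n) \<times> real \<Rightarrow> real \<Rightarrow> real \<Rightarrow> ((real^'n) \<times> real) set" where
  "bicyl z R \<sigma> = ball (fst z) R \<times> {snd z - \<sigma><..<snd z + \<sigma>}"

text \<open>
  The volume of \<open>bicyl z R \<sigma>\<close>.
\<close>

definition bivol :: "'n itself \<Rightarrow> real \<Rightarrow> real \<Rightarrow> real" where
  "bivol _ R \<sigma> = unit_ball_vol (real CARD('n)) * R ^ CARD('n) * (2 * \<sigma>)"

text \<open>
  A real-valued form of "the maximal function of \<open>f\<close>, extended by zero outside \<open>S\<close>, is at most \<open>m\<close>
  at \<open>z\<close>", restricted to cylinders centred at \<open>z\<close>.
\<close>

definition avg_le :: "((real^'n) \<times> real) set \<Rightarrow> ((real^'n) \<times> real \<Rightarrow> real) \<Rightarrow> real \<Rightarrow> (real^'n) \<times> real \<Rightarrow> bool" where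
  "avg_le S f m z \<longleftrightarrow> (\<forall>R>0. \<forall>\<sigma>>0.
     (\<integral>\<zeta>. f \<zeta> * indicator (bicyl z R \<sigma>) \<zeta> \<partial>lebesgue_on S) \<le> m * bivol TYPE('n) R \<sigma>)"

lemma bicyl_borel [measurable]: "bicyl z R \<sigma> \<in> sets borel"
  unfolding bicyl_def by (intro borel_open open_Times) auto

text \<open>
  The only way in which maximal functions enter the estimates of the smoothed values: a weight that is
  bounded by \<open>B\<close> and supported in a cylinder around \<open>z\<close> picks up at most \<open>B\<close> times the
  volume of the cylinder times \<open>m\<close>.
\<close>

lemma avg_le_weighted:
  fixes z :: "(real^'n) \<times> real"
  assumes f: "integrable (lebesgue_on S) f" "\<And>\<zeta>. 0 \<le> f \<zeta>" and avg: "avg_le S f m z"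
    and g: "g \<in> borel_measurable borel" "\<And>\<zeta>. \<bar>g \<zeta>\<bar> \<le> B * indicator (bicyl z R \<sigma>) \<zeta>"
    and pos: "0 < R" "0 < \<sigma>"
  shows "(\<integral>\<zeta>. f \<zeta> * \<bar>g \<zeta>\<bar> \<partial>lebesgue_on S) \<le> B * (m * bivol TYPE('n) R \<sigma>)"
proof -
  have "z \<in> bicyl z R \<sigma>" using pos by (auto simp: bicyl_def mem_Times_iff)
  then have "0 \<le> B" using g(2)[of z] by (simp add: indicator_def split: if_splits)
  have gB: "\<bar>g \<zeta>\<bar> \<le> B" for \<zeta>
    using g(2)[of \<zeta>] \<open>0 \<le> B\<close> by (cases "\<zeta> \<in> bicyl z R \<sigma>") auto
  have "(\<integral>\<zeta>. f \<zeta> * \<bar>g \<zeta>\<bar> \<partial>lebesgue_on S)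
      \<le> (\<integral>\<zeta>. B * (f \<zeta> * indicator (bicyl z R \<sigma>) \<zeta>) \<partial>lebesgue_on S)"
  proof (rule integral_mono)
    show "integrable (lebesgue_on S) (\<lambda>\<zeta>. f \<zeta> * \<bar>g \<zeta>\<bar>)"
      using f(1) by (rule integrable_mult_bounded[where B=B]) (use g gB in auto)
    show "integrable (lebesgue_on S) (\<lambda>\<zeta>. B * (f \<zeta> * indicator (bicyl z R \<sigma>) \<zeta>))"
      by (intro integrable_mult_right integrable_mult_bounded[where B=1] f) (auto simp: indicator_def)
    show "f \<zeta> * \<bar>g \<zeta>\<bar> \<le> B * (f \<zeta> * indicator (bicyl z R \<sigma>) \<zeta>)" for \<zeta>
      using mult_left_mono[OF g(2)[of \<zeta>] f(2)[of \<zeta>]] by (simp add: mult_ac)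
  qed
  also have "\<dots> = B * (\<integral>\<zeta>. f \<zeta> * indicator (bicyl z R \<sigma>) \<zeta> \<partial>lebesgue_on S)" by simp
  also have "\<dots> \<le> B * (m * bivol TYPE('n) R \<sigma>)"
    using avg pos \<open>0 \<le> B\<close> by (intro mult_left_mono) (auto simp: avg_le_def)
  finally show ?thesis .
qed

section \<open>Smoothed values of a function with a weak gradient and a weak time derivative\<close>

lemma cylinder_lmeasurable: "cylinder x0 t0 r \<in> lmeasurable"
proof (rule lmeasurable_open)
  show "bounded (cylinder x0 t0 r)"
    unfolding cylinder_def time_interval_def by (intro bounded_Times) auto
  show "open (cylinder x0 t0 r)"
    unfolding cylinder_def time_interval_def by (intro open_Times) auto
qed

text \<open>
  The constants of the three basic estimates below, as functions of the dimension.
\<close>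

definition C_space :: "nat \<Rightarrow> real" where
  "C_space n = 2 ^ n * hump_bound ^ Suc n * unit_ball_vol (real n) * (2 * real n) ^ n * 4"

lemma C_space_nonneg: "0 \<le> C_space n"
  using hump_bound(1) by (simp add: C_space_def)

definition C_time :: "nat \<Rightarrow> real" where
  "C_time n = 2 * real n * hump_bound ^ n * unit_ball_vol (real n) * (2 * real n) ^ n"

lemma C_time_nonneg: "0 \<le> C_time n"
  using hump_bound(1) by (simp add: C_time_def)

definition C_point :: "nat \<Rightarrow> real" where
  "C_point n = hump_bound ^ Suc n * unit_ball_vol (real n) * (2 * real n) ^ n * 4 * 2 ^ n"

lemma C_point_nonneg: "0 \<le> C_point n"
  using hump_bound(1) by (simp add: C_point_def)

text \<open>
  Cubes with corner \<open>z\<close> rather than balls: they carry the kernels, whose spatial and temporal widths agree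
  in the end. For such isotropic cubes almost every point is a Lebesgue point of an integrable function.
\<close>

definition lebesgue_point :: "'a::euclidean_space set \<Rightarrow> ('a \<Rightarrow> real) \<Rightarrow> 'a \<Rightarrow> bool" where
  "lebesgue_point S v z \<longleftrightarrow>
     ((\<lambda>d. (\<integral>\<zeta>. \<bar>v \<zeta> - v z\<bar> * indicator (cbox z (z + d *\<^sub>R One)) \<zeta> \<partial>lebesgue_on S) / d ^ DIM('a))
      \<longlongrightarrow> 0) (at_right 0)"

text \<open>
  What the proof uses of one scalar component \<open>v\<close> of a solution: its weak spatial gradient is dominated by
  \<open>h\<close> and its weak time derivative is the divergence of a field dominated by \<open>\<Phi>\<close>. Both are
  recorded as inequalities for test functions that are products, which keeps the vector-valued field and
  its nonlinear structure out of the estimates.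
\<close>

locale weak_cylinder =
  fixes x0 :: "real^'n" and t0 r :: real and v h \<Phi> :: "(real^'n) \<times> real \<Rightarrow> real"
  assumes r: "0 < r"
    and v: "integrable (lebesgue_on (cylinder x0 t0 (2 * r))) v"
    and h: "integrable (lebesgue_on (cylinder x0 t0 (2 * r))) h" "\<And>z. 0 \<le> h z"
    and \<Phi>: "integrable (lebesgue_on (cylinder x0 t0 (2 * r))) \<Phi>" "\<And>z. 0 \<le> \<Phi> z"
    and weak_gradient: "\<And>\<alpha> \<theta> j. smooth \<alpha> \<Longrightarrow> \<alpha> \<in> test_functions (ball x0 (2 * r)) \<Longrightarrow>
      smooth \<theta> \<Longrightarrow> \<theta> \<in> test_functions (time_interval t0 (2 * r)) \<Longrightarrow>
      \<bar>\<integral>z. v z * (dir_deriv \<alpha> (axis j 1) (fst z) * \<theta> (snd z)) \<partial>lebesgue_on (cylinder x0 t0 (2 * r))\<bar>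
      \<le> (\<integral>z. h z * \<bar>\<alpha> (fst z) * \<theta> (snd z)\<bar> \<partial>lebesgue_on (cylinder x0 t0 (2 * r)))"
    and weak_time_derivative: "\<And>\<alpha> \<theta>. smooth \<alpha> \<Longrightarrow> \<alpha> \<in> test_functions (ball x0 (2 * r)) \<Longrightarrow>
      smooth \<theta> \<Longrightarrow> \<theta> \<in> test_functions (time_interval t0 (2 * r)) \<Longrightarrow>
      \<bar>\<integral>z. v z * (\<alpha> (fst z) * dir_deriv \<theta> 1 (snd z)) \<partial>lebesgue_on (cylinder x0 t0 (2 * r))\<bar>
      \<le> (\<integral>z. \<Phi> z * \<bar>(\<Sum>j\<in>UNIV. \<bar>dir_deriv \<alpha> (axis j 1) (fst z)\<bar>) * \<theta> (snd z)\<bar>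
             \<partial>lebesgue_on (cylinder x0 t0 (2 * r)))"
begin

abbreviation "Q2 \<equiv> cylinder x0 t0 (2 * r)"

text \<open>
  The value of \<open>v\<close> at \<open>(x, t)\<close>, smoothed by a kernel with spatial widths \<open>w\<close> and temporal width
  \<open>s\<close>.
\<close>

definition moll :: "real^'n \<Rightarrow> real \<Rightarrow> ('n \<Rightarrow> real) \<Rightarrow> real \<Rightarrow> real" where
  "moll x t w s = (\<integral>z. v z * (kern x w (fst z) * pulse t s (snd z)) \<partial>lebesgue_on Q2)"

lemma moll_integrable:
  assumes "\<And>j. \<rho> / 2 \<le> w j" "0 < \<rho>" "0 < s"
  shows "integrable (lebesgue_on Q2) (\<lambda>z. v z * (kern x w (fst z) * pulse t s (snd z)))"
  by (rule integrable_mult_bounded[OF v kern_pulse_measurable]) (rule kern_pulse_abs_le[OF assms])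

text \<open>
  The kernel of temporal width \<open>s\<close> started at time \<open>t\<close> fits into the time interval of the doubled
  cylinder; the spatial condition that goes with it is \<open>CARD('n) * \<rho> < r\<close>.
\<close>

definition admissible :: "real^'n \<Rightarrow> real \<Rightarrow> real \<Rightarrow> bool" where
  "admissible x t s \<longleftrightarrow> 0 < s \<and> t0 - (2 * r)\<^sup>2 < t \<and> t + s < t0 + (2 * r)\<^sup>2 \<and> x \<in> ball x0 r"

lemma box_test_function:
  fixes x :: "real^'n"
  assumes "smooth \<alpha>" "x \<in> ball x0 r" "real CARD('n) * \<rho> < r" "0 < \<rho>"
    and supp: "\<And>y. \<alpha> y \<noteq> 0 \<Longrightarrow> \<forall>j. x $ j \<le> y $ j \<and> y $ j \<le> x $ j + \<rho>"
  shows "\<alpha> \<in> test_functions (ball x0 (2 * r))"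
proof (rule smooth_test_function[where K="cball x (real CARD('n) * \<rho>)"])
  show "cball x (real CARD('n) * \<rho>) \<subseteq> ball x0 (2 * r)"
  proof
    fix y assume "y \<in> cball x (real CARD('n) * \<rho>)"
    then show "y \<in> ball x0 (2 * r)"
      using assms(2,3) dist_triangle[of x0 y x] by simp
  qed
  show "\<alpha> y = 0" if "y \<notin> cball x (real CARD('n) * \<rho>)" for y
  proof (rule ccontr)
    assume "\<alpha> y \<noteq> 0"
    from box_subset_ball[of x y \<rho>] supp[OF this] \<open>0 < \<rho>\<close> that show False by auto
  qed
qed (use assms in auto)

lemma interval_test_function:
  assumes "smooth \<theta>" "t0 - (2 * r)\<^sup>2 < a" "b < t0 + (2 * r)\<^sup>2"
    and "\<And>\<tau>. \<theta> \<tau> \<noteq> 0 \<Longrightarrow> a \<le> \<tau> \<and> \<tau> \<le> b"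
  shows "\<theta> \<in> test_functions (time_interval t0 (2 * r))"
  by (rule smooth_test_function[where K="{a..b}"])
     (use assms in \<open>auto simp: time_interval_def\<close>)

text \<open>
  Two kernels that differ only in the width of the \<open>i\<close>-th side have the same mass on every line in
  direction \<open>i\<close>. Therefore their difference is the \<open>i\<close>-th derivative of a compactly supported
  function, and the difference of the smoothed values is controlled by the gradient. The antiderivative
  is smaller than the kernels by a factor of order \<open>\<rho>\<close>.
\<close>

lemma moll_halve_width:
  assumes avg: "avg_le Q2 h m (x, t)" and adm: "admissible x t s"
    and \<rho>: "0 < \<rho>" "real CARD('n) * \<rho> < r"
    and w: "\<And>j. \<rho> / 2 \<le> w j" "\<And>j. w j \<le> \<rho>" "w i = \<rho>"
  shows "\<bar>moll x t w s - moll x t (w(i := \<rho> / 2)) s\<bar> \<le> C_space CARD('n) * \<rho> * m"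
proof -
  let ?n = "CARD('n)"
  define w' where "w' = w(i := \<rho> / 2)"
  \<comment> \<open>the factor of the side \<open>i\<close> is the antiderivative of the difference of the two pulses\<close>
  define f where "f j = (if j = i then (\<lambda>\<eta>. ramp ((\<eta> - x $ i) / \<rho>) - ramp ((\<eta> - x $ i) / (\<rho> / 2)))
     else pulse (x $ j) (w j))" for j
  define \<alpha> where "\<alpha> y = (\<Prod>j\<in>UNIV. f j (y $ j))" for y :: "real^'n"
  have wpos: "0 < w j" for j using w(1)[of j] \<rho> by linarith
  have s: "0 < s" and x: "x \<in> ball x0 r" using adm by (auto simp: admissible_def)
  have sm_f: "smooth (f j)" for j
    by (cases "j = i") (simp_all only: f_def if_True if_False simp_thms smooth_diff smooth_ramp_scaled smooth_pulse_real)
  have sm: "smooth \<alpha>" unfolding \<alpha>_def[abs_def]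
    by (intro smooth_prod smooth_coordinate sm_f) auto
  have deriv: "dir_deriv \<alpha> (axis i 1) y = kern x w y - kern x w' y" for y
  proof -
    have "(f i has_real_derivative (pulse (x $ i) \<rho> (y $ i) - pulse (x $ i) (\<rho> / 2) (y $ i))) (at (y $ i))"
      unfolding f_def if_P[OF refl] using \<rho> by (intro DERIV_diff ramp_scaled_has_derivative) auto
    from dir_deriv_prod_coordinates[OF sm[unfolded \<alpha>_def[abs_def]] this]
    have "dir_deriv \<alpha> (axis i 1) y
       = (pulse (x $ i) \<rho> (y $ i) - pulse (x $ i) (\<rho> / 2) (y $ i)) * (\<Prod>j\<in>UNIV - {i}. f j (y $ j))"
      by (simp add: \<alpha>_def[abs_def])
    also have "(\<Prod>j\<in>UNIV - {i}. f j (y $ j)) = (\<Prod>j\<in>UNIV - {i}. pulse (x $ j) (w j) (y $ j))"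
      by (intro prod.cong) (auto simp: f_def)
    also have "(pulse (x $ i) \<rho> (y $ i) - pulse (x $ i) (\<rho> / 2) (y $ i)) * \<dots> = kern x w y - kern x w' y"
    proof -
      have "kern x w y = pulse (x $ i) \<rho> (y $ i) * (\<Prod>j\<in>UNIV - {i}. pulse (x $ j) (w j) (y $ j))"
        unfolding kern_def by (subst prod.remove[of UNIV i]) (auto simp: w)
      moreover have "kern x w' y = pulse (x $ i) (\<rho> / 2) (y $ i) * (\<Prod>j\<in>UNIV - {i}. pulse (x $ j) (w j) (y $ j))"
        unfolding kern_def by (subst prod.remove[of UNIV i]) (auto simp: w'_def intro!: prod.cong)
      ultimately show ?thesis by (simp add: algebra_simps)
    qed
    finally show ?thesis .
  qed
  have supp: "\<forall>j. x $ j \<le> y $ j \<and> y $ j \<le> x $ j + \<rho>" if "\<alpha> y \<noteq> 0" for y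
  proof
    fix j
    have nz: "f j (y $ j) \<noteq> 0" using that by (auto simp: \<alpha>_def)
    show "x $ j \<le> y $ j \<and> y $ j \<le> x $ j + \<rho>"
    proof (cases "j = i")
      case True
      show ?thesis
      proof (rule ccontr)
        assume "\<not> ?thesis"
        then consider "y $ i < x $ i" | "x $ i + \<rho> < y $ i" using True by force
        then have "f i (y $ i) = 0"
        proof cases
          case 1
          then show ?thesis using \<rho> by (simp add: f_def ramp_eq_0 divide_nonpos_pos)
        next
          case 2
          then show ?thesis using \<rho> by (simp add: f_def ramp_eq_1 field_simps)
        qed
        with nz True show False by simp
      qed
    next
      case False
      then have "pulse (x $ j) (w j) (y $ j) \<noteq> 0" using nz by (simp add: f_def)
      then show ?thesis using pulse_nonzeroD[OF _ wpos, of "x $ j" j "y $ j"] w(2)[of j] by linarith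
    qed
  qed
  have bound: "\<bar>\<alpha> y\<bar> \<le> \<rho> * (2 * hump_bound / \<rho>) ^ ?n" for y
  proof -
    let ?b = "2 * hump_bound / \<rho>"
    have b: "0 \<le> ?b" using \<rho> hump_bound(1) by simp
    have fj: "\<bar>f j (y $ j)\<bar> \<le> ?b" if "j \<noteq> i" for j
      using that pulse_abs_le[OF w(1) \<rho>(1)] by (simp add: f_def)
    have fi: "\<bar>f i (y $ i)\<bar> \<le> \<rho> * ?b"
    proof -
      have "\<bar>f i (y $ i)\<bar> \<le> 1"
        using ramp_bounds[of "(y $ i - x $ i) / \<rho>"] ramp_bounds[of "(y $ i - x $ i) / (\<rho> / 2)"]
        unfolding f_def by auto
      \<comment> \<open>the ramps are bounded by 1 and not by \<open>?b\<close>: this gains the factor \<open>\<rho>\<close>\<close>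
      also have "1 \<le> \<rho> * ?b" using \<rho> hump_bound(1) by simp
      finally show ?thesis .
    qed
    have "\<bar>\<alpha> y\<bar> = \<bar>f i (y $ i)\<bar> * (\<Prod>j\<in>UNIV - {i}. \<bar>f j (y $ j)\<bar>)"
      unfolding \<alpha>_def abs_prod by (subst prod.remove[of UNIV i]) auto
    also have "\<dots> \<le> (\<rho> * ?b) * (\<Prod>j\<in>UNIV - {i}. ?b)"
      using fi b \<rho> by (intro mult_mono prod_mono prod_nonneg) (auto intro!: fj)
    also have "\<dots> = \<rho> * (?b * ?b ^ (?n - 1))" by (simp add: card_Diff_singleton)
    also have "?b * ?b ^ (?n - 1) = ?b ^ ?n" by (simp add: power_eq_if)
    finally show ?thesis .
  qed
  have "moll x t w s - moll x t w' s
      = (\<integral>z. v z * (dir_deriv \<alpha> (axis i 1) (fst z) * pulse t s (snd z)) \<partial>lebesgue_on Q2)"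
  proof -
    have w': "\<rho> / 2 \<le> w' j" for j using w \<rho> by (simp add: w'_def)
    show ?thesis unfolding moll_def
      by (subst Bochner_Integration.integral_diff[symmetric, OF moll_integrable[OF w(1) \<rho>(1) s] moll_integrable[OF w' \<rho>(1) s]])
         (simp add: deriv algebra_simps)
  qed
  also have "\<bar>\<dots>\<bar> \<le> (\<integral>z. h z * \<bar>\<alpha> (fst z) * pulse t s (snd z)\<bar> \<partial>lebesgue_on Q2)"
  proof (rule weak_gradient[OF sm _ smooth_pulse_real])
    show "\<alpha> \<in> test_functions (ball x0 (2 * r))"
      by (rule box_test_function[OF sm x \<rho>(2,1) supp])
    show "pulse t s \<in> test_functions (time_interval t0 (2 * r))"
      by (rule interval_test_function[where a=t and b="t + s", OF smooth_pulse_real])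
         (use adm in \<open>auto simp: admissible_def less_imp_le dest: pulse_nonzeroD[OF _ s]\<close>)
  qed
  also have "\<dots> \<le> (\<rho> * (2 * hump_bound / \<rho>) ^ ?n * (hump_bound / s)) * (m * bivol TYPE('n) (2 * real ?n * \<rho>) (2 * s))"
  proof (rule avg_le_weighted[OF h avg])
    show "(\<lambda>z. \<alpha> (fst z) * pulse t s (snd z)) \<in> borel_measurable borel"
      by (intro measurable_tensor smooth_imp_measurable sm smooth_pulse_real)
    show "\<bar>\<alpha> (fst z) * pulse t s (snd z)\<bar>
       \<le> \<rho> * (2 * hump_bound / \<rho>) ^ ?n * (hump_bound / s) * indicator (bicyl (x, t) (2 * real ?n * \<rho>) (2 * s)) z" for z
    proof (cases "\<alpha> (fst z) * pulse t s (snd z) = 0")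
      case True
      show ?thesis unfolding True using \<rho> s hump_bound(1) by (simp add: indicator_def)
    next
      case False
      then have "fst z \<in> ball x (2 * real ?n * \<rho>)"
        by (intro box_in_ball) (use supp \<rho> in auto)
      moreover have "snd z \<in> {t<..<t + s}" using False pulse_nonzeroD[OF _ s, of t "snd z"] by auto
      ultimately have "z \<in> bicyl (x, t) (2 * real ?n * \<rho>) (2 * s)"
        by (auto simp: bicyl_def mem_Times_iff)
      moreover have "\<bar>\<alpha> (fst z) * pulse t s (snd z)\<bar> \<le> (\<rho> * (2 * hump_bound / \<rho>) ^ ?n) * (hump_bound / s)"
        unfolding abs_mult using bound pulse_le[OF s] pulse_nonneg[OF s] \<rho> hump_bound(1)
        by (intro mult_mono) auto
      ultimately show ?thesis by simp
    qed
  qed (use \<rho> s in auto)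
  also have "\<dots> = C_space CARD('n) * \<rho> * m"
    using \<rho> s unfolding C_space_def bivol_def
    by (simp add: power_divide power_mult_distrib field_simps)
  finally show ?thesis by (simp add: w'_def)
qed
text \<open>
  The sides are halved one after the other, by induction on the set of sides treated already.
\<close>

lemma moll_halve:
  assumes avg: "avg_le Q2 h m (x, t)" and adm: "admissible x t s"
    and \<rho>: "0 < \<rho>" "real CARD('n) * \<rho> < r"
  shows "\<bar>moll x t (\<lambda>_. \<rho>) s - moll x t (\<lambda>_. \<rho> / 2) s\<bar> \<le> real CARD('n) * (C_space CARD('n) * \<rho> * m)"
proof -
  have "\<bar>moll x t (\<lambda>_. \<rho>) s - moll x t (\<lambda>j. if j \<in> S then \<rho> / 2 else \<rho>) s\<bar>
      \<le> real (card S) * (C_space CARD('n) * \<rho> * m)" if "finite S" for S :: "'n set"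
    using that
  proof induction
    case empty
    then show ?case by simp
  next
    case (insert i S)
    define w where "w S j = (if j \<in> S then \<rho> / 2 else \<rho>)" for S and j :: 'n
    have upd: "w (insert i S) = (w S)(i := \<rho> / 2)" by (auto simp: w_def)
    have "\<bar>moll x t (w S) s - moll x t ((w S)(i := \<rho> / 2)) s\<bar> \<le> C_space CARD('n) * \<rho> * m"
      by (rule moll_halve_width[OF avg adm \<rho>]) (use \<rho>(1) insert.hyps in \<open>auto simp: w_def\<close>)
    moreover have "\<bar>moll x t (\<lambda>_. \<rho>) s - moll x t (w S) s\<bar> \<le> real (card S) * (C_space CARD('n) * \<rho> * m)"
      using insert.IH by (simp add: w_def[abs_def])
    moreover have "real (card (insert i S)) * (C_space CARD('n) * \<rho> * m)
        = real (card S) * (C_space CARD('n) * \<rho> * m) + C_space CARD('n) * \<rho> * m"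
      using insert.hyps by (simp add: distrib_right)
    ultimately have "\<bar>moll x t (\<lambda>_. \<rho>) s - moll x t (w (insert i S)) s\<bar>
        \<le> real (card (insert i S)) * (C_space CARD('n) * \<rho> * m)"
      unfolding upd by linarith
    then show ?case by (simp add: w_def[abs_def])
  qed
  from this[of UNIV] show ?thesis by simp
qed

text \<open>
  Halving the box costs an amount proportional to its size, so all steps together cost at most twice as
  much as the first one, whatever the number of steps. The temporal width is the same throughout.
\<close>

lemma moll_halve_iterate:
  assumes avg: "avg_le Q2 h m (x, t)" and adm: "admissible x t s" and m: "0 \<le> m"
    and \<rho>: "0 < \<rho>" "real CARD('n) * \<rho> < r"
  shows "\<bar>moll x t (\<lambda>_. \<rho>) s - moll x t (\<lambda>_. \<rho> / 2 ^ k) s\<bar> \<le> 2 * real CARD('n) * C_space CARD('n) * \<rho> * m"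
proof -
  define D where "D = real CARD('n) * C_space CARD('n) * \<rho> * m"
  have D: "0 \<le> D" using C_space_nonneg[of "CARD('n)"] \<rho> m by (simp add: D_def)
  have "\<bar>moll x t (\<lambda>_. \<rho>) s - moll x t (\<lambda>_. \<rho> / 2 ^ k) s\<bar> \<le> (2 - 2 / 2 ^ k) * D"
  proof (induction k)
    case (Suc k)
    have "\<rho> / 2 ^ k \<le> \<rho>" using \<rho>(1) by (simp add: field_simps)
    then have "real CARD('n) * (\<rho> / 2 ^ k) \<le> real CARD('n) * \<rho>" by (intro mult_left_mono) auto
    then have "real CARD('n) * (\<rho> / 2 ^ k) < r" using \<rho>(2) by linarith
    from moll_halve[OF avg adm _ this] \<rho>(1)
    have "\<bar>moll x t (\<lambda>_. \<rho> / 2 ^ k) s - moll x t (\<lambda>_. \<rho> / 2 ^ Suc k) s\<bar> \<le> (1 / 2 ^ k) * D"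
      by (simp add: D_def mult_ac)
    moreover have "(2 - 2 / 2 ^ Suc k) * D = (2 - 2 / 2 ^ k) * D + (1 / 2 ^ k) * D"
      by (simp add: algebra_simps)
    moreover have "\<bar>a - c\<bar> \<le> A + B" if "\<bar>a - b\<bar> \<le> A" "\<bar>b - c\<bar> \<le> B" for a b c A B :: real
      using that by linarith
    ultimately show ?case using Suc.IH by (simp only:)
  qed simp
  also have "\<dots> \<le> 2 * D" by (rule mult_right_mono) (use D in auto)
  finally show ?thesis by (simp add: D_def mult_ac)
qed

text \<open>
  The difference of two pulses in time is the derivative of a cut-off function with values between 0 and 1
  that vanishes before the first pulse and after the second. With this cut-off, the equation turns the
  difference of the smoothed values into an integral of the flux against the gradient of the spatial
  kernel. The cylinder that contains the support is centred at the earlier point.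
\<close>

lemma moll_time_difference:
  assumes avg: "avg_le Q2 \<Phi> M (x, t1)" and adm: "admissible x t1 s" "admissible x t2 s" and t: "t1 < t2"
    and \<rho>: "0 < \<rho>" "real CARD('n) * \<rho> < r"
  shows "\<bar>moll x t1 (\<lambda>_. \<rho>) s - moll x t2 (\<lambda>_. \<rho>) s\<bar> \<le> C_time CARD('n) / \<rho> * (t2 - t1 + 2 * s) * M"
proof -
  let ?n = "CARD('n)"
  define \<theta> where "\<theta> \<tau> = ramp ((\<tau> - t1) / s) - ramp ((\<tau> - t2) / s)" for \<tau>
  define \<alpha> where "\<alpha> = kern x (\<lambda>_. \<rho>)"
  define g where "g y = (\<Sum>j\<in>UNIV. \<bar>dir_deriv \<alpha> (axis j 1) y\<bar>)" for y
  have s: "0 < s" and x: "x \<in> ball x0 r" using adm by (auto simp: admissible_def)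
  have sm: "smooth \<alpha>" by (simp add: \<alpha>_def smooth_kern)
  have sm_t: "smooth \<theta>" unfolding \<theta>_def[abs_def] by (intro smooth_diff smooth_ramp_scaled)
  have deriv: "dir_deriv \<theta> 1 \<tau> = pulse t1 s \<tau> - pulse t2 s \<tau>" for \<tau>
    unfolding \<theta>_def[abs_def] using s
    by (intro dir_deriv_real DERIV_diff ramp_scaled_has_derivative) auto
  have th_bound: "\<bar>\<theta> \<tau>\<bar> \<le> 1" for \<tau>
    using ramp_bounds[of "(\<tau> - t1) / s"] ramp_bounds[of "(\<tau> - t2) / s"] by (simp add: \<theta>_def abs_le_iff)
  have th_supp: "t1 \<le> \<tau> \<and> \<tau> \<le> t2 + s" if "\<theta> \<tau> \<noteq> 0" for \<tau>
  proof (rule ccontr)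
    assume "\<not> ?thesis"
    then consider "\<tau> < t1" | "t2 + s < \<tau>" by linarith
    then have "\<theta> \<tau> = 0"
    proof cases
      case 1
      then have "(\<tau> - t1) / s \<le> 0" "(\<tau> - t2) / s \<le> 0" using s t by (auto simp: field_simps)
      then show ?thesis by (simp add: \<theta>_def ramp_eq_0)
    next
      case 2
      then have "1 \<le> (\<tau> - t1) / s" "1 \<le> (\<tau> - t2) / s" using s t by (auto simp: field_simps)
      then show ?thesis by (simp add: \<theta>_def ramp_eq_1)
    qed
    with that show False by simp
  qed
  have "moll x t1 (\<lambda>_. \<rho>) s - moll x t2 (\<lambda>_. \<rho>) s
      = (\<integral>z. v z * (\<alpha> (fst z) * dir_deriv \<theta> 1 (snd z)) \<partial>lebesgue_on Q2)"
    unfolding moll_def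
    by (subst Bochner_Integration.integral_diff[symmetric, OF moll_integrable[of \<rho>] moll_integrable[of \<rho>]])
       (use s \<rho> in \<open>auto simp: deriv \<alpha>_def algebra_simps\<close>)
  also have "\<bar>\<dots>\<bar> \<le> (\<integral>z. \<Phi> z * \<bar>g (fst z) * \<theta> (snd z)\<bar> \<partial>lebesgue_on Q2)"
    unfolding g_def
  proof (rule weak_time_derivative[OF sm _ sm_t])
    show "\<alpha> \<in> test_functions (ball x0 (2 * r))"
    proof (rule box_test_function[OF sm x \<rho>(2,1)])
      show "\<forall>j. x $ j \<le> y $ j \<and> y $ j \<le> x $ j + \<rho>" if "\<alpha> y \<noteq> 0" for y
        using kern_nonzeroD[OF that[unfolded \<alpha>_def]] \<rho>(1) by (auto simp: less_imp_le)
    qed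
    show "\<theta> \<in> test_functions (time_interval t0 (2 * r))"
      by (rule interval_test_function[where a=t1 and b="t2 + s", OF sm_t])
         (use adm th_supp in \<open>auto simp: admissible_def\<close>)
  qed
  also have "\<dots> \<le> (real ?n * (hump_bound ^ ?n / \<rho> ^ Suc ?n)) * (M * bivol TYPE('n) (2 * real ?n * \<rho>) (t2 - t1 + 2 * s))"
  proof (rule avg_le_weighted[OF \<Phi> avg])
    show "(\<lambda>z. g (fst z) * \<theta> (snd z)) \<in> borel_measurable borel"
      unfolding g_def
      by (intro measurable_tensor borel_measurable_sum borel_measurable_abs smooth_imp_measurable smooth_dir_deriv sm sm_t)
    show "\<bar>g (fst z) * \<theta> (snd z)\<bar>
       \<le> real ?n * (hump_bound ^ ?n / \<rho> ^ Suc ?n) * indicator (bicyl (x, t1) (2 * real ?n * \<rho>) (t2 - t1 + 2 * s)) z" for z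
    proof (cases "g (fst z) * \<theta> (snd z) = 0")
      case True
      show ?thesis unfolding True using \<rho> s hump_bound(1) by (simp add: indicator_def)
    next
      case False
      have "\<exists>j. dir_deriv \<alpha> (axis j 1) (fst z) \<noteq> 0"
      proof (rule ccontr)
        assume "\<not> ?thesis"
        then have "g (fst z) = 0" by (simp add: g_def)
        with False show False by simp
      qed
      then have "\<forall>j. x $ j \<le> fst z $ j \<and> fst z $ j \<le> x $ j + \<rho>"
        unfolding \<alpha>_def using kern_dir_deriv_eq_0[OF \<rho>(1)] by blast
      then have "fst z \<in> ball x (2 * real ?n * \<rho>)"
        by (intro box_in_ball) (use \<rho> in auto)
      moreover have "t1 \<le> snd z \<and> snd z \<le> t2 + s" using False th_supp by simp
      ultimately have "z \<in> bicyl (x, t1) (2 * real ?n * \<rho>) (t2 - t1 + 2 * s)"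
        using s t by (auto simp: bicyl_def mem_Times_iff)
      moreover have "\<bar>g (fst z) * \<theta> (snd z)\<bar> \<le> (real ?n * (hump_bound ^ ?n / \<rho> ^ Suc ?n)) * 1"
      proof -
        have "g y \<le> (\<Sum>j\<in>(UNIV::'n set). hump_bound ^ ?n / \<rho> ^ Suc ?n)" for y
          unfolding g_def \<alpha>_def by (intro sum_mono kern_dir_deriv_le \<rho>)
        moreover have "0 \<le> g y" for y by (simp add: g_def sum_nonneg)
        ultimately show ?thesis
          unfolding abs_mult using th_bound \<rho> hump_bound(1) by (intro mult_mono) auto
      qed
      ultimately show ?thesis by simp
    qed
  qed (use \<rho> s t in auto)
  also have "\<dots> = C_time CARD('n) / \<rho> * (t2 - t1 + 2 * s) * M"
    using \<rho> s unfolding C_time_def bivol_def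
    by (simp add: power_divide power_mult_distrib field_simps)
  finally show ?thesis .
qed

text \<open>
  The kernel has mass 1 and is bounded by a constant over the volume of its cube.
\<close>

lemma moll_sub_le:
  assumes adm: "admissible x t d" and d: "real CARD('n) * d < r"
  shows "\<bar>moll x t (\<lambda>_. d) d - v (x, t)\<bar> \<le> hump_bound ^ Suc CARD('n) *
    ((\<integral>\<zeta>. \<bar>v \<zeta> - v (x, t)\<bar> * indicator (cbox (x, t) ((x, t) + d *\<^sub>R One)) \<zeta> \<partial>lebesgue_on Q2) / d ^ Suc CARD('n))"
proof -
  let ?n = "CARD('n)" and ?c = "v (x, t)" and ?B = "cbox (x, t) ((x, t) + d *\<^sub>R One)"
  define k where "k z = kern x (\<lambda>_. d) (fst z) * pulse t d (snd z)" for z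
  have dpos: "0 < d" and x: "x \<in> ball x0 r" using adm by (auto simp: admissible_def)
  have k_meas: "k \<in> borel_measurable borel"
    unfolding k_def[abs_def] by (rule kern_pulse_measurable)
  have k_nonneg: "0 \<le> k z" for z using dpos by (simp add: k_def kern_nonneg pulse_nonneg)
  have k_supp: "z \<in> Q2 \<and> z \<in> ?B" if "k z \<noteq> 0" for z
  proof -
    have "kern x (\<lambda>_. d) (fst z) \<noteq> 0" and p: "pulse t d (snd z) \<noteq> 0" using that by (auto simp: k_def)
    from kern_nonzeroD[OF this(1)] dpos
    have box: "x $ j \<le> fst z $ j \<and> fst z $ j \<le> x $ j + d" for j by (auto simp: less_imp_le)
    have "dist x (fst z) < r" using box_subset_ball[of x "fst z" d, OF box dpos] d by simp
    then have "fst z \<in> ball x0 (2 * r)" using x dist_triangle[of x0 "fst z" x] by simp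
    moreover have tz: "t < snd z" "snd z < t + d" using pulse_nonzeroD[OF p dpos] by auto
    moreover have "z \<in> ?B"
    proof -
      have "(x, t) \<bullet> b \<le> z \<bullet> b \<and> z \<bullet> b \<le> (x, t) \<bullet> b + d" if "b \<in> Basis" for b
      proof -
        from that consider j where "b = (axis j 1, 0)" | "b = (0, 1)"
          by (auto simp: Basis_prod_def Basis_vec_def)
        then show ?thesis
          using box tz by cases (auto simp: inner_prod_def inner_axis)
      qed
      then show ?thesis by (simp add: mem_box inner_add_left)
    qed
    ultimately show ?thesis using adm by (auto simp: cylinder_def time_interval_def admissible_def mem_Times_iff)
  qed
  have k_bound: "\<bar>k z\<bar> \<le> hump_bound ^ Suc ?n / d ^ Suc ?n" for z
  proof -
    have "kern x (\<lambda>_. d) y \<le> (hump_bound / d) ^ ?n" for y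
    proof -
      have "kern x (\<lambda>_. d) y \<le> (\<Prod>j\<in>(UNIV::'n set). hump_bound / d)"
        unfolding kern_def by (rule prod_mono) (simp add: pulse_le[OF dpos] pulse_nonneg[OF dpos])
      then show ?thesis by simp
    qed
    moreover have "0 \<le> kern x (\<lambda>_. d) y" for y using dpos by (simp add: kern_nonneg)
    ultimately have "\<bar>k z\<bar> \<le> (hump_bound / d) ^ ?n * (hump_bound / d)"
      unfolding k_def abs_mult using pulse_le[OF dpos, of t "snd z"] pulse_nonneg[OF dpos, of t "snd z"] dpos hump_bound(1)
      by (intro mult_mono) simp_all
    then show ?thesis by (simp add: power_divide mult.commute)
  qed
  have Q2: "Q2 \<in> lmeasurable" by (rule cylinder_lmeasurable)
  have mass: "has_bochner_integral (lebesgue_on Q2) k 1"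
  proof (rule has_bochner_integral_nn_integral)
    have "(\<integral>\<^sup>+z. ennreal (k z) \<partial>lebesgue_on Q2) = (\<integral>\<^sup>+z. ennreal (k z) * indicator Q2 z \<partial>lebesgue)"
      using Q2 by (intro nn_integral_restrict_space) auto
    also have "\<dots> = (\<integral>\<^sup>+z. ennreal (k z) \<partial>lebesgue)"
      by (intro nn_integral_cong) (metis ennreal_0 indicator_simps(1) k_supp mult.right_neutral mult_zero_left)
    also have "\<dots> = 1"
      unfolding nn_integral_completion k_def by (rule nn_integral_kern_pulse[OF dpos])
    finally show "(\<integral>\<^sup>+z. ennreal (k z) \<partial>lebesgue_on Q2) = ennreal 1" by simp
  qed (use k_meas k_nonneg in \<open>auto intro: borel_measurable_lebesgue_on\<close>)
  interpret Q: finite_measure "lebesgue_on Q2" by (rule finite_measure_lebesgue_on[OF Q2])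
  have int_vk: "integrable (lebesgue_on Q2) (\<lambda>z. v z * k z)"
    by (rule integrable_mult_bounded[OF v k_meas k_bound])
  have int_v: "integrable (lebesgue_on Q2) (\<lambda>z. \<bar>v z - ?c\<bar>)"
    using v by (intro integrable_abs Bochner_Integration.integrable_diff) auto
  have "moll x t (\<lambda>_. d) d - ?c = (\<integral>z. v z * k z \<partial>lebesgue_on Q2) - (\<integral>z. ?c * k z \<partial>lebesgue_on Q2)"
  proof -
    have "moll x t (\<lambda>_. d) d = (\<integral>z. v z * k z \<partial>lebesgue_on Q2)" by (simp add: moll_def k_def)
    moreover have "(\<integral>z. ?c * k z \<partial>lebesgue_on Q2) = ?c" by (simp add: has_bochner_integral_integral_eq[OF mass])
    ultimately show ?thesis by simp
  qed
  also have "\<dots> = (\<integral>z. v z * k z - ?c * k z \<partial>lebesgue_on Q2)"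
    using mass by (intro Bochner_Integration.integral_diff[symmetric] int_vk) (auto simp: has_bochner_integral_iff)
  also have "\<bar>\<dots>\<bar> \<le> (\<integral>z. \<bar>v z * k z - ?c * k z\<bar> \<partial>lebesgue_on Q2)"
    by (rule integral_abs_bound)
  also have "\<dots> = (\<integral>z. \<bar>v z - ?c\<bar> * k z \<partial>lebesgue_on Q2)"
    using k_nonneg by (simp add: left_diff_distrib[symmetric] abs_mult)
  also have "\<dots> \<le> (\<integral>z. (hump_bound ^ Suc ?n / d ^ Suc ?n) * (\<bar>v z - ?c\<bar> * indicator ?B z) \<partial>lebesgue_on Q2)"
  proof (rule integral_mono)
    show "integrable (lebesgue_on Q2) (\<lambda>z. \<bar>v z - ?c\<bar> * k z)"
      by (rule integrable_mult_bounded[OF int_v k_meas k_bound])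
    show "integrable (lebesgue_on Q2) (\<lambda>z. (hump_bound ^ Suc ?n / d ^ Suc ?n) * (\<bar>v z - ?c\<bar> * indicator ?B z))"
      by (intro integrable_mult_right integrable_mult_bounded[where B=1] int_v) (auto simp: indicator_def)
    show "\<bar>v z - ?c\<bar> * k z \<le> (hump_bound ^ Suc ?n / d ^ Suc ?n) * (\<bar>v z - ?c\<bar> * indicator ?B z)" for z
    proof (cases "k z = 0")
      case True
      show ?thesis unfolding True using dpos hump_bound(1) by (simp add: indicator_def)
    next
      case False
      then have "z \<in> ?B" using k_supp by blast
      then show ?thesis
        using mult_right_mono[OF k_bound[of z], of "\<bar>v z - ?c\<bar>"] k_nonneg[of z] by (simp add: mult.commute)
    qed
  qed
  also have "\<dots> = hump_bound ^ Suc ?n * ((\<integral>\<zeta>. \<bar>v \<zeta> - ?c\<bar> * indicator ?B \<zeta> \<partial>lebesgue_on Q2) / d ^ Suc ?n)"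
    by simp
  finally show ?thesis .
qed

lemma eventually_admissible:
  assumes "x \<in> ball x0 r" "t \<in> time_interval t0 r" "0 < \<rho>"
  shows "\<forall>\<^sub>F k in sequentially. admissible x t (\<rho> / 2 ^ k) \<and> real CARD('n) * (\<rho> / 2 ^ k) < r"
proof -
  have lim: "(\<lambda>k. \<rho> / 2 ^ k) \<longlonglongrightarrow> 0"
    using LIMSEQ_divide_realpow_zero[of 2 \<rho>] by simp
  have "r\<^sup>2 < (2 * r)\<^sup>2" using r by (simp add: power2_eq_square)
  then have t: "t0 - (2 * r)\<^sup>2 < t" "t < t0 + (2 * r)\<^sup>2" using assms(2) by (auto simp: time_interval_def)
  have "\<forall>\<^sub>F k in sequentially. \<rho> / 2 ^ k < t0 + (2 * r)\<^sup>2 - t"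
    using lim t by (intro order_tendstoD) auto
  moreover have "\<forall>\<^sub>F k in sequentially. \<rho> / 2 ^ k < r / real CARD('n)"
    using lim r by (intro order_tendstoD) auto
  ultimately show ?thesis
  proof eventually_elim
    case (elim k)
    moreover have "real CARD('n) * (\<rho> / 2 ^ k) < r"
      using elim(2) by (simp add: pos_less_divide_eq mult.commute)
    ultimately show ?case
      using assms t by (auto simp: admissible_def)
  qed
qed

lemma moll_tendsto:
  assumes "lebesgue_point Q2 v (x, t)" "x \<in> ball x0 r" "t \<in> time_interval t0 r" "0 < \<rho>"
  shows "(\<lambda>k. moll x t (\<lambda>_. \<rho> / 2 ^ k) (\<rho> / 2 ^ k)) \<longlonglongrightarrow> v (x, t)"
proof -
  let ?E = "\<lambda>d. (\<integral>\<zeta>. \<bar>v \<zeta> - v (x, t)\<bar> * indicator (cbox (x, t) ((x, t) + d *\<^sub>R One)) \<zeta> \<partial>lebesgue_on Q2) / d ^ Suc CARD('n)"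
  have dim: "DIM((real^'n) \<times> real) = Suc CARD('n)" by simp
  have "filterlim (\<lambda>k. \<rho> / 2 ^ k) (at_right 0) sequentially"
    using LIMSEQ_divide_realpow_zero[of 2 \<rho>] assms(4)
    by (auto simp: filterlim_at intro!: always_eventually)
  then have "(\<lambda>k. ?E (\<rho> / 2 ^ k)) \<longlonglongrightarrow> 0"
    by (rule filterlim_compose[OF assms(1)[unfolded lebesgue_point_def dim]])
  then have "(\<lambda>k. hump_bound ^ Suc CARD('n) * ?E (\<rho> / 2 ^ k)) \<longlonglongrightarrow> 0"
    by (rule tendsto_mult_right_zero)
  then have "(\<lambda>k. moll x t (\<lambda>_. \<rho> / 2 ^ k) (\<rho> / 2 ^ k) - v (x, t)) \<longlonglongrightarrow> 0"
  proof (rule Lim_null_comparison[rotated])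
    show "\<forall>\<^sub>F k in sequentially. norm (moll x t (\<lambda>_. \<rho> / 2 ^ k) (\<rho> / 2 ^ k) - v (x, t))
        \<le> hump_bound ^ Suc CARD('n) * ?E (\<rho> / 2 ^ k)"
      using eventually_admissible[OF assms(2-4)]
    proof eventually_elim
      case (elim k)
      then show ?case using moll_sub_le[of x t "\<rho> / 2 ^ k"] unfolding real_norm_def by blast
    qed
  qed
  then show ?thesis by (simp add: LIM_zero_iff)
qed

text \<open>
  Smooth at scale \<open>\<rho>\<close> in space, shrink the box to side \<open>s\<close> at both times, and let
  \<open>s = \<rho> / 2 ^ k\<close> tend to 0. Only the term \<open>2 * s\<close> in the time difference depends on
  \<open>s\<close>.
\<close>

lemma pointwise_time_oscillation:
  assumes x: "x \<in> ball x0 r" and t: "t1 \<in> time_interval t0 r" "t2 \<in> time_interval t0 r" "t1 < t2"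
    and lp: "lebesgue_point Q2 v (x, t1)" "lebesgue_point Q2 v (x, t2)"
    and m: "0 \<le> m" "avg_le Q2 h m (x, t1)" "avg_le Q2 h m (x, t2)"
    and M: "avg_le Q2 \<Phi> M (x, t1)"
    and \<rho>: "0 < \<rho>" "real CARD('n) * \<rho> < r"
  shows "\<bar>v (x, t1) - v (x, t2)\<bar>
    \<le> 2 * (2 * real CARD('n) * C_space CARD('n) * \<rho> * m) + C_time CARD('n) / \<rho> * (t2 - t1) * M"
proof (rule LIMSEQ_le)
  let ?s = "\<lambda>k. \<rho> / 2 ^ k"
  let ?U = "\<lambda>t k. moll x t (\<lambda>_. ?s k) (?s k)"
  show "(\<lambda>k. \<bar>?U t1 k - ?U t2 k\<bar>) \<longlonglongrightarrow> \<bar>v (x, t1) - v (x, t2)\<bar>"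
    by (intro tendsto_intros moll_tendsto lp x t \<rho>)
  have "(\<lambda>k. ?s k) \<longlonglongrightarrow> 0" using LIMSEQ_divide_realpow_zero[of 2 \<rho>] by simp
  then have "(\<lambda>k. 2 * (2 * real CARD('n) * C_space CARD('n) * \<rho> * m) + C_time CARD('n) / \<rho> * (t2 - t1 + 2 * ?s k) * M)
      \<longlonglongrightarrow> 2 * (2 * real CARD('n) * C_space CARD('n) * \<rho> * m) + C_time CARD('n) / \<rho> * (t2 - t1 + 2 * 0) * M"
    by (intro tendsto_intros)
  then show "(\<lambda>k. 2 * (2 * real CARD('n) * C_space CARD('n) * \<rho> * m) + C_time CARD('n) / \<rho> * (t2 - t1 + 2 * ?s k) * M)
      \<longlonglongrightarrow> 2 * (2 * real CARD('n) * C_space CARD('n) * \<rho> * m) + C_time CARD('n) / \<rho> * (t2 - t1) * M" by simp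
  have "\<forall>\<^sub>F k in sequentially. \<bar>?U t1 k - ?U t2 k\<bar>
      \<le> 2 * (2 * real CARD('n) * C_space CARD('n) * \<rho> * m) + C_time CARD('n) / \<rho> * (t2 - t1 + 2 * ?s k) * M"
    using eventually_admissible[OF x t(1) \<rho>(1)] eventually_admissible[OF x t(2) \<rho>(1)]
  proof eventually_elim
    case (elim k)
    then have adm: "admissible x t1 (?s k)" "admissible x t2 (?s k)" by auto
    have "\<bar>a - b\<bar> \<le> 2 * A + B" if "\<bar>c - a\<bar> \<le> A" "\<bar>d - b\<bar> \<le> A" "\<bar>c - d\<bar> \<le> B" for a b c d A B :: real
      using that by linarith
    from this[OF moll_halve_iterate[OF m(2) adm(1) m(1) \<rho>] moll_halve_iterate[OF m(3) adm(2) m(1) \<rho>]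
      moll_time_difference[OF M adm t(3) \<rho>]]
    show ?case .
  qed
  then show "\<exists>N. \<forall>k\<ge>N. \<bar>?U t1 k - ?U t2 k\<bar>
      \<le> 2 * (2 * real CARD('n) * C_space CARD('n) * \<rho> * m) + C_time CARD('n) / \<rho> * (t2 - t1 + 2 * ?s k) * M"
    by (simp only: eventually_sequentially)
qed

text \<open>
  The smoothed values with equal widths are bounded by averages over comparable cylinders, and they
  converge to the value at a Lebesgue point.
\<close>

lemma pointwise_bound:
  assumes x: "x \<in> ball x0 r" and t: "t \<in> time_interval t0 r"
    and lp: "lebesgue_point Q2 v (x, t)" and avg: "avg_le Q2 (\<lambda>z. \<bar>v z\<bar>) m (x, t)"
  shows "\<bar>v (x, t)\<bar> \<le> C_point CARD('n) * m"
proof (rule LIMSEQ_le_const2)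
  let ?n = "CARD('n)"
  show "(\<lambda>k. \<bar>moll x t (\<lambda>_. 1 / 2 ^ k) (1 / 2 ^ k)\<bar>) \<longlonglongrightarrow> \<bar>v (x, t)\<bar>"
    by (rule tendsto_rabs, rule moll_tendsto[OF lp x t]) simp
  have "\<bar>moll x t (\<lambda>_. d) d\<bar> \<le> C_point CARD('n) * m" if "0 < d" for d
  proof -
    let ?k = "\<lambda>z. kern x (\<lambda>_. d) (fst z) * pulse t d (snd z)"
    have "\<bar>moll x t (\<lambda>_. d) d\<bar> \<le> (\<integral>z. \<bar>v z * ?k z\<bar> \<partial>lebesgue_on Q2)"
      unfolding moll_def by (rule integral_abs_bound)
    also have "\<dots> = (\<integral>z. \<bar>v z\<bar> * \<bar>?k z\<bar> \<partial>lebesgue_on Q2)" by (simp add: abs_mult)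
    also have "\<dots> \<le> ((2 * hump_bound / d) ^ ?n * (hump_bound / d)) * (m * bivol TYPE('n) (2 * real ?n * d) (2 * d))"
    proof (rule avg_le_weighted[OF _ _ avg kern_pulse_measurable])
      show "\<bar>?k z\<bar> \<le> (2 * hump_bound / d) ^ ?n * (hump_bound / d) * indicator (bicyl (x, t) (2 * real ?n * d) (2 * d)) z" for z
      proof (cases "?k z = 0")
        case True
        show ?thesis unfolding True using that hump_bound(1) by (simp add: indicator_def)
      next
        case False
        have "x $ j < fst z $ j \<and> fst z $ j < x $ j + d" for j
          using False that by (intro kern_nonzeroD) auto
        then have "fst z \<in> ball x (2 * real ?n * d)"
          by (intro box_in_ball) (use that in \<open>auto simp: less_imp_le\<close>)
        moreover have "t < snd z \<and> snd z < t + d" using False that by (intro pulse_nonzeroD) auto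
        ultimately have "z \<in> bicyl (x, t) (2 * real ?n * d) (2 * d)"
          by (auto simp: bicyl_def mem_Times_iff)
        then show ?thesis using kern_pulse_abs_le[of d "\<lambda>_. d" d x "fst z" t "snd z"] that by simp
      qed
    qed (use v that in auto)
    also have "\<dots> = C_point CARD('n) * m"
      using that unfolding C_point_def bivol_def
      by (simp add: power_divide power_mult_distrib field_simps)
    finally show ?thesis .
  qed
  then show "\<exists>N. \<forall>k\<ge>N. \<bar>moll x t (\<lambda>_. 1 / 2 ^ k) (1 / 2 ^ k)\<bar> \<le> C_point CARD('n) * m" by simp
qed

end

section \<open>Measurability, slices and Lebesgue points for Lebesgue measure\<close>

text \<open>
  Completeness of Lebesgue measure: on a null set the values may be arbitrary.
\<close>

lemma measurable_lebesgue_cong_AE: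
  fixes f g :: "'a::euclidean_space \<Rightarrow> 'b::topological_space"
  assumes g: "g \<in> borel_measurable lebesgue" and ae: "AE z in lebesgue. f z = g z"
  shows "f \<in> borel_measurable lebesgue"
proof (rule borel_measurableI)
  obtain N where N: "N \<in> null_sets lebesgue" "{z. f z \<noteq> g z} \<subseteq> N"
    using ae by (auto simp: eventually_ae_filter)
  fix S :: "'b set" assume "open S"
  have eq: "f -` S = (g -` S - N) \<union> (f -` S \<inter> N)" using N(2) by auto
  have 1: "g -` S - N \<in> sets lebesgue"
    using measurable_sets[OF g, of S] \<open>open S\<close> N(1) by (auto intro: sets.Diff)
  have 2: "f -` S \<inter> N \<in> sets lebesgue"
    using N(1) null_sets_completion_subset[of "f -` S \<inter> N" N lborel] by auto
  have "f -` S \<in> sets lebesgue" by (subst eq) (rule sets.Un[OF 1 2])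
  then show "f -` S \<inter> space lebesgue \<in> sets lebesgue" by simp
qed

text \<open>
  For simple \<open>D\<close> the composition is measurable piece by piece, and continuity of \<open>A z\<close> carries this
  over to limits. The approximating simple functions are first projected to \<open>vecs N\<close>, where measurability
  and continuity of the field are known.
\<close>

lemma measurable_caratheodory:
  fixes A :: "'a::euclidean_space \<Rightarrow> (nat \<Rightarrow> 'b::{real_normed_vector, second_countable_topology}) \<Rightarrow> 'c::metric_space"
  assumes S: "S \<in> sets lebesgue"
    and A: "\<And>\<xi>. \<xi> \<in> vecs N \<Longrightarrow> (\<lambda>z. A z \<xi>) \<in> borel_measurable (lebesgue_on S)"
    and cont: "AE z in lebesgue_on S. continuous_on (vecs N) (A z)"
    and D: "D \<in> borel_measurable (lebesgue_on S)" "D \<in> S \<rightarrow> vecs N"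
  shows "(\<lambda>z. A z (D z)) \<in> borel_measurable (lebesgue_on S)"
proof -
  let ?M = "lebesgue_on S"
  have space: "space ?M = S" by simp
  define proj :: "(nat \<Rightarrow> 'b) \<Rightarrow> nat \<Rightarrow> 'b" where "proj v i = (if i < N then v i else 0)" for v i
  have proj_vecs: "proj v \<in> vecs N" for v by (simp add: proj_def vecs_def)
  have proj_id: "proj v = v" if "v \<in> vecs N" for v using that by (auto simp: proj_def vecs_def fun_eq_iff not_less)
  obtain F where F: "\<And>i. simple_function ?M (F i)" "\<And>z. z \<in> S \<Longrightarrow> (\<lambda>i. F i z) \<longlonglongrightarrow> D z"
    using borel_measurable_implies_sequence_metric[OF D(1), of undefined] space by metis
  define G where "G i z = proj (F i z)" for i z
  have G: "simple_function ?M (G i)" for i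
    unfolding G_def by (rule simple_function_compose1[OF F(1)])
  have G_lim: "(\<lambda>i. G i z) \<longlonglongrightarrow> D z" if "z \<in> S" for z
  proof -
    have "continuous_on UNIV proj"
      unfolding proj_def[abs_def]
    proof (rule continuous_on_coordinatewise_then_product)
      fix i show "continuous_on UNIV (\<lambda>v. if i < N then v i else 0 :: 'b)"
        by (cases "i < N") (auto intro: continuous_on_product_coordinates)
    qed
    then have "isCont proj (D z)" by (simp add: continuous_on_eq_continuous_at)
    from isCont_tendsto_compose[OF this F(2)[OF that]] show ?thesis
      using D(2) that by (auto simp: G_def proj_id Pi_iff)
  qed
  have AG: "(\<lambda>z. A z (G i z)) \<in> borel_measurable ?M" for i
  proof (rule measurable_compose_countable'[where I="G i ` space ?M" and f="\<lambda>\<xi> z. A z \<xi>" and g="G i"])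
    show "(\<lambda>z. A z \<xi>) \<in> borel_measurable ?M" if "\<xi> \<in> G i ` space ?M" for \<xi>
      using that by (intro A) (auto simp: G_def proj_vecs)
    show "G i \<in> measurable ?M (count_space (G i ` space ?M))"
      using simple_functionD[OF G[of i]] by (subst measurable_count_space_eq2) auto
    show "countable (G i ` space ?M)"
      using simple_functionD(1)[OF G[of i]] by (rule countable_finite)
  qed
  obtain N0 where N0: "N0 \<in> null_sets ?M" "{z \<in> space ?M. \<not> continuous_on (vecs N) (A z)} \<subseteq> N0"
    using cont by (auto simp: eventually_ae_filter)
  have N0_leb: "N0 \<in> null_sets lebesgue"
    using N0(1) S by (simp add: null_sets_restrict_space)
  \<comment> \<open>an arbitrary value off \<open>S\<close> and on the null set where continuity fails\<close>
  define c where "c = A undefined undefined"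
  define B where "B i z = (if z \<in> S - N0 then A z (G i z) else c)" for i z
  define B' where "B' z = (if z \<in> S - N0 then A z (D z) else c)" for z
  have SN: "S - N0 \<in> sets lebesgue" using S N0_leb by auto
  have "B i \<in> borel_measurable lebesgue" for i
  proof -
    have "(\<lambda>z. A z (G i z)) \<in> borel_measurable (lebesgue_on (S - N0))"
      using AG[of i] by (rule measurable_restrict_mono) auto
    then show ?thesis
      unfolding B_def using SN by (subst measurable_If_restrict_space_iff) (auto simp: set_diff_eq)
  qed
  moreover have "(\<lambda>i. B i z) \<longlonglongrightarrow> B' z" for z
  proof (cases "z \<in> S - N0")
    case True
    then have "continuous_on (vecs N) (A z)" using N0(2) by auto
    then have "(\<lambda>i. A z (G i z)) \<longlonglongrightarrow> A z (D z)"
      using True D(2) by (intro continuous_on_tendsto_compose[OF _ G_lim]) (auto simp: G_def proj_vecs Pi_iff)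
    with True show ?thesis by (simp add: B_def B'_def)
  next
    case False
    then have "B i z = c" "B' z = c" for i by (auto simp: B_def B'_def)
    then show ?thesis by simp
  qed
  ultimately have B': "B' \<in> borel_measurable lebesgue"
    by (rule borel_measurable_LIMSEQ_metric)
  define E where "E z = (if z \<in> S then A z (D z) else c)" for z
  have "AE z in lebesgue. E z = B' z"
    using N0_leb by (rule AE_I') (auto simp: E_def B'_def)
  with B' have "E \<in> borel_measurable lebesgue" by (rule measurable_lebesgue_cong_AE)
  then have "E \<in> borel_measurable (lebesgue_on S)" by (rule measurable_restrict_space1)
  then show ?thesis by (rule measurable_cong[THEN iffD1, rotated]) (simp add: E_def)
qed

lemma AE_lebesgue_iff: "(AE z in lebesgue. P z) \<longleftrightarrow> (AE z in lborel. P z)"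
  by (rule AE_completion_iff)

lemma AE_lebesgue_slices:
  fixes P :: "('a::euclidean_space \<times> 'b::euclidean_space) \<Rightarrow> bool"
  assumes "AE z in lebesgue. P z"
  shows "AE x in lebesgue. AE t in lebesgue. P (x, t)"
proof -
  have "AE z in lborel \<Otimes>\<^sub>M lborel. P z"
    using assms by (simp only: AE_lebesgue_iff lborel_prod)
  from lborel_pair.AE_pair[OF this] show ?thesis by (simp only: AE_lebesgue_iff)
qed

text \<open>
  The order of the two almost-everywhere quantifiers may be exchanged only for measurable sets; hence the
  detour over a Borel null set that covers the exceptional set.
\<close>

lemma AE_lebesgue_slices_snd:
  fixes P :: "('a::euclidean_space \<times> 'b::euclidean_space) \<Rightarrow> bool"
  assumes "AE z in lebesgue. P z"
  shows "AE t in lebesgue. AE x in lebesgue. P (x, t)"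
proof -
  have "AE z in lborel. P z" using assms by (simp only: AE_lebesgue_iff)
  then obtain N where N: "\<And>z. z \<in> space lborel - N \<Longrightarrow> P z" "N \<in> null_sets lborel"
    by (rule AE_E3) blast
  have N_meas: "N \<in> sets (lborel \<Otimes>\<^sub>M lborel)" using null_setsD2[OF N(2)] by (simp only: lborel_prod)
  have "AE z in lborel \<Otimes>\<^sub>M lborel. z \<notin> N"
    using AE_not_in[OF N(2)] by (simp only: lborel_prod)
  from lborel_pair.AE_pair[OF this] have xt: "AE x in lborel. AE t in lborel. (x, t) \<notin> N" .
  have "{z \<in> space (lborel \<Otimes>\<^sub>M lborel). (fst z, snd z) \<notin> N} = space (lborel \<Otimes>\<^sub>M lborel) - N"
    by (simp only: prod.collapse set_diff_eq)
  then have "{z \<in> space (lborel \<Otimes>\<^sub>M lborel). (fst z, snd z) \<notin> N} \<in> sets (lborel \<Otimes>\<^sub>M lborel)"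
    using sets.compl_sets[OF N_meas] by (simp only:)
  from iffD1[OF lborel_pair.AE_commute[OF this] xt]
  have "AE t in lborel. AE x in lborel. (x, t) \<notin> N" .
  moreover have "P z" if "z \<notin> N" for z using N(1)[of z] that by simp
  ultimately show ?thesis unfolding AE_lebesgue_iff by (elim eventually_mono) blast+
qed

text \<open>
  Fubini's theorem for a Lebesgue measurable integrand, which is replaced by a Borel measurable version.
  Its slices then agree almost everywhere with those of the integrand for almost every \<open>t\<close>.
\<close>

lemma integral_lebesgue_slices:
  fixes f :: "('a::euclidean_space \<times> 'b::euclidean_space) \<Rightarrow> real"
  assumes f: "integrable lebesgue f"
  obtains G where "G \<in> borel_measurable borel" "AE t in lebesgue. (\<integral>x. f (x, t) \<partial>lebesgue) = G t"
    "(\<integral>z. f z \<partial>lebesgue) = (\<integral>t. G t \<partial>lborel)"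
proof -
  obtain f' where f': "f' \<in> borel_measurable lborel" "AE z in lborel. f z = f' z"
    using completion_ex_borel_measurable_real[OF borel_measurable_integrable[OF f]] by blast
  have ae: "AE z in lebesgue. f z = f' z" using f'(2) by (simp add: AE_lebesgue_iff)
  have f'_leb: "f' \<in> borel_measurable lebesgue" using f'(1) by (rule measurable_completion)
  have int_eq: "(\<integral>z. f z \<partial>lebesgue) = (\<integral>z. f' z \<partial>lebesgue)"
    using borel_measurable_integrable[OF f] f'_leb ae by (rule integral_cong_AE)
  have "integrable lebesgue f'" using iffD1[OF integrable_cong_AE[OF borel_measurable_integrable[OF f] f'_leb ae] f] .
  then have int: "integrable (lborel \<Otimes>\<^sub>M lborel) f'"
    using f'(1) by (simp add: lborel_prod integrable_completion)
  define G where "G t = (\<integral>x. f' (x, t) \<partial>lborel)" for t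
  have "(\<integral>z. f z \<partial>lebesgue) = (\<integral>t. G t \<partial>lborel)"
    using int lborel_pair.integral_snd[of "\<lambda>x t. f' (x, t)"] f'(1)
    by (simp add: int_eq integral_completion G_def lborel_prod)
  moreover have "G \<in> borel_measurable borel"
  proof -
    have "f' \<in> borel_measurable (lborel \<Otimes>\<^sub>M lborel)" using f'(1) by (simp add: lborel_prod)
    then have "(\<lambda>(t, x). f' (x, t)) \<in> borel_measurable (lborel \<Otimes>\<^sub>M lborel)" by measurable
    from lborel.borel_measurable_lebesgue_integral[OF this] show ?thesis by (simp add: G_def[abs_def])
  qed
  moreover have "AE t in lebesgue. (\<integral>x. f (x, t) \<partial>lebesgue) = G t"
    using AE_lebesgue_slices_snd[OF ae]
  proof eventually_elim
    case (elim t)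
    have "(\<lambda>x. (x, t)) \<in> borel_measurable lborel"
      by (simp add: borel_measurable_continuous_onI continuous_on_Pair)
    then have m: "(\<lambda>x. f' (x, t)) \<in> borel_measurable lborel"
      using f'(1) by (simp add: measurable_compose[of _ _ borel])
    then have m': "(\<lambda>x. f' (x, t)) \<in> borel_measurable lebesgue" by (rule measurable_completion)
    have "(\<integral>x. f (x, t) \<partial>lebesgue) = (\<integral>x. f' (x, t) \<partial>lebesgue)"
      using measurable_lebesgue_cong_AE[OF m' elim] m' elim by (rule integral_cong_AE)
    then show ?case using m by (simp add: integral_completion G_def)
  qed
  ultimately show thesis by (intro that)
qed

text \<open>
  This form suffices to pass from weak gradients on time slices to weak gradients in space-time.
\<close>

lemma integral_lebesgue_eq_slices:
  fixes f g :: "('a::euclidean_space \<times> 'b::euclidean_space) \<Rightarrow> real"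
  assumes "integrable lebesgue f" "integrable lebesgue g"
    and "AE t in lebesgue. (\<integral>x. f (x, t) \<partial>lebesgue) = (\<integral>x. g (x, t) \<partial>lebesgue)"
  shows "(\<integral>z. f z \<partial>lebesgue) = (\<integral>z. g z \<partial>lebesgue)"
proof -
  obtain F where F: "F \<in> borel_measurable borel" "AE t in lebesgue. (\<integral>x. f (x, t) \<partial>lebesgue) = F t"
    "(\<integral>z. f z \<partial>lebesgue) = (\<integral>t. F t \<partial>lborel)"
    using integral_lebesgue_slices[OF assms(1)] by blast
  obtain G where G: "G \<in> borel_measurable borel" "AE t in lebesgue. (\<integral>x. g (x, t) \<partial>lebesgue) = G t"
    "(\<integral>z. g z \<partial>lebesgue) = (\<integral>t. G t \<partial>lborel)"
    using integral_lebesgue_slices[OF assms(2)] by blast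
  have "AE t in lborel. F t = G t"
    using F(2) G(2) assms(3) unfolding AE_lebesgue_iff by eventually_elim simp
  then have "(\<integral>t. F t \<partial>lborel) = (\<integral>t. G t \<partial>lborel)"
    by (intro integral_cong_AE) (simp_all add: F(1) G(1))
  with F(3) G(3) show ?thesis by simp
qed

lemma AE_integrable_slice:
  fixes f :: "('a::euclidean_space \<times> 'b::euclidean_space) \<Rightarrow> real"
  assumes f: "integrable lebesgue f"
  shows "AE x in lebesgue. integrable lebesgue (\<lambda>t. f (x, t))"
proof -
  obtain f' where f': "f' \<in> borel_measurable lborel" "AE z in lborel. f z = f' z"
    using completion_ex_borel_measurable_real[OF borel_measurable_integrable[OF f]] by blast
  have ae: "AE z in lebesgue. f z = f' z" using f'(2) by (simp add: AE_lebesgue_iff)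
  have f'_leb: "f' \<in> borel_measurable lebesgue" using f'(1) by (rule measurable_completion)
  have "integrable lebesgue f'" using iffD1[OF integrable_cong_AE[OF borel_measurable_integrable[OF f] f'_leb ae] f] .
  then have int: "integrable (lborel \<Otimes>\<^sub>M lborel) f'"
    using f'(1) by (simp add: lborel_prod integrable_completion)
  have "AE x in lebesgue. integrable lborel (\<lambda>t. f' (x, t))"
    unfolding AE_lebesgue_iff using lborel_pair.AE_integrable_fst'[OF int] .
  with AE_lebesgue_slices[OF ae] show ?thesis
  proof eventually_elim
    case (elim x)
    then have i: "integrable lebesgue (\<lambda>t. f' (x, t))" by (simp add: integrable_completion)
    moreover have "(\<lambda>t. f (x, t)) \<in> borel_measurable lebesgue"
      using measurable_lebesgue_cong_AE[OF borel_measurable_integrable[OF i] elim(1)] .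
    ultimately show ?case using iffD2[OF integrable_cong_AE[OF _ borel_measurable_integrable[OF i] elim(1)] i] by blast
  qed
qed

text \<open>
  Almost everywhere, the averages of \<open>\<bar>v - c\<bar>\<close> over shrinking cubes converge to \<open>\<bar>v z - c\<bar>\<close>,
  simultaneously for all rational \<open>c\<close>. A rational \<open>c\<close> close to \<open>v z\<close> gives the assertion.
\<close>

lemma AE_lebesgue_point:
  fixes v :: "'a::euclidean_space \<Rightarrow> real"
  assumes S: "S \<in> sets lebesgue" and v: "integrable (lebesgue_on S) v"
  shows "AE z in lebesgue. z \<in> S \<longrightarrow> lebesgue_point S v z"
proof -
  define V where "V z = (if z \<in> S then v z else 0)" for z
  have V: "integrable lebesgue V"
  proof -
    have "V = (\<lambda>z. indicator S z *\<^sub>R v z)" by (auto simp: V_def fun_eq_iff)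
    then show ?thesis using v S integrable_restrict_space[of S lebesgue v] by simp
  qed
  define B where "B z d = cbox z (z + d *\<^sub>R (One::'a))" for z d
  have B_leb: "B z d \<in> lmeasurable" for z d by (simp add: B_def)
  have int_cbox: "(\<lambda>\<zeta>. \<bar>V \<zeta> - c\<bar>) absolutely_integrable_on cbox a b" for c a b
  proof -
    have "V absolutely_integrable_on cbox a b"
      by (rule set_integrable_subset[of _ UNIV]) (use V in \<open>auto simp: set_integrable_def\<close>)
    moreover have "(\<lambda>_. c) absolutely_integrable_on cbox a b"
      by (simp add: absolutely_integrable_on_const)
    ultimately have "(\<lambda>\<zeta>. V \<zeta> - c) absolutely_integrable_on cbox a b" by (rule set_integral_diff(1))
    then show ?thesis by (rule set_integrable_abs)
  qed
  then have int: "(\<lambda>\<zeta>. \<bar>V \<zeta> - c\<bar>) absolutely_integrable_on B z d" for c z d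
    by (simp add: B_def)
  have "\<exists>N. negligible N \<and> (\<forall>z e. z \<notin> N \<longrightarrow> 0 < e \<longrightarrow> (\<exists>d>0. \<forall>h. 0 < h \<and> h < d \<longrightarrow>
      norm (integral (B z h) (\<lambda>\<zeta>. \<bar>V \<zeta> - c\<bar>) /\<^sub>R h ^ DIM('a) - \<bar>V z - c\<bar>) < e))" for c
  proof -
    have "(\<lambda>\<zeta>. \<bar>V \<zeta> - c\<bar>) integrable_on cbox a b" for a b
      using int_cbox by (rule set_lebesgue_integral_eq_integral(1))
    from integrable_ccontinuous_explicit[of "\<lambda>\<zeta>. \<bar>V \<zeta> - c\<bar>", OF this] show ?thesis
      unfolding B_def by metis
  qed
  then obtain N where N: "\<And>c. negligible (N c)"
    "\<And>c z e. z \<notin> N c \<Longrightarrow> 0 < e \<Longrightarrow> \<exists>d>0. \<forall>h. 0 < h \<and> h < d \<longrightarrow>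
      norm (integral (B z h) (\<lambda>\<zeta>. \<bar>V \<zeta> - c\<bar>) /\<^sub>R h ^ DIM('a) - \<bar>V z - c\<bar>) < e"
    by metis
  have "(\<Union>c\<in>\<rat>. N c) \<in> null_sets lebesgue"
    using N(1) countable_rat by (intro null_sets_UN') (auto simp: negligible_iff_null_sets)
  then show ?thesis
  proof (rule AE_I', intro subsetI)
    fix z assume "z \<in> {z \<in> space lebesgue. \<not> (z \<in> S \<longrightarrow> lebesgue_point S v z)}"
    then have z: "z \<in> S" "\<not> lebesgue_point S v z" by auto
    show "z \<in> (\<Union>c\<in>\<rat>. N c)"
    proof (rule ccontr)
      assume zN: "z \<notin> (\<Union>c\<in>\<rat>. N c)"
      have "lebesgue_point S v z" unfolding lebesgue_point_def
      proof (rule tendstoI)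
        fix e :: real assume "0 < e"
        \<comment> \<open>the constant \<open>c\<close> is compared with \<open>v z\<close> twice, in the integrand and in the limit; hence the thirds\<close>
        obtain c where c: "c \<in> \<rat>" "V z < c" "c < V z + e / 3"
          using Rats_dense_in_real[of "V z" "V z + e / 3"] \<open>0 < e\<close> by auto
        obtain d where d: "0 < d" "\<And>h. 0 < h \<Longrightarrow> h < d \<Longrightarrow>
          norm (integral (B z h) (\<lambda>\<zeta>. \<bar>V \<zeta> - c\<bar>) /\<^sub>R h ^ DIM('a) - \<bar>V z - c\<bar>) < e / 3"
          using N(2)[of z c "e / 3"] zN c(1) \<open>0 < e\<close> by auto
        have bound: "\<bar>(\<integral>\<zeta>. \<bar>v \<zeta> - v z\<bar> * indicator (B z h) \<zeta> \<partial>lebesgue_on S) / h ^ DIM('a)\<bar> < e"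
          if h: "0 < h" "h < d" for h
        proof -
          let ?I = "\<integral>\<zeta>. \<bar>v \<zeta> - v z\<bar> * indicator (B z h) \<zeta> \<partial>lebesgue_on S"
          have "?I = (\<integral>\<zeta>. indicator S \<zeta> * (\<bar>v \<zeta> - v z\<bar> * indicator (B z h) \<zeta>) \<partial>lebesgue)"
            using S by (subst integral_restrict_space) auto
          also have "\<dots> \<le> (\<integral>\<zeta>. indicator (B z h) \<zeta> *\<^sub>R \<bar>V \<zeta> - V z\<bar> \<partial>lebesgue)"
          proof (rule integral_mono_AE')
            show "integrable lebesgue (\<lambda>\<zeta>. indicator (B z h) \<zeta> *\<^sub>R \<bar>V \<zeta> - V z\<bar>)"
              using int[where c="V z"] by (simp add: set_integrable_def)
          qed (use z(1) in \<open>auto simp: V_def indicator_def\<close>)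
          also have "\<dots> = integral (B z h) (\<lambda>\<zeta>. \<bar>V \<zeta> - V z\<bar>)"
            using set_lebesgue_integral_eq_integral(2)[OF int] by (simp add: set_lebesgue_integral_def)
          also have "\<dots> \<le> integral (B z h) (\<lambda>\<zeta>. \<bar>V \<zeta> - c\<bar> + \<bar>V z - c\<bar>)"
            using int[of z h] B_leb[of z h]
            by (intro integral_le integrable_add) (auto intro: set_lebesgue_integral_eq_integral(1) integrable_on_const)
          also have "\<dots> = integral (B z h) (\<lambda>\<zeta>. \<bar>V \<zeta> - c\<bar>) + \<bar>V z - c\<bar> * h ^ DIM('a)"
          proof -
            have "measure lebesgue (B z h) = h ^ DIM('a)"
              using h by (simp add: B_def content_cbox_if box_eq_empty inner_add_left prod_constant)
            then have "integral (B z h) (\<lambda>_. \<bar>V z - c\<bar>) = \<bar>V z - c\<bar> * h ^ DIM('a)"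
              by (simp add: B_def)
            then show ?thesis using int[where c=c and z=z and d=h] B_leb[of z h]
              by (subst Henstock_Kurzweil_Integration.integral_add)
                 (auto intro: set_lebesgue_integral_eq_integral(1) integrable_on_const)
          qed
          finally have "?I / h ^ DIM('a) \<le> integral (B z h) (\<lambda>\<zeta>. \<bar>V \<zeta> - c\<bar>) / h ^ DIM('a) + \<bar>V z - c\<bar>"
            using h by (simp add: field_simps)
          moreover have "integral (B z h) (\<lambda>\<zeta>. \<bar>V \<zeta> - c\<bar>) / h ^ DIM('a) < \<bar>V z - c\<bar> + e / 3"
          proof -
            have "\<bar>a / b - c'\<bar> < e' \<Longrightarrow> a / b < c' + e'" for a b c' e' :: real by linarith
            moreover have "\<bar>integral (B z h) (\<lambda>\<zeta>. \<bar>V \<zeta> - c\<bar>) / h ^ DIM('a) - \<bar>V z - c\<bar>\<bar> < e / 3"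
            proof -
              have "integral (B z h) (\<lambda>\<zeta>. \<bar>V \<zeta> - c\<bar>) / h ^ DIM('a)
                  = integral (B z h) (\<lambda>\<zeta>. \<bar>V \<zeta> - c\<bar>) /\<^sub>R h ^ DIM('a)"
                unfolding real_scaleR_def divide_inverse by (rule mult.commute)
              then show ?thesis using d(2)[OF h] by (simp only: real_norm_def)
            qed
            ultimately show ?thesis by blast
          qed
          moreover have "0 \<le> ?I" by (simp add: integral_nonneg)
          moreover have "\<bar>V z - c\<bar> < e / 3" using c(2,3) by simp
          ultimately show ?thesis using h by simp
        qed
        show "\<forall>\<^sub>F d in at_right 0. dist ((\<integral>\<zeta>. \<bar>v \<zeta> - v z\<bar> * indicator (cbox z (z + d *\<^sub>R One)) \<zeta> \<partial>lebesgue_on S) / d ^ DIM('a)) 0 < e"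
          unfolding eventually_at_right_field
          by (rule exI[of _ d]) (use d(1) bound in \<open>auto simp: B_def dist_real_def\<close>)
      qed
      with z(2) show False by simp
    qed
  qed
qed

lemma integral_lebesgue_on_superset:
  fixes f :: "'a::euclidean_space \<Rightarrow> real"
  assumes "S \<in> sets lebesgue" "T \<in> sets lebesgue" "S \<subseteq> T" "\<And>z. z \<in> T - S \<Longrightarrow> f z = 0"
  shows "(\<integral>z. f z \<partial>lebesgue_on T) = (\<integral>z. f z \<partial>lebesgue_on S)"
proof -
  have "(\<integral>z. f z \<partial>lebesgue_on T) = (\<integral>z. indicator T z *\<^sub>R f z \<partial>lebesgue)"
    using assms by (intro integral_restrict_space) auto
  also have "\<dots> = (\<integral>z. indicator S z *\<^sub>R f z \<partial>lebesgue)"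
    using assms by (intro Bochner_Integration.integral_cong) (auto simp: indicator_def)
  also have "\<dots> = (\<integral>z. f z \<partial>lebesgue_on S)"
    using assms by (intro integral_restrict_space[symmetric]) auto
  finally show ?thesis .
qed

section \<open>Norms of vectors and scalar components\<close>

lemma vnorm_nonneg: "0 \<le> vnorm N y"
  by (simp add: vnorm_def L2_set_nonneg)

text \<open>
  Duality of the Euclidean norm: estimates for vectors are reduced to scalar components
  in the direction of a vector \<open>e\<close> of norm at most 1, without loss in the constants.
\<close>

lemma norm_combination_le_vnorm:
  fixes y :: "nat \<Rightarrow> 'b::real_normed_vector"
  assumes "L2_set e {..<N} \<le> 1"
  shows "norm (\<Sum>i<N. e i *\<^sub>R y i) \<le> vnorm N y"
proof -
  have "norm (\<Sum>i<N. e i *\<^sub>R y i) \<le> (\<Sum>i<N. \<bar>e i\<bar> * \<bar>norm (y i)\<bar>)"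
    by (rule order_trans[OF norm_sum]) simp
  also have "\<dots> \<le> L2_set e {..<N} * L2_set (\<lambda>i. norm (y i)) {..<N}" by (rule L2_set_mult_ineq)
  also have "\<dots> \<le> 1 * L2_set (\<lambda>i. norm (y i)) {..<N}"
    using assms by (intro mult_right_mono) (auto simp: L2_set_nonneg)
  finally show ?thesis by (simp add: vnorm_def)
qed

lemma vnorm_attained:
  fixes y :: "nat \<Rightarrow> real"
  obtains e where "L2_set e {..<N} \<le> 1" "vnorm N y = (\<Sum>i<N. e i * y i)"
proof (cases "vnorm N y = 0")
  case True
  show ?thesis by (rule that[of "\<lambda>_. 0"]) (use True in \<open>simp_all add: L2_set_def\<close>)
next
  case False
  define c where "c = vnorm N y"
  have c: "0 < c" using False vnorm_nonneg[of N y] by (simp add: c_def)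
  have sq: "(\<Sum>i<N. (y i)\<^sup>2) = c\<^sup>2" by (simp add: c_def vnorm_def L2_set_def sum_nonneg)
  show ?thesis
  proof (rule that[of "\<lambda>i. y i / c"])
    have "L2_set (\<lambda>i. y i / c) {..<N} = sqrt ((\<Sum>i<N. (y i)\<^sup>2) / c\<^sup>2)"
      by (simp add: L2_set_def power_divide sum_divide_distrib)
    then show "L2_set (\<lambda>i. y i / c) {..<N} \<le> 1" using c by (simp add: sq)
    have "(\<Sum>i<N. y i / c * y i) = (\<Sum>i<N. (y i)\<^sup>2) / c"
      by (simp add: sum_divide_distrib power2_eq_square)
    also have "\<dots> = c" unfolding sq using c by (simp add: power2_eq_square)
    finally show "vnorm N y = (\<Sum>i<N. y i / c * y i)" by (simp add: c_def)
  qed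
qed

lemma vnorm_leI:
  fixes y :: "nat \<Rightarrow> real"
  assumes "\<And>e. L2_set e {..<N} \<le> 1 \<Longrightarrow> (\<Sum>i<N. e i * y i) \<le> c"
  shows "vnorm N y \<le> c"
  using vnorm_attained[of N y] assms by metis

lemma vnorm_minus_commute:
  fixes a b :: "nat \<Rightarrow> 'b::real_normed_vector"
  shows "vnorm N (\<lambda>i. a i - b i) = vnorm N (\<lambda>i. b i - a i)"
  by (simp add: vnorm_def norm_minus_commute)

lemma component_measurable:
  fixes f :: "'a \<Rightarrow> nat \<Rightarrow> 'b::topological_space"
  assumes "f \<in> borel_measurable M"
  shows "(\<lambda>z. f z i) \<in> borel_measurable M"
proof (rule measurable_compose[OF assms, of "\<lambda>v. v i"])
  show "(\<lambda>v::nat \<Rightarrow> 'b. v i) \<in> borel_measurable borel"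
    by (intro borel_measurable_continuous_onI continuous_on_product_coordinates)
qed

lemma vnorm_measurable:
  fixes f :: "'a \<Rightarrow> nat \<Rightarrow> 'b::{real_normed_vector, second_countable_topology}"
  assumes "f \<in> borel_measurable M"
  shows "(\<lambda>z. vnorm N (f z)) \<in> borel_measurable M"
proof -
  have [measurable]: "(\<lambda>z. f z i) \<in> borel_measurable M" for i using component_measurable[OF assms] .
  show ?thesis unfolding vnorm_def L2_set_def by measurable
qed

lemma norm_le_vnorm: "i < N \<Longrightarrow> norm (y i) \<le> vnorm N y"
  unfolding vnorm_def by (rule order_trans[OF _ member_le_L2_set]) auto

section \<open>The strong maximal function\<close>

lemma emeasure_bicyl:
  fixes y :: "real^'n"
  assumes "0 < \<rho>" "0 < s"
  shows "emeasure lebesgue (ball y \<rho> \<times> {\<tau> - s<..<\<tau> + s}) = ennreal (bivol TYPE('n) \<rho> s)"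
proof -
  have "open (ball y \<rho> \<times> {\<tau> - s<..<\<tau> + s})" by (intro open_Times) auto
  then have "emeasure lebesgue (ball y \<rho> \<times> {\<tau> - s<..<\<tau> + s}) = emeasure (lborel \<Otimes>\<^sub>M lborel) (ball y \<rho> \<times> {\<tau> - s<..<\<tau> + s})"
    by (simp add: lborel_prod)
  also have "\<dots> = emeasure lborel (ball y \<rho>) * emeasure lborel {\<tau> - s<..<\<tau> + s}"
    by (rule lborel.emeasure_pair_measure_Times) auto
  also have "\<dots> = ennreal (unit_ball_vol (real CARD('n)) * \<rho> ^ CARD('n)) * ennreal (2 * s)"
    using assms by (simp add: emeasure_ball)
  also have "\<dots> = ennreal (bivol TYPE('n) \<rho> s)"
    unfolding bivol_def using assms by (intro ennreal_mult[symmetric]) auto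
  finally show ?thesis .
qed

lemma bivol_pos: "0 < \<rho> \<Longrightarrow> 0 < s \<Longrightarrow> 0 < bivol TYPE('n::finite) \<rho> s"
  by (simp add: bivol_def)

lemma nn_integral_bicyl_le_maximal:
  fixes z :: "(real^'n) \<times> real"
  assumes "0 < \<rho>" "0 < s" and X: "strong_maximal f z \<le> ennreal Y"
  shows "(\<integral>\<^sup>+\<zeta>\<in>bicyl z \<rho> s. ennreal \<bar>f \<zeta>\<bar> \<partial>lebesgue) \<le> ennreal Y * ennreal (bivol TYPE('n) \<rho> s)"
proof -
  let ?C = "bicyl z \<rho> s"
  have "eavg ?C (\<lambda>\<zeta>. ennreal \<bar>f \<zeta>\<bar>) \<le> strong_maximal f z"
    unfolding strong_maximal_def bicyl_def
  proof (rule Sup_upper, rule CollectI, intro exI conjI)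
    show "z \<in> ball (fst z) \<rho> \<times> {snd z - s<..<snd z + s}" using assms by (simp add: mem_Times_iff)
  qed (use assms in auto)
  also note X
  finally have "(\<integral>\<^sup>+\<zeta>\<in>?C. ennreal \<bar>f \<zeta>\<bar> \<partial>lebesgue) / ennreal (bivol TYPE('n) \<rho> s) \<le> ennreal Y"
    using emeasure_bicyl[OF assms(1,2), of "fst z" "snd z"] by (simp add: eavg_def bicyl_def)
  then have "(\<integral>\<^sup>+\<zeta>\<in>?C. ennreal \<bar>f \<zeta>\<bar> \<partial>lebesgue) / ennreal (bivol TYPE('n) \<rho> s) * ennreal (bivol TYPE('n) \<rho> s)
      \<le> ennreal Y * ennreal (bivol TYPE('n) \<rho> s)" by (rule mult_right_mono) simp
  moreover have "a / ennreal (bivol TYPE('n) \<rho> s) * ennreal (bivol TYPE('n) \<rho> s) = a" for a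
    using bivol_pos[OF assms(1,2), where 'n='n] by (simp add: ennreal_divide_times ennreal_divide_self)
  ultimately show ?thesis by (simp only:)
qed

text \<open>
  The affine majorant \<open>a + b * W\<close> is how powers of \<open>W\<close> are handled: \<open>a\<close> contributes the volume of
  the cylinder and \<open>b * W\<close> the maximal function.
\<close>

lemma avg_le_of_maximal:
  fixes z :: "(real^'n) \<times> real" and S :: "((real^'n) \<times> real) set"
  assumes S: "S \<in> sets lebesgue"
    and f: "integrable (lebesgue_on S) f" "\<And>\<zeta>. 0 \<le> f \<zeta>"
    and W: "W \<in> borel_measurable (lebesgue_on S)" "\<And>\<zeta>. 0 \<le> W \<zeta>"
    and le: "\<And>\<zeta>. \<zeta> \<in> S \<Longrightarrow> f \<zeta> \<le> a + b * W \<zeta>"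
    and ab: "0 \<le> a" "0 \<le> b" "0 \<le> Y"
    and X: "strong_maximal (\<lambda>\<zeta>. W \<zeta> * indicator S \<zeta>) z \<le> ennreal Y"
  shows "avg_le S f (a + b * Y) z"
  unfolding avg_le_def
proof (intro allI impI)
  fix R \<sigma> :: real assume pos: "0 < R" "0 < \<sigma>"
  let ?C = "bicyl z R \<sigma>" and ?V = "bivol TYPE('n) R \<sigma>"
  have V: "0 < ?V" using bivol_pos[OF pos] .
  have C: "?C \<in> sets lebesgue" by (intro sets_completionI_sets) simp
  have W': "(\<lambda>\<zeta>. W \<zeta> * indicator S \<zeta>) \<in> borel_measurable lebesgue"
    using W(1) S by (simp add: borel_measurable_restrict_space_iff mult.commute)
  have "(\<integral>\<^sup>+\<zeta>. ennreal (f \<zeta> * indicator ?C \<zeta>) \<partial>lebesgue_on S)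
      = (\<integral>\<^sup>+\<zeta>. ennreal (f \<zeta> * indicator ?C \<zeta>) * indicator S \<zeta> \<partial>lebesgue)"
    using S by (intro nn_integral_restrict_space) auto
  also have "\<dots> \<le> (\<integral>\<^sup>+\<zeta>. ennreal a * indicator ?C \<zeta> + ennreal b * (ennreal \<bar>W \<zeta> * indicator S \<zeta>\<bar> * indicator ?C \<zeta>) \<partial>lebesgue)"
  proof (rule nn_integral_mono)
    fix \<zeta>
    show "ennreal (f \<zeta> * indicator ?C \<zeta>) * indicator S \<zeta>
      \<le> ennreal a * indicator ?C \<zeta> + ennreal b * (ennreal \<bar>W \<zeta> * indicator S \<zeta>\<bar> * indicator ?C \<zeta>)"
    proof (cases "\<zeta> \<in> S \<and> \<zeta> \<in> ?C")
      case True
      have "ennreal (f \<zeta>) \<le> ennreal (a + b * W \<zeta>)" using le True by (intro ennreal_leI) auto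
      also have "\<dots> = ennreal a + ennreal b * ennreal (W \<zeta>)"
        using ab W(2)[of \<zeta>] by (simp add: ennreal_plus ennreal_mult)
      finally show ?thesis using True W(2)[of \<zeta>] by simp
    qed (auto simp: indicator_def)
  qed
  also have "\<dots> = ennreal a * emeasure lebesgue ?C + ennreal b * (\<integral>\<^sup>+\<zeta>\<in>?C. ennreal \<bar>W \<zeta> * indicator S \<zeta>\<bar> \<partial>lebesgue)"
  proof -
    have "(indicator ?C :: _ \<Rightarrow> ennreal) \<in> borel_measurable lebesgue" using C by (rule borel_measurable_indicator)
    moreover from this have "(\<lambda>\<zeta>. ennreal \<bar>W \<zeta> * indicator S \<zeta>\<bar> * indicator ?C \<zeta>) \<in> borel_measurable lebesgue"
      using W' by (intro borel_measurable_times_ennreal measurable_compose[OF _ measurable_ennreal] borel_measurable_abs)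
    moreover from calculation(1) have "(\<lambda>\<zeta>. ennreal a * indicator ?C \<zeta>) \<in> borel_measurable lebesgue"
      by (intro borel_measurable_times_ennreal) auto
    ultimately show ?thesis
      using C by (simp only: nn_integral_add nn_integral_cmult nn_integral_indicator borel_measurable_times_ennreal borel_measurable_const)
  qed
  also have "\<dots> \<le> ennreal a * ennreal ?V + ennreal b * (ennreal Y * ennreal ?V)"
    using emeasure_bicyl[OF pos, of "fst z" "snd z"] nn_integral_bicyl_le_maximal[OF pos X]
    by (intro add_mono mult_left_mono) (auto simp: bicyl_def)
  also have "\<dots> = ennreal ((a + b * Y) * ?V)"
    using ab V by (simp add: ennreal_mult[symmetric] ennreal_plus[symmetric] algebra_simps del: ennreal_plus)
  finally have nn: "(\<integral>\<^sup>+\<zeta>. ennreal (f \<zeta> * indicator ?C \<zeta>) \<partial>lebesgue_on S) \<le> ennreal ((a + b * Y) * ?V)" .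
  have "(\<integral>\<zeta>. f \<zeta> * indicator ?C \<zeta> \<partial>lebesgue_on S) = enn2real (\<integral>\<^sup>+\<zeta>. ennreal (f \<zeta> * indicator ?C \<zeta>) \<partial>lebesgue_on S)"
  proof (rule integral_eq_nn_integral)
    have "indicator ?C \<in> borel_measurable (lebesgue_on S)" by (rule borel_measurable_lebesgue_on) simp
    then show "(\<lambda>\<zeta>. f \<zeta> * indicator ?C \<zeta>) \<in> borel_measurable (lebesgue_on S)"
      by (rule borel_measurable_times[OF borel_measurable_integrable[OF f(1)]])
  qed (use f(2) in \<open>simp add: indicator_def\<close>)
  also have "\<dots> \<le> (a + b * Y) * ?V"
    using nn ab V by (intro enn2real_leI) (auto intro!: mult_nonneg_nonneg)
  finally show "(\<integral>\<zeta>. f \<zeta> * indicator ?C \<zeta> \<partial>lebesgue_on S) \<le> (a + b * Y) * ?V" .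
qed

lemma avg_le_mono:
  fixes z :: "(real^'n) \<times> real"
  shows "avg_le S f m z \<Longrightarrow> m \<le> m' \<Longrightarrow> avg_le S f m' z"
  unfolding avg_le_def by (meson bivol_pos less_imp_le mult_right_mono order_trans)

text \<open>
  The strong maximal function is lower semicontinuous, since the cylinders of its definition are open and
  only required to contain the point.
\<close>

lemma strong_maximal_measurable:
  fixes f :: "(real^'n) \<times> real \<Rightarrow> real"
  shows "strong_maximal f \<in> borel_measurable borel"
proof (rule borel_measurableI_greater)
  fix a
  have "{z. a < strong_maximal f z} = \<Union>{ball y \<rho> \<times> {\<tau> - s<..<\<tau> + s} | y \<rho> \<tau> s.
      0 < \<rho> \<and> 0 < s \<and> a < eavg (ball y \<rho> \<times> {\<tau> - s<..<\<tau> + s}) (\<lambda>\<zeta>. ennreal \<bar>f \<zeta>\<bar>)}"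
    unfolding strong_maximal_def less_Sup_iff by blast
  moreover have "open \<dots>" by (rule open_Union) (auto intro!: open_Times)
  ultimately show "{z \<in> space borel. a < strong_maximal f z} \<in> sets borel" by simp
qed

lemma epowr_measurable:
  assumes "X \<in> borel_measurable M" shows "(\<lambda>z. epowr (X z) a) \<in> borel_measurable M"
  unfolding epowr_def using assms by measurable

lemma majorant_measurable: "majorant N p u Du F x0 t0 r \<in> borel_measurable borel"
  unfolding majorant_def[abs_def] Let_def
  using strong_maximal_measurable by (cases "p < 2") (auto intro!: epowr_measurable borel_measurable_add)

lemma majorant_slice_measurable: "(\<lambda>t. majorant N p u Du F x0 t0 r (x, t)) \<in> borel_measurable borel"
  by (rule measurable_compose[OF _ majorant_measurable]) (simp add: borel_measurable_continuous_onI continuous_on_Pair)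

lemma epowr_ge_1: "1 \<le> X \<Longrightarrow> 0 < a \<Longrightarrow> 1 \<le> epowr X a"
proof -
  assume X: "1 \<le> X" and a: "0 < a"
  show ?thesis
  proof (cases X)
    case (real x)
    then have "1 \<le> x" using X by (simp add: ennreal_1[symmetric] del: ennreal_1)
    then show ?thesis using real a by (simp add: epowr_def ge_one_powr_ge_zero)
  qed (simp add: epowr_def)
qed

lemma majorant_ge_1: "1 < p \<Longrightarrow> 1 \<le> majorant N p u Du F x0 t0 r z"
  by (auto simp: majorant_def Let_def intro!: epowr_ge_1 simp: add_increasing)

section \<open>From pointwise differences to mean oscillation\<close>

lemma powr_le_one_plus:
  fixes y a m :: real
  assumes "0 \<le> y" "0 < a" "a \<le> m"
  shows "y powr a \<le> 1 + y powr m"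
proof (cases "y \<le> 1")
  case True
  then have "y powr a \<le> 1" using assms by (simp add: powr_le1)
  then show ?thesis by (simp add: add_increasing2)
next
  case False
  then have "y powr a \<le> y powr m" using assms by (intro powr_mono) auto
  then show ?thesis by simp
qed

lemma integrable_lower_power:
  fixes f :: "'a::euclidean_space \<Rightarrow> real"
  assumes S: "S \<in> lmeasurable" and f: "f \<in> borel_measurable (lebesgue_on S)" "\<And>z. 0 \<le> f z"
    and int: "integrable (lebesgue_on S) (\<lambda>z. f z powr m)" and a: "0 < a" "a \<le> m"
  shows "integrable (lebesgue_on S) (\<lambda>z. f z powr a)"
proof (rule Bochner_Integration.integrable_bound)
  interpret finite_measure "lebesgue_on S" by (rule finite_measure_lebesgue_on[OF S])
  show "integrable (lebesgue_on S) (\<lambda>z. 1 + f z powr m)" using int by simp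
  show "(\<lambda>z. f z powr a) \<in> borel_measurable (lebesgue_on S)" using f(1) by measurable
  show "AE z in lebesgue_on S. norm (f z powr a) \<le> norm (1 + f z powr m)"
    using powr_le_one_plus[OF f(2) a] by (intro AE_I2) (simp add: add_nonneg_nonneg)
qed

lemma power_sum_bound:
  fixes y A q :: real
  assumes "0 \<le> y" "0 \<le> A" "0 < q"
  shows "(y + 2 * A) powr q \<le> 3 powr q * (y powr q + A powr q)"
proof -
  have "(y + 2 * A) powr q \<le> (3 * max y A) powr q"
    using assms by (intro powr_mono2) auto
  also have "\<dots> = 3 powr q * (max y A) powr q" using assms by (simp add: powr_mult)
  also have "(max y A) powr q \<le> y powr q + A powr q"
    by (simp add: max_def)
  finally show ?thesis by simp
qed

lemma le_one_plus_powr: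
  fixes y q :: real
  assumes "0 \<le> y" "1 \<le> q"
  shows "y \<le> 1 + y powr q"
proof (cases "y \<le> 1")
  case False
  then have "y powr 1 \<le> y powr q" using assms by (intro powr_mono) auto
  then show ?thesis using False by simp
qed (simp add: add_increasing2)

text \<open>
  Normalising \<open>g\<close> by the \<open>q\<close>-mean \<open>A\<close> gives \<open>g \<le> A + A (g/A)^q\<close>, so the mean of \<open>g\<close> is at most
  \<open>2 A\<close>. The distance of \<open>w t\<close> from its mean is therefore at most \<open>K (g t + 2 A)\<close>, and the
  mean of the \<open>q\<close>-th power of this is bounded by \<open>(6 K)^q A^q\<close>. The condition \<open>1 \<le> g\<close> makes \<open>A\<close>
  positive.
\<close>

lemma mean_oscillation_le:
  fixes w :: "real \<Rightarrow> nat \<Rightarrow> real" and g :: "real \<Rightarrow> ennreal" and a b K q :: real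
  defines "I \<equiv> {a<..<b}"
  assumes ab: "a < b" and q: "1 \<le> q" and K: "0 < K"
    and w: "\<And>i. i < N \<Longrightarrow> integrable (lebesgue_on I) (\<lambda>t. w t i)"
    and g: "g \<in> borel_measurable borel" "\<And>t. 1 \<le> g t"
    and E: "AE t in lebesgue_on I. E t"
    and osc: "\<And>s t. s \<in> I \<Longrightarrow> t \<in> I \<Longrightarrow> E s \<Longrightarrow> E t \<Longrightarrow>
        ennreal (vnorm N (\<lambda>i. w t i - w s i)) \<le> ennreal K * (g t + g s)"
  shows "eavg I (\<lambda>t. ennreal (vnorm N (\<lambda>i. w t i - (\<integral>s. w s i \<partial>lebesgue_on I) / measure lebesgue I) powr q))
      \<le> ennreal ((6 * K) powr q) * eavg I (\<lambda>t. epowr (g t) q)"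
proof -
  let ?M = "lebesgue_on I"
  define len where "len = b - a"
  define m where "m i = (\<integral>s. w s i \<partial>?M) / len" for i
  have l: "0 < len" using ab by (simp add: len_def)
  have eI: "emeasure lebesgue I = ennreal len" using ab by (simp add: I_def len_def)
  have mI: "measure lebesgue I = len" using l by (simp add: measure_def eI)
  have I_leb: "I \<in> sets lebesgue" and I_lm: "I \<in> lmeasurable" by (auto simp: I_def)
  interpret finite_measure ?M by (rule finite_measure_lebesgue_on[OF I_lm])
  have measM: "measure ?M (space ?M) = len" using I_leb mI by (simp add: measure_restrict_space)
  have gq: "(\<lambda>t. epowr (g t) q) \<in> borel_measurable ?M"
    by (intro borel_measurable_lebesgue_on epowr_measurable g)
  have eavg_eq: "eavg I f = (\<integral>\<^sup>+t. f t \<partial>?M) / ennreal len" for f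
    using I_leb by (simp add: eavg_def eI nn_integral_restrict_space)
  define J where "J = (\<integral>\<^sup>+t. epowr (g t) q \<partial>?M)"
  \<comment> \<open>an infinite mean on the right-hand side makes the claim trivial\<close>
  show ?thesis
  proof (cases "J = \<infinity>")
    case True
    then have "eavg I (\<lambda>t. epowr (g t) q) = \<infinity>"
      by (simp add: eavg_eq J_def[symmetric] ennreal_divide_eq_top_iff)
    then show ?thesis using K by (simp add: ennreal_mult_eq_top_iff)
  next
    case False
    define G where "G t = enn2real (g t)" for t
    have G_meas: "G \<in> borel_measurable ?M"
      unfolding G_def[abs_def] by (intro borel_measurable_lebesgue_on measurable_compose[OF g(1)]) simp
    have G_nonneg: "0 \<le> G t" for t by (simp add: G_def)
    have fin: "AE t in ?M. g t \<noteq> \<infinity>"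
    proof -
      have "AE t in ?M. epowr (g t) q \<noteq> \<infinity>"
        by (rule nn_integral_PInf_AE[OF gq]) (use False in \<open>simp add: J_def\<close>)
      then show ?thesis by eventually_elim (auto simp: epowr_def)
    qed
    have J_G: "J = (\<integral>\<^sup>+t. ennreal (G t powr q) \<partial>?M)"
      unfolding J_def by (rule nn_integral_cong_AE) (use fin in eventually_elim, simp add: epowr_def G_def)
    have Gq_int: "integrable ?M (\<lambda>t. G t powr q)"
      using False G_meas by (intro integrableI_nonneg) (auto simp: J_G less_top)
    define P where "P = (\<integral>t. G t powr q \<partial>?M) / len"
    have int_Gq: "(\<integral>t. G t powr q \<partial>?M) = len * P" using l by (simp add: P_def)
    have J_P: "J = ennreal (len * P)"
      unfolding J_G int_Gq[symmetric] by (rule nn_integral_eq_integral[OF Gq_int]) simp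
    have G_ge: "AE t in ?M. 1 \<le> G t"
      using fin
    proof eventually_elim
      case (elim t)
      then have "ennreal 1 \<le> ennreal (G t)" using g(2)[of t] by (simp add: G_def less_top)
      then show ?case using G_nonneg[of t] by (subst (asm) ennreal_le_iff) auto
    qed
    have P: "1 \<le> P"
    proof -
      have "(\<integral>t. 1 \<partial>?M) \<le> (\<integral>t. G t powr q \<partial>?M)"
        by (rule integral_mono_AE) (use Gq_int G_ge q in \<open>auto simp: ge_one_powr_ge_zero elim: eventually_mono\<close>)
      then show ?thesis using l measM by (simp add: int_Gq)
    qed
    \<comment> \<open>the mean of order \<open>q\<close> of \<open>g\<close>\<close>
    define A where "A = P powr (1 / q)"
    have A: "1 \<le> A" using P q by (simp add: A_def ge_one_powr_ge_zero)
    have A_q: "A powr q = P" using P q by (simp add: A_def powr_powr)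
    have G_le: "G t \<le> A + A / P * (G t powr q)" for t
    proof -
      have "G t / A \<le> 1 + (G t / A) powr q" using G_nonneg A q by (intro le_one_plus_powr) auto
      also have "(G t / A) powr q = G t powr q / P" using G_nonneg A by (simp add: powr_divide A_q)
      finally have "G t \<le> (1 + G t powr q / P) * A" using A by (simp add: pos_divide_le_eq)
      then show ?thesis by (simp add: algebra_simps)
    qed
    have maj_int: "integrable ?M (\<lambda>t. A + A / P * (G t powr q))"
      using Gq_int by auto
    have G_int: "integrable ?M G"
      by (rule Bochner_Integration.integrable_bound[OF maj_int G_meas])
         (use G_le G_nonneg in \<open>auto intro!: AE_I2 simp: abs_of_nonneg intro: order_trans[OF _ abs_ge_self]\<close>)
    have int_G: "(\<integral>t. G t \<partial>?M) \<le> 2 * A * len"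
    proof -
      have "(\<integral>t. G t \<partial>?M) \<le> (\<integral>t. A + A / P * (G t powr q) \<partial>?M)"
        by (rule integral_mono[OF G_int maj_int G_le])
      also have "\<dots> = A * len + A / P * (len * P)" using Gq_int measM by (simp add: int_Gq)
      also have "\<dots> = 2 * A * len" using P by simp
      finally show ?thesis .
    qed
    have key: "AE t in ?M. vnorm N (\<lambda>i. w t i - m i) \<le> K * (G t + 2 * A)"
      using E fin AE_space
    proof eventually_elim
      case (elim t)
      then have tI: "t \<in> I" by simp
      show ?case
      proof (rule vnorm_leI)
        fix e assume e: "L2_set e {..<N} \<le> 1"
        have "(\<Sum>i<N. e i * (w t i - m i)) * len = (\<integral>s. (\<Sum>i<N. e i * (w t i - w s i)) \<partial>?M)"
        proof -
          have "(\<integral>s. (\<Sum>i<N. e i * (w t i - w s i)) \<partial>?M) = (\<Sum>i<N. \<integral>s. e i * (w t i - w s i) \<partial>?M)"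
            by (rule Bochner_Integration.integral_sum) (use w in auto)
          also have "\<dots> = (\<Sum>i<N. e i * (w t i - m i) * len)"
          proof (rule sum.cong[OF refl])
            fix i assume "i \<in> {..<N}"
            then have wi: "integrable ?M (\<lambda>s. w s i)" using w by simp
            have "(\<integral>s. e i * (w t i - w s i) \<partial>?M) = e i * ((\<integral>s. w t i \<partial>?M) - (\<integral>s. w s i \<partial>?M))"
              using wi by (simp add: Bochner_Integration.integral_diff)
            also have "(\<integral>s. w t i \<partial>?M) = len * w t i" using measM by simp
            also have "(\<integral>s. w s i \<partial>?M) = m i * len" using l by (simp add: m_def)
            finally show "(\<integral>s. e i * (w t i - w s i) \<partial>?M) = e i * (w t i - m i) * len"
              by (simp add: algebra_simps)
          qed
          finally show ?thesis by (simp add: sum_distrib_right)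
        qed
        also have "\<dots> \<le> (\<integral>s. K * (G t + G s) \<partial>?M)"
        proof (rule integral_mono_AE)
          show "integrable ?M (\<lambda>s. \<Sum>i<N. e i * (w t i - w s i))" using w by auto
          show "integrable ?M (\<lambda>s. K * (G t + G s))" using G_int by auto
          show "AE s in ?M. (\<Sum>i<N. e i * (w t i - w s i)) \<le> K * (G t + G s)"
            using E fin AE_space
          proof eventually_elim
            case (elim s)
            have "(\<Sum>i<N. e i * (w t i - w s i)) \<le> vnorm N (\<lambda>i. w t i - w s i)"
              using norm_combination_le_vnorm[OF e, of "\<lambda>i. w t i - w s i"] by simp
            moreover have "ennreal (vnorm N (\<lambda>i. w t i - w s i)) \<le> ennreal (K * (G t + G s))"
            proof -
              have "g t = ennreal (G t)" "g s = ennreal (G s)"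
                using elim \<open>g t \<noteq> \<infinity>\<close> by (auto simp: G_def less_top)
              then have "ennreal K * (g t + g s) = ennreal (K * (G t + G s))"
                using K G_nonneg by (simp add: ennreal_mult ennreal_plus)
              moreover have "ennreal (vnorm N (\<lambda>i. w t i - w s i)) \<le> ennreal K * (g t + g s)"
                using osc[of s t] elim tI \<open>E t\<close> by simp
              ultimately show ?thesis by simp
            qed
            moreover have "0 \<le> K * (G t + G s)" using K G_nonneg by simp
            ultimately show ?case by (simp add: ennreal_le_iff)
          qed
        qed
        also have "\<dots> = K * (G t * len + (\<integral>s. G s \<partial>?M))" using G_int measM by simp
        also have "\<dots> \<le> K * (G t * len + 2 * A * len)"
          using K int_G by (intro mult_left_mono) auto
        finally have "(\<Sum>i<N. e i * (w t i - m i)) * len \<le> (K * (G t + 2 * A)) * len"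
          by (simp add: algebra_simps)
        then show "(\<Sum>i<N. e i * (w t i - m i)) \<le> K * (G t + 2 * A)"
          using l by simp
      qed
    qed
    have "(\<integral>\<^sup>+t. ennreal (vnorm N (\<lambda>i. w t i - m i) powr q) \<partial>?M)
        \<le> (\<integral>\<^sup>+t. ennreal ((3 * K) powr q * (G t powr q + P)) \<partial>?M)"
    proof (rule nn_integral_mono_AE)
      show "AE t in ?M. ennreal (vnorm N (\<lambda>i. w t i - m i) powr q) \<le> ennreal ((3 * K) powr q * (G t powr q + P))"
        using key
      proof eventually_elim
        case (elim t)
        have "vnorm N (\<lambda>i. w t i - m i) powr q \<le> (K * (G t + 2 * A)) powr q"
          using elim q by (intro powr_mono2) (auto simp: vnorm_nonneg)
        also have "\<dots> = K powr q * (G t + 2 * A) powr q"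
          using K G_nonneg A by (simp add: powr_mult)
        also have "\<dots> \<le> K powr q * (3 powr q * (G t powr q + A powr q))"
          using G_nonneg A q by (intro mult_left_mono power_sum_bound) auto
        also have "\<dots> = (3 * K) powr q * (G t powr q + P)"
          using K by (simp add: powr_mult A_q)
        finally show ?case by (rule ennreal_leI)
      qed
    qed
    also have "\<dots> = ennreal (\<integral>t. (3 * K) powr q * (G t powr q + P) \<partial>?M)"
      by (rule nn_integral_eq_integral) (use Gq_int P in auto)
    also have "(\<integral>t. (3 * K) powr q * (G t powr q + P) \<partial>?M) = (3 * K) powr q * (2 * len * P)"
      using Gq_int measM by (simp add: int_Gq)
    also have "\<dots> \<le> (6 * K) powr q * (len * P)"
    proof -
      have "(6 * K) powr q = 2 powr q * (3 * K) powr q"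
        using K powr_mult[of 2 "3 * K" q] by simp
      moreover have "2 powr 1 \<le> (2::real) powr q" using q by (intro powr_mono) auto
      ultimately have "2 * (3 * K) powr q \<le> (6 * K) powr q" by (simp add: mult_right_mono)
      then have "2 * (3 * K) powr q * (len * P) \<le> (6 * K) powr q * (len * P)"
        using l P by (intro mult_right_mono) auto
      then show ?thesis by (simp add: mult_ac)
    qed
    finally have "(\<integral>\<^sup>+t. ennreal (vnorm N (\<lambda>i. w t i - m i) powr q) \<partial>?M) \<le> ennreal ((6 * K) powr q) * J"
      unfolding J_P using l P by (simp add: ennreal_mult[symmetric] ennreal_leI)
    then have "(\<integral>\<^sup>+t. ennreal (vnorm N (\<lambda>i. w t i - m i) powr q) \<partial>?M) / ennreal len \<le> ennreal ((6 * K) powr q) * J / ennreal len"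
      by (rule divide_right_mono_ennreal)
    then show ?thesis
      unfolding eavg_eq J_def mI m_def by (simp add: ennreal_times_divide)
  qed
qed
section \<open>Scalar components of a weak solution\<close>

locale solution =
  fixes N :: nat and p \<nu> L q :: real and \<Omega> :: "(real^'n) set" and T :: real
    and A :: "(real^'n) \<times> real \<Rightarrow> (nat \<Rightarrow> real^'n) \<Rightarrow> nat \<Rightarrow> real^'n"
    and F :: "(real^'n) \<times> real \<Rightarrow> nat \<Rightarrow> real^'n"
    and u :: "(real^'n) \<times> real \<Rightarrow> nat \<Rightarrow> real"
    and Du :: "(real^'n) \<times> real \<Rightarrow> nat \<Rightarrow> real^'n"
    and x0 :: "real^'n" and t0 r :: real
  assumes p: "1 < p" "p \<noteq> 2" and L: "0 < L" and q: "max 1 (p - 1) < q"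
    and \<Omega>: "open \<Omega>"
    and field: "caratheodory_field N p \<nu> L (spacetime \<Omega> T) A"
    and F: "F \<in> borel_measurable (lebesgue_on (spacetime \<Omega> T))"
      "Lloc (p * q / 2) (spacetime \<Omega> T) (\<lambda>z. vnorm N (F z))"
    and u: "LW_loc (p * q / 2) N \<Omega> T u Du"
    and weak: "weak_solution N p (spacetime \<Omega> T) A F u Du"
    and r: "0 < r" and inside: "cpt_contained (cylinder x0 t0 (2 * r)) (spacetime \<Omega> T)"
begin

abbreviation "S \<equiv> cylinder x0 t0 (2 * r)"

abbreviation "ST \<equiv> spacetime \<Omega> T"

lemma S_subset: "S \<subseteq> ST"
  using inside closure_subset by (auto simp: cpt_contained_def)

lemma S_lmeasurable: "S \<in> lmeasurable" by (rule cylinder_lmeasurable)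

lemma S_sets: "S \<in> sets lebesgue" using S_lmeasurable by auto

lemma ST_sets: "ST \<in> sets lebesgue"
  unfolding spacetime_def using \<Omega> by (intro sets_completionI_sets) (auto intro!: borel_open open_Times)

text \<open>
  The integrability exponent of the solution covers both the function itself and the power \<open>p - 1\<close>
  in the growth condition; for \<open>p > 2\<close> the latter needs \<open>q > p - 1\<close>.
\<close>

lemma exponent: "1 \<le> p * q / 2" "p - 1 \<le> p * q / 2"
proof -
  show 1: "1 \<le> p * q / 2" using u by (simp add: LW_loc_def)
  show "p - 1 \<le> p * q / 2"
  proof (cases "p \<le> 2")
    case False
    then have "2 * (p - 1) \<le> p * q" using q by (intro mult_mono) auto
    then show ?thesis by simp
  qed (use 1 in simp)
qed

text \<open>
  The closure of the doubled cylinder is the product of a closed ball and a closed interval, so the ball and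
  the interval are compactly contained separately, as the definition of the solution space demands.
\<close>

lemma ball_inside: "cpt_contained (ball x0 (2 * r)) \<Omega>"
  and times_inside: "0 < t0 - (2 * r)\<^sup>2" "t0 + (2 * r)\<^sup>2 < T"
proof -
  have pos: "0 < (2 * r)\<^sup>2" using r by simp
  have "closure S = cball x0 (2 * r) \<times> {t0 - (2 * r)\<^sup>2..t0 + (2 * r)\<^sup>2}"
    unfolding cylinder_def time_interval_def closure_Times using r pos by simp
  then have sub: "cball x0 (2 * r) \<times> {t0 - (2 * r)\<^sup>2..t0 + (2 * r)\<^sup>2} \<subseteq> \<Omega> \<times> {0<..<T}"
    using inside by (simp add: cpt_contained_def spacetime_def)
  have ne: "cball x0 (2 * r) \<noteq> {}" "t0 \<in> {t0 - (2 * r)\<^sup>2..t0 + (2 * r)\<^sup>2}" using r pos by auto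
  have "cball x0 (2 * r) \<subseteq> \<Omega>"
  proof
    fix x assume "x \<in> cball x0 (2 * r)"
    then have "(x, t0) \<in> \<Omega> \<times> {0<..<T}" using ne(2) by (intro subsetD[OF sub] SigmaI)
    then show "x \<in> \<Omega>" by simp
  qed
  then show "cpt_contained (ball x0 (2 * r)) \<Omega>" using r by (simp add: cpt_contained_def)
  have "{t0 - (2 * r)\<^sup>2..t0 + (2 * r)\<^sup>2} \<subseteq> {0<..<T}"
  proof
    fix t assume "t \<in> {t0 - (2 * r)\<^sup>2..t0 + (2 * r)\<^sup>2}"
    then have "(x0, t) \<in> \<Omega> \<times> {0<..<T}" using r by (intro subsetD[OF sub] SigmaI) auto
    then show "t \<in> {0<..<T}" by simp
  qed
  then show "0 < t0 - (2 * r)\<^sup>2" "t0 + (2 * r)\<^sup>2 < T" using pos by (auto simp: subset_iff)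
qed

lemma slices_weakly_differentiable:
  "AE t in lebesgue_on (time_interval t0 (2 * r)). \<forall>i<N. W1 (p * q / 2) (ball x0 (2 * r)) (\<lambda>x. u (x,t) i) (\<lambda>x. Du (x,t) i)"
  and powers_integrable: "integrable (lebesgue_on S) (\<lambda>z. vnorm N (u z) powr (p * q / 2) + vnorm N (Du z) powr (p * q / 2))"
proof -
  have "t0 - (2 * r)\<^sup>2 < t0 + (2 * r)\<^sup>2" using r by simp
  then have "open (ball x0 (2 * r)) \<and> cpt_contained (ball x0 (2 * r)) \<Omega> \<and> 0 < t0 - (2 * r)\<^sup>2 \<and>
      t0 - (2 * r)\<^sup>2 < t0 + (2 * r)\<^sup>2 \<and> t0 + (2 * r)\<^sup>2 < T"
    using ball_inside times_inside by simp
  with u show "AE t in lebesgue_on (time_interval t0 (2 * r)). \<forall>i<N. W1 (p * q / 2) (ball x0 (2 * r)) (\<lambda>x. u (x,t) i) (\<lambda>x. Du (x,t) i)"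
    "integrable (lebesgue_on S) (\<lambda>z. vnorm N (u z) powr (p * q / 2) + vnorm N (Du z) powr (p * q / 2))"
    unfolding LW_loc_def time_interval_def cylinder_def by blast+
qed

lemma measurable_on_S:
  "u \<in> borel_measurable (lebesgue_on S)" "Du \<in> borel_measurable (lebesgue_on S)" "F \<in> borel_measurable (lebesgue_on S)"
  using u F(1) S_subset by (auto simp: LW_loc_def intro: measurable_restrict_mono)

lemma vnorm_measurable_on_S [measurable]:
  "(\<lambda>z. vnorm N (u z)) \<in> borel_measurable (lebesgue_on S)"
  "(\<lambda>z. vnorm N (Du z)) \<in> borel_measurable (lebesgue_on S)"
  "(\<lambda>z. vnorm N (F z)) \<in> borel_measurable (lebesgue_on S)"
  by (intro vnorm_measurable measurable_on_S)+

lemma power_integrable_u: "integrable (lebesgue_on S) (\<lambda>z. vnorm N (u z) powr (p * q / 2))"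
proof (rule Bochner_Integration.integrable_bound[OF powers_integrable])
  show "(\<lambda>z. vnorm N (u z) powr (p * q / 2)) \<in> borel_measurable (lebesgue_on S)" by measurable
qed simp

lemma power_integrable_Du: "integrable (lebesgue_on S) (\<lambda>z. vnorm N (Du z) powr (p * q / 2))"
proof (rule Bochner_Integration.integrable_bound[OF powers_integrable])
  show "(\<lambda>z. vnorm N (Du z) powr (p * q / 2)) \<in> borel_measurable (lebesgue_on S)" by measurable
qed simp

lemma power_integrable_F: "integrable (lebesgue_on S) (\<lambda>z. vnorm N (F z) powr (p * q / 2))"
proof -
  have "integrable (lebesgue_on (closure S)) (\<lambda>z. vnorm N (F z) powr (p * q / 2))"
    using F(2) inside by (simp add: Lloc_def cpt_contained_def vnorm_nonneg)
  then have "set_integrable lebesgue (closure S) (\<lambda>z. vnorm N (F z) powr (p * q / 2))"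
    by (simp add: set_integrable_def integrable_restrict_space)
  then have "set_integrable lebesgue S (\<lambda>z. vnorm N (F z) powr (p * q / 2))"
    by (rule set_integrable_subset) (use S_sets closure_subset in auto)
  then show ?thesis using S_sets by (simp add: set_integrable_def integrable_restrict_space)
qed

lemma lower_powers:
  assumes "0 < a" "a \<le> p * q / 2"
  shows "integrable (lebesgue_on S) (\<lambda>z. vnorm N (u z) powr a)"
    "integrable (lebesgue_on S) (\<lambda>z. vnorm N (Du z) powr a)"
    "integrable (lebesgue_on S) (\<lambda>z. vnorm N (F z) powr a)"
  using integrable_lower_power[OF S_lmeasurable vnorm_measurable[OF measurable_on_S(1)] vnorm_nonneg power_integrable_u assms]
    integrable_lower_power[OF S_lmeasurable vnorm_measurable[OF measurable_on_S(2)] vnorm_nonneg power_integrable_Du assms]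
    integrable_lower_power[OF S_lmeasurable vnorm_measurable[OF measurable_on_S(3)] vnorm_nonneg power_integrable_F assms] .

lemma vnorm_u_integrable: "integrable (lebesgue_on S) (\<lambda>z. vnorm N (u z))"
  and vnorm_Du_integrable: "integrable (lebesgue_on S) (\<lambda>z. vnorm N (Du z))"
  using lower_powers[of 1] exponent by (simp_all add: vnorm_nonneg)

lemma u_integrable: "i < N \<Longrightarrow> integrable (lebesgue_on S) (\<lambda>z. u z i)"
  using norm_le_vnorm[of i N "u _"] vnorm_nonneg[of N "u _"]
  by (intro Bochner_Integration.integrable_bound[OF vnorm_u_integrable component_measurable[OF measurable_on_S(1)]] AE_I2) simp

lemma Du_integrable: "i < N \<Longrightarrow> integrable (lebesgue_on S) (\<lambda>z. Du z i \<bullet> b)"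
proof (rule Bochner_Integration.integrable_bound)
  assume i: "i < N"
  show "integrable (lebesgue_on S) (\<lambda>z. norm b * vnorm N (Du z))" using vnorm_Du_integrable by simp
  show "(\<lambda>z. Du z i \<bullet> b) \<in> borel_measurable (lebesgue_on S)"
    using component_measurable[OF measurable_on_S(2)] by (intro borel_measurable_inner) auto
  have "\<bar>Du z i \<bullet> b\<bar> \<le> norm b * vnorm N (Du z)" for z
    using Cauchy_Schwarz_ineq2[of "Du z i" b] mult_right_mono[OF norm_le_vnorm[OF i, of "Du z"], of "norm b"]
    by (simp add: mult.commute)
  then show "AE z in lebesgue_on S. norm (Du z i \<bullet> b) \<le> norm (norm b * vnorm N (Du z))"
    by (intro AE_I2) (simp add: vnorm_nonneg)
qed

text \<open>
  On almost every time slice this is the definition of the weak gradient, multiplied by the number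
  \<open>\<theta> t\<close>; Fubini's theorem assembles the slices.
\<close>

lemma weak_gradient_component:
  assumes i: "i < N" and \<alpha>: "smooth \<alpha>" "\<alpha> \<in> test_functions (ball x0 (2 * r))"
    and \<theta>: "smooth \<theta>" "\<theta> \<in> test_functions (time_interval t0 (2 * r))"
  shows "(\<integral>z. u z i * (dir_deriv \<alpha> (axis j 1) (fst z) * \<theta> (snd z)) \<partial>lebesgue_on S)
    = - (\<integral>z. (Du z i \<bullet> axis j 1) * (\<alpha> (fst z) * \<theta> (snd z)) \<partial>lebesgue_on S)"
proof -
  let ?b = "axis j 1 :: real^'n" and ?B = "ball x0 (2 * r)" and ?J = "time_interval t0 (2 * r)"
  obtain C1 where C1: "\<And>y. \<bar>\<alpha> y\<bar> \<le> C1" "0 \<le> C1" using test_function_bounded[OF \<alpha>] by metis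
  obtain C2 where C2: "\<And>y. \<bar>dir_deriv \<alpha> ?b y\<bar> \<le> C2" "0 \<le> C2"
    using test_function_dir_deriv_bounded[OF \<alpha>] by metis
  obtain C3 where C3: "\<And>y. \<bar>\<theta> y\<bar> \<le> C3" "0 \<le> C3" using test_function_bounded[OF \<theta>] by metis
  let ?f = "\<lambda>z. u z i * (dir_deriv \<alpha> ?b (fst z) * \<theta> (snd z))"
  let ?g = "\<lambda>z. - ((Du z i \<bullet> ?b) * (\<alpha> (fst z) * \<theta> (snd z)))"
  have f: "integrable (lebesgue_on S) ?f"
  proof (rule integrable_mult_bounded[OF u_integrable[OF i]])
    show "(\<lambda>z. dir_deriv \<alpha> ?b (fst z) * \<theta> (snd z)) \<in> borel_measurable borel"
      by (intro measurable_tensor smooth_imp_measurable smooth_dir_deriv \<alpha> \<theta>)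
    show "\<bar>dir_deriv \<alpha> ?b (fst z) * \<theta> (snd z)\<bar> \<le> C2 * C3" for z
      unfolding abs_mult by (intro mult_mono C2 C3) auto
  qed
  have "integrable (lebesgue_on S) (\<lambda>z. (Du z i \<bullet> ?b) * (\<alpha> (fst z) * \<theta> (snd z)))"
  proof (rule integrable_mult_bounded[OF Du_integrable[OF i]])
    show "(\<lambda>z. \<alpha> (fst z) * \<theta> (snd z)) \<in> borel_measurable borel"
      by (intro measurable_tensor smooth_imp_measurable \<alpha> \<theta>)
    show "\<bar>\<alpha> (fst z) * \<theta> (snd z)\<bar> \<le> C1 * C3" for z
      unfolding abs_mult by (intro mult_mono C1 C3) auto
  qed
  then have g: "integrable (lebesgue_on S) ?g" by simp
  have slice: "(\<integral>x. indicator S (x, t) *\<^sub>R k (x, t) \<partial>lebesgue)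
      = indicator ?J t * (\<integral>x. k (x, t) \<partial>lebesgue_on ?B)" for k :: "_ \<Rightarrow> real" and t
  proof -
    have "(\<integral>x. indicator S (x, t) *\<^sub>R k (x, t) \<partial>lebesgue) = (\<integral>x. indicator ?J t * (indicator ?B x *\<^sub>R k (x, t)) \<partial>lebesgue)"
      by (intro Bochner_Integration.integral_cong) (auto simp: cylinder_def indicator_def)
    also have "\<dots> = indicator ?J t * (\<integral>x. k (x, t) \<partial>lebesgue_on ?B)"
      by (subst integral_restrict_space) auto
    finally show ?thesis .
  qed
  have "(\<integral>z. ?f z \<partial>lebesgue_on S) = (\<integral>z. indicator S z *\<^sub>R ?f z \<partial>lebesgue)"
    using S_sets by (intro integral_restrict_space) auto
  also have "\<dots> = (\<integral>z. indicator S z *\<^sub>R ?g z \<partial>lebesgue)"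
  proof (rule integral_lebesgue_eq_slices)
    have *: "S \<inter> space lebesgue \<in> sets lebesgue" using S_sets by simp
    show "integrable lebesgue (\<lambda>z. indicator S z *\<^sub>R ?f z)"
      by (rule iffD1[OF integrable_restrict_space[OF *] f])
    show "integrable lebesgue (\<lambda>z. indicator S z *\<^sub>R ?g z)"
      by (rule iffD1[OF integrable_restrict_space[OF *] g])
    have "AE t in lebesgue. t \<in> ?J \<longrightarrow> W1 (p * q / 2) ?B (\<lambda>x. u (x,t) i) (\<lambda>x. Du (x,t) i)"
      using slices_weakly_differentiable i by (subst (asm) AE_restrict_space_iff) (auto simp: time_interval_def)
    then show "AE t in lebesgue. (\<integral>x. indicator S (x, t) *\<^sub>R ?f (x, t) \<partial>lebesgue) = (\<integral>x. indicator S (x, t) *\<^sub>R ?g (x, t) \<partial>lebesgue)"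
    proof eventually_elim
      case (elim t)
      show ?case
      proof (cases "t \<in> ?J")
        case True
        have "(\<integral>x. u (x, t) i * dir_deriv \<alpha> ?b x \<partial>lebesgue_on ?B) = - (\<integral>x. (Du (x, t) i \<bullet> ?b) * \<alpha> x \<partial>lebesgue_on ?B)"
          using elim True \<alpha>(2) by (simp add: W1_def axis_in_Basis_iff)
        then have "(\<integral>x. (u (x, t) i * dir_deriv \<alpha> ?b x) * \<theta> t \<partial>lebesgue_on ?B) = - (\<integral>x. ((Du (x, t) i \<bullet> ?b) * \<alpha> x) * \<theta> t \<partial>lebesgue_on ?B)"
          by simp
        then show ?thesis unfolding slice[where k="?f"] slice[where k="?g"] by (simp add: mult.assoc)
      next
        case False
        then show ?thesis unfolding slice[where k="?f"] slice[where k="?g"] by simp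
      qed
    qed
  qed
  also have "\<dots> = (\<integral>z. ?g z \<partial>lebesgue_on S)"
    using S_sets by (intro integral_restrict_space[symmetric]) auto
  finally show ?thesis by simp
qed

definition component :: "(nat \<Rightarrow> real) \<Rightarrow> (real^'n) \<times> real \<Rightarrow> real" where
  "component e z = (\<Sum>i<N. e i * u z i)"

text \<open>
  A bound for the norm of the field \<open>A(z, \<nabla>u) - \<bar>F\<bar>^(p-2) F\<close> by the growth condition.
\<close>

definition flux_bound :: "(real^'n) \<times> real \<Rightarrow> real" where
  "flux_bound z = L * vnorm N (Du z) powr (p - 1) + vnorm N (F z) powr (p - 1)"

lemma component_integrable: "integrable (lebesgue_on S) (component e)"
  unfolding component_def[abs_def] using u_integrable by auto

lemma flux_bound_integrable: "integrable (lebesgue_on S) flux_bound"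
  unfolding flux_bound_def[abs_def] using lower_powers[of "p - 1"] exponent p by simp

lemma flux_bound_nonneg: "0 \<le> flux_bound z"
  using L by (simp add: flux_bound_def)

lemma component_weak_gradient:
  assumes e: "L2_set e {..<N} \<le> 1" and \<alpha>: "smooth \<alpha>" "\<alpha> \<in> test_functions (ball x0 (2 * r))"
    and \<theta>: "smooth \<theta>" "\<theta> \<in> test_functions (time_interval t0 (2 * r))"
  shows "\<bar>\<integral>z. component e z * (dir_deriv \<alpha> (axis j 1) (fst z) * \<theta> (snd z)) \<partial>lebesgue_on S\<bar>
    \<le> (\<integral>z. vnorm N (Du z) * \<bar>\<alpha> (fst z) * \<theta> (snd z)\<bar> \<partial>lebesgue_on S)"
proof -
  let ?b = "axis j 1 :: real^'n"
  let ?d = "\<lambda>z. dir_deriv \<alpha> ?b (fst z) * \<theta> (snd z)" and ?k = "\<lambda>z. \<alpha> (fst z) * \<theta> (snd z)"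
  obtain C1 where C1: "\<And>y. \<bar>\<alpha> y\<bar> \<le> C1" "0 \<le> C1" using test_function_bounded[OF \<alpha>] by metis
  obtain C2 where C2: "\<And>y. \<bar>dir_deriv \<alpha> ?b y\<bar> \<le> C2" "0 \<le> C2"
    using test_function_dir_deriv_bounded[OF \<alpha>] by metis
  obtain C3 where C3: "\<And>y. \<bar>\<theta> y\<bar> \<le> C3" "0 \<le> C3" using test_function_bounded[OF \<theta>] by metis
  have d: "?d \<in> borel_measurable borel" "\<bar>?d z\<bar> \<le> C2 * C3" for z
    unfolding abs_mult by (intro measurable_tensor smooth_imp_measurable smooth_dir_deriv \<alpha> \<theta> mult_mono C2 C3 abs_ge_zero)+
  have k: "?k \<in> borel_measurable borel" "\<bar>?k z\<bar> \<le> C1 * C3" for z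
    unfolding abs_mult by (intro measurable_tensor smooth_imp_measurable \<alpha> \<theta> mult_mono C1 C3 abs_ge_zero)+
  have "(\<integral>z. component e z * ?d z \<partial>lebesgue_on S) = (\<integral>z. (\<Sum>i<N. e i * (u z i * ?d z)) \<partial>lebesgue_on S)"
    by (simp add: component_def sum_distrib_right mult.assoc)
  also have "\<dots> = (\<Sum>i<N. e i * (\<integral>z. u z i * ?d z \<partial>lebesgue_on S))"
    by (subst Bochner_Integration.integral_sum) (auto intro!: integrable_mult_bounded[OF u_integrable d])
  also have "\<dots> = (\<Sum>i<N. e i * (\<integral>z. - ((Du z i \<bullet> ?b) * ?k z) \<partial>lebesgue_on S))"
    by (intro sum.cong refl) (simp add: weak_gradient_component[OF _ \<alpha> \<theta>])
  also have "\<dots> = (\<integral>z. (\<Sum>i<N. e i * - ((Du z i \<bullet> ?b) * ?k z)) \<partial>lebesgue_on S)"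
    by (subst Bochner_Integration.integral_sum) (auto intro!: integrable_mult_bounded[OF Du_integrable k])
  also have "\<bar>\<dots>\<bar> \<le> (\<integral>z. \<bar>\<Sum>i<N. e i * - ((Du z i \<bullet> ?b) * ?k z)\<bar> \<partial>lebesgue_on S)"
    by (rule integral_abs_bound)
  also have "\<dots> \<le> (\<integral>z. vnorm N (Du z) * \<bar>?k z\<bar> \<partial>lebesgue_on S)"
  proof (rule integral_mono)
    show "integrable (lebesgue_on S) (\<lambda>z. \<bar>\<Sum>i<N. e i * - ((Du z i \<bullet> ?b) * ?k z)\<bar>)"
      by (intro integrable_abs Bochner_Integration.integrable_sum integrable_mult_right integrable_minus
          integrable_mult_bounded[OF Du_integrable k]) auto
    show "integrable (lebesgue_on S) (\<lambda>z. vnorm N (Du z) * \<bar>?k z\<bar>)"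
      by (rule integrable_mult_bounded[OF vnorm_Du_integrable]) (use k in auto)
    fix z
    have "(\<Sum>i<N. e i * - ((Du z i \<bullet> ?b) * ?k z)) = - (((\<Sum>i<N. e i *\<^sub>R Du z i) \<bullet> ?b) * ?k z)"
      by (simp add: inner_sum_left sum_distrib_right sum_negf mult.assoc)
    moreover have "\<bar>(\<Sum>i<N. e i *\<^sub>R Du z i) \<bullet> ?b\<bar> \<le> vnorm N (Du z)"
      using Cauchy_Schwarz_ineq2[of "\<Sum>i<N. e i *\<^sub>R Du z i" ?b] norm_combination_le_vnorm[OF e, of "Du z"]
      by simp
    ultimately show "\<bar>\<Sum>i<N. e i * - ((Du z i \<bullet> ?b) * ?k z)\<bar> \<le> vnorm N (Du z) * \<bar>?k z\<bar>"
      by (simp add: abs_mult mult_right_mono del: sum_negf)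
  qed
  finally show ?thesis .
qed

text \<open>
  The equation is tested with \<open>e\<close> times a product of \<open>\<alpha>\<close> and \<open>\<theta>\<close>. Before its integral can be
  split, the term with the vector field has to be known to be integrable, which rests on the measurability
  of a Caratheodory field along a measurable map and on the growth condition.
\<close>

lemma component_weak_time_derivative:
  assumes e: "L2_set e {..<N} \<le> 1" and \<alpha>: "smooth \<alpha>" "\<alpha> \<in> test_functions (ball x0 (2 * r))"
    and \<theta>: "smooth \<theta>" "\<theta> \<in> test_functions (time_interval t0 (2 * r))"
  shows "\<bar>\<integral>z. component e z * (\<alpha> (fst z) * dir_deriv \<theta> 1 (snd z)) \<partial>lebesgue_on S\<bar>
    \<le> (\<integral>z. flux_bound z * \<bar>(\<Sum>j\<in>UNIV. \<bar>dir_deriv \<alpha> (axis j 1) (fst z)\<bar>) * \<theta> (snd z)\<bar> \<partial>lebesgue_on S)"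
proof -
  define \<phi> where "\<phi> i z = e i * (\<alpha> (fst z) * \<theta> (snd z))" for i :: nat and z :: "(real^'n) \<times> real"
  define \<gamma> where "\<gamma> z = (\<chi> j. dir_deriv \<alpha> (axis j 1) (fst z) * \<theta> (snd z))" for z :: "(real^'n) \<times> real"
  define \<kappa> where "\<kappa> z = (\<Sum>j\<in>UNIV. \<bar>dir_deriv \<alpha> (axis j 1) (fst z)\<bar>) * \<theta> (snd z)" for z :: "(real^'n) \<times> real"
  define \<tau> where "\<tau> z = \<alpha> (fst z) * dir_deriv \<theta> 1 (snd z)" for z :: "(real^'n) \<times> real"
  define a where "a z = component e z * \<tau> z" for z
  define b where "b z = (\<Sum>i<N. e i *\<^sub>R A z (Du z) i) \<bullet> \<gamma> z" for z
  define c where "c z = (\<Sum>i<N. e i *\<^sub>R (vnorm N (F z) powr (p - 2) *\<^sub>R F z i)) \<bullet> \<gamma> z" for z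
  obtain K1 where K1: "compact K1" "K1 \<subseteq> ball x0 (2 * r)" "\<And>y. y \<notin> K1 \<Longrightarrow> \<alpha> y = 0" using test_function_support[OF \<alpha>(2)] by metis
  obtain K2 where K2: "compact K2" "K2 \<subseteq> time_interval t0 (2 * r)" "\<And>y. y \<notin> K2 \<Longrightarrow> \<theta> y = 0" using test_function_support[OF \<theta>(2)] by metis
  have smooth_\<alpha>\<theta>: "smooth (\<lambda>z. \<alpha> (fst z) * \<theta> (snd z))"
    by (intro smooth_mult smooth_compose_fst smooth_compose_snd \<alpha> \<theta>)
  have test: "\<phi> i \<in> test_functions ST" for i
  proof (rule smooth_test_function[where K="K1 \<times> K2"])
    show "smooth (\<phi> i)" unfolding \<phi>_def[abs_def] by (intro smooth_mult smooth_const smooth_\<alpha>\<theta>)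
    show "compact (K1 \<times> K2)" using K1(1) K2(1) by (rule compact_Times)
    show "K1 \<times> K2 \<subseteq> ST" using K1(2) K2(2) S_subset by (auto simp: cylinder_def)
    show "\<phi> i z = 0" if "z \<notin> K1 \<times> K2" for z
      using that K1(3) K2(3) by (auto simp: \<phi>_def mem_Times_iff)
  qed
  have td: "time_deriv (\<phi> i) z = e i * \<tau> z" for i z
    unfolding time_deriv_def \<phi>_def[abs_def] \<tau>_def
    by (simp add: dir_deriv_cmult[OF smooth_\<alpha>\<theta>] dir_deriv_tensor[OF \<alpha>(1) \<theta>(1)] dir_deriv_zero[OF \<alpha>(1)])
  have sg: "space_grad (\<phi> i) z = e i *\<^sub>R \<gamma> z" for i z
    unfolding space_grad_def \<phi>_def[abs_def] \<gamma>_def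
    by (simp add: vec_eq_iff dir_deriv_cmult[OF smooth_\<alpha>\<theta>] dir_deriv_tensor[OF \<alpha>(1) \<theta>(1)] dir_deriv_zero[OF \<theta>(1)])
  have ia: "vinner N (u z) (\<lambda>i. time_deriv (\<phi> i) z) = a z" for z
    by (simp add: vinner_def td a_def component_def sum_distrib_left mult_ac)
  have ib: "vinner N (A z (Du z)) (\<lambda>i. space_grad (\<phi> i) z) = b z" for z
    by (simp add: vinner_def sg b_def inner_sum_left)
  have ic: "vinner N (\<lambda>i. vnorm N (F z) powr (p - 2) *\<^sub>R F z i) (\<lambda>i. space_grad (\<phi> i) z) = c z" for z
    by (simp add: vinner_def sg c_def inner_sum_left mult_ac)
  have eq: "(\<integral>z. - a z + b z \<partial>lebesgue_on ST) = (\<integral>z. c z \<partial>lebesgue_on ST)"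
    using weak[unfolded weak_solution_def, rule_format, of \<phi>] test by (simp add: ia ib ic)
  have outside: "\<tau> z = 0" "\<gamma> z = 0" if "z \<notin> S" for z
  proof -
    have "fst z \<notin> K1 \<or> snd z \<notin> K2" using that K1(2) K2(2) by (auto simp: cylinder_def mem_Times_iff)
    moreover have "dir_deriv \<alpha> d y = 0" if "y \<notin> K1" for d y
      by (rule dir_deriv_eq_0_outside[OF compact_imp_closed[OF K1(1)] K1(3) that])
    moreover have "dir_deriv \<theta> d y = 0" if "y \<notin> K2" for d y
      by (rule dir_deriv_eq_0_outside[OF compact_imp_closed[OF K2(1)] K2(3) that])
    ultimately show "\<tau> z = 0" "\<gamma> z = 0" using K1(3) K2(3) by (auto simp: \<tau>_def \<gamma>_def vec_eq_iff)
  qed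
  \<comment> \<open>all three integrands vanish outside the doubled cylinder, so integrability is needed only inside\<close>
  have eqS: "(\<integral>z. - a z + b z \<partial>lebesgue_on S) = (\<integral>z. c z \<partial>lebesgue_on S)"
    using eq integral_lebesgue_on_superset[OF S_sets ST_sets S_subset, of "\<lambda>z. - a z + b z"]
      integral_lebesgue_on_superset[OF S_sets ST_sets S_subset, of c]
    by (simp add: a_def b_def c_def outside)
  obtain C1 where C1: "\<And>y. \<bar>\<alpha> y\<bar> \<le> C1" "0 \<le> C1" using test_function_bounded[OF \<alpha>] by metis
  obtain C3 where C3: "\<And>y. \<bar>\<theta> y\<bar> \<le> C3" "0 \<le> C3" using test_function_bounded[OF \<theta>] by metis
  obtain C4 where C4: "\<And>y. \<bar>dir_deriv \<theta> 1 y\<bar> \<le> C4" "0 \<le> C4" using test_function_dir_deriv_bounded[OF \<theta>] by metis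
  have "\<exists>C. \<forall>y. \<bar>dir_deriv \<alpha> (axis j 1) y\<bar> \<le> C" for j
    using test_function_dir_deriv_bounded[OF \<alpha>, of "axis j 1"] by blast
  then have "\<exists>C. \<forall>j y. \<bar>dir_deriv \<alpha> (axis j 1) y\<bar> \<le> C j" by (intro choice allI)
  then obtain C2 where C2: "\<And>j y. \<bar>dir_deriv \<alpha> (axis j 1) y\<bar> \<le> C2 j" by blast
  have \<tau>: "\<tau> \<in> borel_measurable borel" "\<bar>\<tau> z\<bar> \<le> C1 * C4" for z
    unfolding \<tau>_def[abs_def] abs_mult by (intro measurable_tensor smooth_imp_measurable smooth_dir_deriv \<alpha> \<theta> mult_mono C1 C4 abs_ge_zero)+
  have \<kappa>_meas: "\<kappa> \<in> borel_measurable borel"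
    unfolding \<kappa>_def[abs_def]
    by (intro measurable_tensor borel_measurable_sum borel_measurable_abs smooth_imp_measurable smooth_dir_deriv \<alpha> \<theta>)
  have \<kappa>_bound: "\<bar>\<kappa> z\<bar> \<le> (\<Sum>j\<in>UNIV. C2 j) * C3" for z
  proof -
    have "\<bar>\<Sum>j\<in>UNIV. \<bar>dir_deriv \<alpha> (axis j 1) (fst z)\<bar>\<bar> \<le> (\<Sum>j\<in>UNIV. C2 j)"
      by (subst abs_of_nonneg) (auto intro!: sum_nonneg sum_mono C2)
    from this order_trans[OF abs_ge_zero this] show ?thesis unfolding \<kappa>_def abs_mult
      by (intro mult_mono C3 abs_ge_zero)
  qed
  have \<gamma>_le: "norm (\<gamma> z) \<le> \<bar>\<kappa> z\<bar>" for z
  proof -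
    have "norm (\<gamma> z) \<le> (\<Sum>j\<in>UNIV. \<bar>\<gamma> z $ j\<bar>)" by (rule norm_le_l1_cart)
    also have "\<dots> = \<bar>\<kappa> z\<bar>"
      unfolding \<kappa>_def abs_mult by (simp add: \<gamma>_def abs_mult sum_distrib_right[symmetric] sum_nonneg)
    finally show ?thesis .
  qed
  have \<gamma>_meas: "\<gamma> \<in> borel_measurable (lebesgue_on S)"
  proof (rule borel_measurable_lebesgue_on)
    have "continuous_on UNIV \<gamma>"
      unfolding \<gamma>_def[abs_def]
      by (intro continuous_on_vec_lambda smooth_continuous_on smooth_mult smooth_compose_fst smooth_compose_snd smooth_dir_deriv \<alpha> \<theta>)
    then show "\<gamma> \<in> borel_measurable borel" by (rule borel_measurable_continuous_onI)
  qed
  have A_meas: "(\<lambda>z. A z (Du z) i) \<in> borel_measurable (lebesgue_on S)" for i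
  proof -
    have "(\<lambda>z. A z (Du z)) \<in> borel_measurable (lebesgue_on ST)"
      by (rule measurable_caratheodory[OF ST_sets, where N=N])
         (use field u in \<open>auto simp: caratheodory_field_def LW_loc_def\<close>)
    then have "(\<lambda>z. A z (Du z)) \<in> borel_measurable (lebesgue_on S)"
      by (rule measurable_restrict_mono) (rule S_subset)
    then show ?thesis by (rule component_measurable)
  qed
  have b_le: "AE z in lebesgue_on S. \<bar>b z\<bar> \<le> L * vnorm N (Du z) powr (p - 1) * \<bar>\<kappa> z\<bar>"
  proof -
    have "AE z in lebesgue_on ST. \<forall>\<xi>\<in>vecs N. vnorm N (A z \<xi>) \<le> L * vnorm N \<xi> powr (p - 1)"
      using field unfolding caratheodory_field_def by (auto elim: eventually_mono)
    then have "AE z in lebesgue. z \<in> ST \<longrightarrow> (\<forall>\<xi>\<in>vecs N. vnorm N (A z \<xi>) \<le> L * vnorm N \<xi> powr (p - 1))"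
      using ST_sets by (subst (asm) AE_restrict_space_iff) auto
    then have "AE z in lebesgue. z \<in> S \<longrightarrow> \<bar>b z\<bar> \<le> L * vnorm N (Du z) powr (p - 1) * \<bar>\<kappa> z\<bar>"
    proof eventually_elim
      case (elim z)
      show ?case
      proof
        assume "z \<in> S"
        then have "z \<in> ST" using S_subset by auto
        then have "Du z \<in> vecs N" using u by (auto simp: LW_loc_def)
        then have A_le: "vnorm N (A z (Du z)) \<le> L * vnorm N (Du z) powr (p - 1)" using elim \<open>z \<in> ST\<close> by blast
        have "\<bar>b z\<bar> \<le> norm (\<Sum>i<N. e i *\<^sub>R A z (Du z) i) * norm (\<gamma> z)"
          unfolding b_def by (rule Cauchy_Schwarz_ineq2)
        also have "\<dots> \<le> (L * vnorm N (Du z) powr (p - 1)) * \<bar>\<kappa> z\<bar>"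
          using norm_combination_le_vnorm[OF e, of "A z (Du z)"] A_le \<gamma>_le L by (intro mult_mono) auto
        finally show "\<bar>b z\<bar> \<le> L * vnorm N (Du z) powr (p - 1) * \<bar>\<kappa> z\<bar>" .
      qed
    qed
    then show ?thesis using S_sets by (subst AE_restrict_space_iff) auto
  qed
  have c_le: "\<bar>c z\<bar> \<le> vnorm N (F z) powr (p - 1) * \<bar>\<kappa> z\<bar>" for z
  proof -
    have "c z = vnorm N (F z) powr (p - 2) * ((\<Sum>i<N. e i *\<^sub>R F z i) \<bullet> \<gamma> z)"
      unfolding c_def by (simp add: inner_sum_left sum_distrib_left mult_ac)
    then have "\<bar>c z\<bar> = vnorm N (F z) powr (p - 2) * \<bar>(\<Sum>i<N. e i *\<^sub>R F z i) \<bullet> \<gamma> z\<bar>"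
      by (simp add: abs_mult)
    also have "\<dots> \<le> vnorm N (F z) powr (p - 2) * (vnorm N (F z) * \<bar>\<kappa> z\<bar>)"
    proof (rule mult_left_mono)
      have "\<bar>(\<Sum>i<N. e i *\<^sub>R F z i) \<bullet> \<gamma> z\<bar> \<le> norm (\<Sum>i<N. e i *\<^sub>R F z i) * norm (\<gamma> z)"
        by (rule Cauchy_Schwarz_ineq2)
      also have "\<dots> \<le> vnorm N (F z) * \<bar>\<kappa> z\<bar>"
        using norm_combination_le_vnorm[OF e, of "F z"] \<gamma>_le vnorm_nonneg by (intro mult_mono) auto
      finally show "\<bar>(\<Sum>i<N. e i *\<^sub>R F z i) \<bullet> \<gamma> z\<bar> \<le> vnorm N (F z) * \<bar>\<kappa> z\<bar>" .
    qed simp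
    also have "vnorm N (F z) powr (p - 2) * (vnorm N (F z) * \<bar>\<kappa> z\<bar>) = vnorm N (F z) powr (p - 1) * \<bar>\<kappa> z\<bar>"
    proof (cases "vnorm N (F z) = 0")
      case False
      then have "0 < vnorm N (F z)" using vnorm_nonneg[of N "F z"] by simp
      then have "vnorm N (F z) powr (p - 2) * vnorm N (F z) = vnorm N (F z) powr (p - 1)"
        using powr_add[of "vnorm N (F z)" "p - 2" 1] by simp
      then show ?thesis by (simp add: mult.assoc[symmetric])
    qed simp
    finally show ?thesis .
  qed
  have a_int: "integrable (lebesgue_on S) a"
    unfolding a_def[abs_def] by (rule integrable_mult_bounded[OF component_integrable \<tau>])
  have \<kappa>_abs: "(\<lambda>z. \<bar>\<kappa> z\<bar>) \<in> borel_measurable borel" "\<bar>\<bar>\<kappa> z\<bar>\<bar> \<le> (\<Sum>j\<in>UNIV. C2 j) * C3" for z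
    using \<kappa>_meas \<kappa>_bound by simp_all
  have "0 < p - 1" using p by simp
  note powers = lower_powers[OF this exponent(2)]
  have Phi1: "integrable (lebesgue_on S) (\<lambda>z. L * vnorm N (Du z) powr (p - 1) * \<bar>\<kappa> z\<bar>)"
    by (rule integrable_mult_bounded[OF integrable_mult_right[OF powers(2)] \<kappa>_abs])
  have Phi2: "integrable (lebesgue_on S) (\<lambda>z. vnorm N (F z) powr (p - 1) * \<bar>\<kappa> z\<bar>)"
    by (rule integrable_mult_bounded[OF powers(3) \<kappa>_abs])
  have b_int: "integrable (lebesgue_on S) b"
  proof (rule Bochner_Integration.integrable_bound[OF Phi1])
    show "b \<in> borel_measurable (lebesgue_on S)"
      unfolding b_def[abs_def] using A_meas \<gamma>_meas
      by (intro borel_measurable_inner borel_measurable_sum borel_measurable_scaleR borel_measurable_const) auto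
    show "AE z in lebesgue_on S. norm (b z) \<le> norm (L * vnorm N (Du z) powr (p - 1) * \<bar>\<kappa> z\<bar>)"
      using b_le by eventually_elim (use L in \<open>simp add: abs_mult\<close>)
  qed
  have c_int: "integrable (lebesgue_on S) c"
  proof (rule Bochner_Integration.integrable_bound[OF Phi2])
    have "(\<lambda>z. vnorm N (F z) powr (p - 2)) \<in> borel_measurable (lebesgue_on S)" by measurable
    then show "c \<in> borel_measurable (lebesgue_on S)"
      unfolding c_def[abs_def] using component_measurable[OF measurable_on_S(3)] \<gamma>_meas
      by (intro borel_measurable_inner borel_measurable_sum borel_measurable_scaleR borel_measurable_const) auto
    show "AE z in lebesgue_on S. norm (c z) \<le> norm (vnorm N (F z) powr (p - 1) * \<bar>\<kappa> z\<bar>)"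
      using c_le by (intro AE_I2) (simp add: abs_mult)
  qed
  have "(\<integral>z. a z \<partial>lebesgue_on S) = (\<integral>z. b z - c z \<partial>lebesgue_on S)"
    using eqS a_int b_int c_int by simp
  also have "\<bar>\<dots>\<bar> \<le> (\<integral>z. \<bar>b z - c z\<bar> \<partial>lebesgue_on S)" by (rule integral_abs_bound)
  also have "\<dots> \<le> (\<integral>z. flux_bound z * \<bar>\<kappa> z\<bar> \<partial>lebesgue_on S)"
  proof (rule integral_mono_AE)
    show "integrable (lebesgue_on S) (\<lambda>z. \<bar>b z - c z\<bar>)" using b_int c_int by simp
    show "integrable (lebesgue_on S) (\<lambda>z. flux_bound z * \<bar>\<kappa> z\<bar>)"
      by (rule integrable_mult_bounded[OF flux_bound_integrable \<kappa>_abs])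
    show "AE z in lebesgue_on S. \<bar>b z - c z\<bar> \<le> flux_bound z * \<bar>\<kappa> z\<bar>"
      using b_le
    proof eventually_elim
      case (elim z)
      then show ?case using c_le[of z] abs_triangle_ineq4[of "b z" "c z"]
        by (simp add: flux_bound_def distrib_right)
    qed
  qed
  finally show ?thesis by (simp add: a_def \<tau>_def \<kappa>_def)
qed

lemma weak_cylinder_component:
  assumes "L2_set e {..<N} \<le> 1"
  shows "weak_cylinder x0 t0 r (component e) (\<lambda>z. vnorm N (Du z)) flux_bound"
  by unfold_locales
    (use assms r component_integrable vnorm_Du_integrable flux_bound_integrable flux_bound_nonneg vnorm_nonneg
      component_weak_gradient component_weak_time_derivative in auto)

end

section \<open>The pointwise estimate in time and its integration\<close>

text \<open>
  The three summands stem from the change of the box, from the equation and from the trivial bound; adding 1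
  makes positivity evident.
\<close>

definition C_osc :: "nat \<Rightarrow> real \<Rightarrow> real" where
  "C_osc n L = 4 * C_space n + 4 * real n * (L + 1) * C_time n + 2 * C_point n + 1"

lemma C_osc_pos: "0 < L \<Longrightarrow> 0 < C_osc n L"
  using C_space_nonneg[of n] C_time_nonneg[of n] C_point_nonneg[of n]
  by (simp add: C_osc_def add_nonneg_pos)

context solution
begin

lemma lebesgue_point_component:
  assumes "\<And>i. i < N \<Longrightarrow> lebesgue_point S (\<lambda>z. u z i) z"
  shows "lebesgue_point S (component e) z"
  unfolding lebesgue_point_def
proof (rule Lim_null_comparison)
  let ?B = "\<lambda>d. cbox z (z + d *\<^sub>R One)" and ?D = "DIM((real^'n) \<times> real)"
  let ?Q = "\<lambda>i d. (\<integral>\<zeta>. \<bar>u \<zeta> i - u z i\<bar> * indicator (?B d) \<zeta> \<partial>lebesgue_on S) / d ^ ?D"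
  interpret finite_measure "lebesgue_on S" by (rule finite_measure_lebesgue_on[OF S_lmeasurable])
  have "((\<lambda>d. \<Sum>i<N. \<bar>e i\<bar> * ?Q i d) \<longlongrightarrow> (\<Sum>i<N. \<bar>e i\<bar> * 0)) (at_right 0)"
    by (intro tendsto_sum tendsto_mult tendsto_const) (use assms in \<open>auto simp: lebesgue_point_def\<close>)
  then show "((\<lambda>d. \<Sum>i<N. \<bar>e i\<bar> * ?Q i d) \<longlongrightarrow> 0) (at_right 0)" by simp
  have int: "integrable (lebesgue_on S) (\<lambda>\<zeta>. \<bar>f \<zeta> - c\<bar> * indicator (?B d) \<zeta>)"
    if "integrable (lebesgue_on S) f" for f :: "(real^'n) \<times> real \<Rightarrow> real" and c d
    using that by (intro integrable_mult_bounded[where B=1] integrable_abs Bochner_Integration.integrable_diff) (auto simp: indicator_def)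
  have le: "(\<integral>\<zeta>. \<bar>component e \<zeta> - component e z\<bar> * indicator (?B d) \<zeta> \<partial>lebesgue_on S)
      \<le> (\<Sum>i<N. \<bar>e i\<bar> * (\<integral>\<zeta>. \<bar>u \<zeta> i - u z i\<bar> * indicator (?B d) \<zeta> \<partial>lebesgue_on S))" for d
  proof -
    have "(\<integral>\<zeta>. \<bar>component e \<zeta> - component e z\<bar> * indicator (?B d) \<zeta> \<partial>lebesgue_on S)
      \<le> (\<integral>\<zeta>. (\<Sum>i<N. \<bar>e i\<bar> * (\<bar>u \<zeta> i - u z i\<bar> * indicator (?B d) \<zeta>)) \<partial>lebesgue_on S)"
    proof (rule integral_mono)
      show "integrable (lebesgue_on S) (\<lambda>\<zeta>. \<bar>component e \<zeta> - component e z\<bar> * indicator (?B d) \<zeta>)"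
        by (rule int[OF component_integrable])
      show "integrable (lebesgue_on S) (\<lambda>\<zeta>. \<Sum>i<N. \<bar>e i\<bar> * (\<bar>u \<zeta> i - u z i\<bar> * indicator (?B d) \<zeta>))"
        by (intro Bochner_Integration.integrable_sum integrable_mult_right int u_integrable) auto
      fix \<zeta>
      have "component e \<zeta> - component e z = (\<Sum>i<N. e i * (u \<zeta> i - u z i))"
        by (simp add: component_def right_diff_distrib sum_subtractf)
      then have "\<bar>component e \<zeta> - component e z\<bar> \<le> (\<Sum>i<N. \<bar>e i\<bar> * \<bar>u \<zeta> i - u z i\<bar>)"
        using sum_abs[of "\<lambda>i. e i * (u \<zeta> i - u z i)" "{..<N}"] by (simp add: abs_mult)
      then have "\<bar>component e \<zeta> - component e z\<bar> * indicator (?B d) \<zeta> \<le> (\<Sum>i<N. \<bar>e i\<bar> * \<bar>u \<zeta> i - u z i\<bar>) * indicator (?B d) \<zeta>"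
        by (rule mult_right_mono) simp
      then show "\<bar>component e \<zeta> - component e z\<bar> * indicator (?B d) \<zeta> \<le> (\<Sum>i<N. \<bar>e i\<bar> * (\<bar>u \<zeta> i - u z i\<bar> * indicator (?B d) \<zeta>))"
        by (simp add: sum_distrib_right mult.assoc)
    qed
    also have "\<dots> = (\<Sum>i<N. \<integral>\<zeta>. \<bar>e i\<bar> * (\<bar>u \<zeta> i - u z i\<bar> * indicator (?B d) \<zeta>) \<partial>lebesgue_on S)"
      by (rule Bochner_Integration.integral_sum) (intro integrable_mult_right int u_integrable, auto)
    finally show ?thesis by simp
  qed
  show "\<forall>\<^sub>F d in at_right 0. norm ((\<integral>\<zeta>. \<bar>component e \<zeta> - component e z\<bar> * indicator (?B d) \<zeta> \<partial>lebesgue_on S) / d ^ ?D)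
      \<le> (\<Sum>i<N. \<bar>e i\<bar> * ?Q i d)"
    using eventually_at_right_less[of "0::real"]
  proof eventually_elim
    case (elim d)
    have "0 \<le> (\<integral>\<zeta>. \<bar>component e \<zeta> - component e z\<bar> * indicator (?B d) \<zeta> \<partial>lebesgue_on S)"
      by (simp add: integral_nonneg)
    then have "norm ((\<integral>\<zeta>. \<bar>component e \<zeta> - component e z\<bar> * indicator (?B d) \<zeta> \<partial>lebesgue_on S) / d ^ ?D)
        = (\<integral>\<zeta>. \<bar>component e \<zeta> - component e z\<bar> * indicator (?B d) \<zeta> \<partial>lebesgue_on S) / d ^ ?D"
      using elim by (simp only: real_norm_def abs_of_nonneg divide_nonneg_pos zero_less_power)
    also have "\<dots> \<le> (\<Sum>i<N. \<bar>e i\<bar> * (\<integral>\<zeta>. \<bar>u \<zeta> i - u z i\<bar> * indicator (?B d) \<zeta> \<partial>lebesgue_on S)) / d ^ ?D"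
      using elim by (intro divide_right_mono le zero_le_power) simp
    also have "\<dots> = (\<Sum>i<N. \<bar>e i\<bar> * ?Q i d)" by (simp only: sum_divide_distrib times_divide_eq_right)
    finally show ?case .
  qed
qed

text \<open>
  The averages of the gradient are of order \<open>m\<close> and those of the flux of order \<open>m powr (p - 1)\<close>; for
  \<open>p > 2\<close> those of the solution are of order \<open>r * m\<close>.
\<close>

definition controlled :: "real \<Rightarrow> (real^'n) \<times> real \<Rightarrow> bool" where
  "controlled m z \<longleftrightarrow> avg_le S (\<lambda>z. vnorm N (Du z)) (2 * m) z \<and>
     avg_le S flux_bound (2 * (L + 1) * m powr (p - 1)) z \<and>
     (2 < p \<longrightarrow> (\<forall>e. L2_set e {..<N} \<le> 1 \<longrightarrow> avg_le S (\<lambda>z. \<bar>component e z\<bar>) (2 * r * m) z))"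

text \<open>
  The balance between the two error terms, and the case distinction on whether the optimal box fits into
  the ball.
\<close>

lemma time_oscillation:
  assumes x: "x \<in> ball x0 r" and t: "t1 \<in> time_interval t0 r" "t2 \<in> time_interval t0 r" "t1 < t2"
    and lp: "\<And>i. i < N \<Longrightarrow> lebesgue_point S (\<lambda>z. u z i) (x, t1)" "\<And>i. i < N \<Longrightarrow> lebesgue_point S (\<lambda>z. u z i) (x, t2)"
    and m: "1 \<le> m" and ctrl: "controlled m (x, t1)" "controlled m (x, t2)"
  shows "vnorm N (\<lambda>i. u (x, t1) i - u (x, t2) i) \<le> C_osc CARD('n) L * (sqrt (t2 - t1) * m powr (p / 2))"
proof (rule vnorm_leI)
  fix e assume e: "L2_set e {..<N} \<le> 1"
  interpret W: weak_cylinder x0 t0 r "component e" "\<lambda>z. vnorm N (Du z)" flux_bound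
    by (rule weak_cylinder_component[OF e])
  let ?n = "real CARD('n)" and ?v = "component e"
  let ?Cs = "C_space CARD('n)" and ?Ct = "C_time CARD('n)" and ?Cp = "C_point CARD('n)"
  define \<delta> where "\<delta> = sqrt (t2 - t1)"
  define X where "X = \<delta> * m powr (p / 2)"
  have \<delta>: "0 < \<delta>" "\<delta> * \<delta> = t2 - t1" using t(3) by (simp_all add: \<delta>_def)
  have X: "0 < X" using \<delta> m by (simp add: X_def)
  \<comment> \<open>the factor \<open>1 / (2 * ?n)\<close> makes the box fit into the ball when \<open>m = 1\<close>, since \<open>\<delta> < 2 * r\<close>\<close>
  define \<rho> where "\<rho> = \<delta> * m powr ((p - 2) / 2) / (2 * ?n)"
  have n: "0 < ?n" by simp
  have \<rho>: "0 < \<rho>" using \<delta> m by (simp add: \<rho>_def)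
  have \<rho>m: "2 * ?n * (\<rho> * m) = X"
  proof -
    have "m powr ((p - 2) / 2) * m = m powr (p / 2)"
      using m powr_add[of m "(p - 2) / 2" 1] by (simp add: diff_divide_distrib)
    then show ?thesis by (simp add: \<rho>_def X_def mult.assoc)
  qed
  have \<rho>_div: "(t2 - t1) * m powr (p - 1) / \<rho> = 2 * ?n * X"
  proof -
    have "m powr ((p - 2) / 2) * m powr (p / 2) = m powr (p - 1)"
      by (simp add: powr_add[symmetric] add_divide_distrib[symmetric] diff_divide_distrib)
    then have "2 * ?n * X * \<rho> = (t2 - t1) * m powr (p - 1)"
      using \<delta>(2) by (simp add: \<rho>_def X_def mult_ac)
    then show ?thesis using \<rho> by (simp add: field_simps)
  qed
  have diff: "(\<Sum>i<N. e i * (u (x, t1) i - u (x, t2) i)) = ?v (x, t1) - ?v (x, t2)"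
    by (simp add: component_def right_diff_distrib sum_subtractf)
  have lpv: "lebesgue_point S ?v (x, t1)" "lebesgue_point S ?v (x, t2)"
    using lebesgue_point_component lp by blast+
  have "\<bar>?v (x, t1) - ?v (x, t2)\<bar> \<le> C_osc CARD('n) L * X"
  proof (cases "?n * \<rho> < r")
    case True
    have "\<bar>?v (x, t1) - ?v (x, t2)\<bar>
      \<le> 2 * (2 * ?n * ?Cs * \<rho> * (2 * m)) + ?Ct / \<rho> * (t2 - t1) * (2 * (L + 1) * m powr (p - 1))"
      by (rule W.pointwise_time_oscillation[OF x t lpv _ _ _ _ \<rho> True])
         (use m ctrl in \<open>auto simp: controlled_def\<close>)
    also have "2 * (2 * ?n * ?Cs * \<rho> * (2 * m)) = 4 * ?Cs * (2 * ?n * (\<rho> * m))" by simp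
    also have "?Ct / \<rho> * (t2 - t1) * (2 * (L + 1) * m powr (p - 1))
        = 2 * (L + 1) * ?Ct * ((t2 - t1) * m powr (p - 1) / \<rho>)" by simp
    also have "4 * ?Cs * (2 * ?n * (\<rho> * m)) + 2 * (L + 1) * ?Ct * ((t2 - t1) * m powr (p - 1) / \<rho>)
        = (4 * ?Cs + 4 * ?n * (L + 1) * ?Ct) * X"
      unfolding \<rho>m \<rho>_div by (simp add: algebra_simps)
    also have "\<dots> \<le> C_osc CARD('n) L * X"
      using X C_point_nonneg[of "CARD('n)"] by (intro mult_right_mono) (auto simp: C_osc_def)
    finally show ?thesis .
  next
    case False
    \<comment> \<open>for \<open>p < 2\<close> the exponent of \<open>m\<close> in \<open>\<rho>\<close> is negative, so the box always fits\<close>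
    have "2 < p"
    proof (rule ccontr)
      assume "\<not> 2 < p"
      then have "m powr ((p - 2) / 2) \<le> m powr 0" using m by (intro powr_mono) auto
      then have "?n * \<rho> \<le> \<delta> / 2" using \<delta>(1) m by (simp add: \<rho>_def mult_left_le)
      moreover have "\<delta> < 2 * r"
      proof -
        have "t2 - t1 < 2 * r\<^sup>2" using t by (simp add: time_interval_def)
        also have "\<dots> \<le> (2 * r)\<^sup>2" by (simp add: power_mult_distrib)
        finally have "\<delta> < sqrt ((2 * r)\<^sup>2)" unfolding \<delta>_def by (rule real_sqrt_less_mono)
        also have "sqrt ((2 * r)\<^sup>2) = 2 * r" using r by (intro real_sqrt_unique) auto
        finally show ?thesis .
      qed
      ultimately show False using False by simp
    qed
    then have avg: "avg_le S (\<lambda>z. \<bar>?v z\<bar>) (2 * r * m) (x, t1)" "avg_le S (\<lambda>z. \<bar>?v z\<bar>) (2 * r * m) (x, t2)"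
      using ctrl e by (auto simp: controlled_def)
    have "\<bar>?v (x, t1) - ?v (x, t2)\<bar> \<le> \<bar>?v (x, t1)\<bar> + \<bar>?v (x, t2)\<bar>" by simp
    also have "\<dots> \<le> 4 * ?Cp * (r * m)"
      using W.pointwise_bound[OF x t(1) lpv(1) avg(1)] W.pointwise_bound[OF x t(2) lpv(2) avg(2)] by simp
    also have "\<dots> \<le> 4 * ?Cp * ((?n * \<rho>) * m)"
      using False m C_point_nonneg[of "CARD('n)"] by (intro mult_left_mono mult_right_mono) auto
    also have "\<dots> = 2 * ?Cp * (2 * ?n * (\<rho> * m))" by simp
    also have "\<dots> \<le> C_osc CARD('n) L * X"
      unfolding \<rho>m using X L C_space_nonneg[of "CARD('n)"] C_time_nonneg[of "CARD('n)"]
      by (intro mult_right_mono) (auto simp: C_osc_def)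
    finally show ?thesis .
  qed
  then show "(\<Sum>i<N. e i * (u (x, t1) i - u (x, t2) i)) \<le> C_osc CARD('n) L * (sqrt (t2 - t1) * m powr (p / 2))"
    unfolding diff X_def \<delta>_def by linarith
qed

text \<open>
  The function whose maximal function is taken in the majorant \<open>g\<close>.
\<close>

definition weight :: "(real^'n) \<times> real \<Rightarrow> real" where
  "weight z = (if p < 2 then vnorm N (Du z) + vnorm N (F z)
     else (vnorm N (u z) / r + vnorm N (Du z) + vnorm N (F z)) powr (p - 1))"

definition weight_exponent :: real where
  "weight_exponent = (if p < 2 then p / 2 else p / (2 * (p - 1)))"

text \<open>
  The quantity of the order of the gradient that corresponds to a bound \<open>Y\<close> for the maximal function of
  the weight: its power \<open>p / 2\<close> is the power of \<open>Y\<close> that occurs in the majorant.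
\<close>

definition height :: "real \<Rightarrow> real" where
  "height Y = (if p < 2 then Y else Y powr (1 / (p - 1)))"

lemma majorant_eq:
  "majorant N p u Du F x0 t0 r z = epowr (strong_maximal (\<lambda>\<zeta>. weight \<zeta> * indicator S \<zeta>) z + 1) weight_exponent"
  by (simp add: majorant_def Let_def weight_def weight_exponent_def)

lemma height:
  assumes "1 \<le> Y" shows "1 \<le> height Y" "height Y powr (p / 2) = Y powr weight_exponent"
proof -
  show "1 \<le> height Y" using assms p by (simp add: height_def ge_one_powr_ge_zero)
  have "1 / (p - 1) * (p / 2) = p / (2 * (p - 1))" by simp
  then show "height Y powr (p / 2) = Y powr weight_exponent"
    unfolding height_def weight_exponent_def by (simp only: powr_powr if_distrib[of "\<lambda>y. y powr (p / 2)"] if_distrib[of "\<lambda>y. Y powr y"])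
qed

text \<open>
  For \<open>p < 2\<close> the weight dominates the gradient, and the flux, of lower order \<open>p - 1 < 1\<close>, is
  bounded by an affine function of the weight. For \<open>p > 2\<close> the weight dominates the flux, and it is the
  gradient and the solution that are of lower order.
\<close>

lemma controlled_of_maximal:
  assumes Y: "1 \<le> Y" and X: "strong_maximal (\<lambda>\<zeta>. weight \<zeta> * indicator S \<zeta>) z \<le> ennreal Y"
  shows "controlled (height Y) z"
proof -
  have nonneg: "0 \<le> vnorm N (u \<zeta>)" "0 \<le> vnorm N (Du \<zeta>)" "0 \<le> vnorm N (F \<zeta>)" for \<zeta> by (rule vnorm_nonneg)+
  have W_meas: "weight \<in> borel_measurable (lebesgue_on S)" unfolding weight_def[abs_def] by measurable
  have W_nonneg: "0 \<le> weight \<zeta>" for \<zeta> using nonneg by (simp add: weight_def)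
  note avg = avg_le_of_maximal[OF S_sets _ _ W_meas W_nonneg _ _ _ _ X]
  show ?thesis
  proof (cases "p < 2")
    case True
    have hY: "height Y = Y" using True by (simp add: height_def)
    have W: "weight \<zeta> = vnorm N (Du \<zeta>) + vnorm N (F \<zeta>)" for \<zeta> using True by (simp add: weight_def)
    have "avg_le S (\<lambda>z. vnorm N (Du z)) (0 + 1 * Y) z"
      by (rule avg[OF vnorm_Du_integrable vnorm_nonneg]) (use Y nonneg in \<open>auto simp: W\<close>)
    then have 1: "avg_le S (\<lambda>z. vnorm N (Du z)) (2 * Y) z" by (rule avg_le_mono) (use Y in simp)
    have "avg_le S flux_bound ((L + 1) * Y powr (p - 1) + (L + 1) * Y powr (p - 1) / Y * Y) z"
    proof (rule avg[OF flux_bound_integrable flux_bound_nonneg])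
      fix \<zeta>
      have "flux_bound \<zeta> \<le> L * weight \<zeta> powr (p - 1) + weight \<zeta> powr (p - 1)"
        unfolding flux_bound_def W using L p nonneg by (intro add_mono mult_left_mono powr_mono2) auto
      also have "\<dots> = (L + 1) * weight \<zeta> powr (p - 1)" by (simp add: distrib_right)
      also have "weight \<zeta> powr (p - 1) = Y powr (p - 1) * (weight \<zeta> / Y) powr (p - 1)"
        using Y W_nonneg[of \<zeta>] by (simp add: powr_divide)
      also have "(L + 1) * \<dots> \<le> (L + 1) * (Y powr (p - 1) * (1 + weight \<zeta> / Y))"
      proof (intro mult_left_mono)
        show "(weight \<zeta> / Y) powr (p - 1) \<le> 1 + weight \<zeta> / Y"
          using powr_le_one_plus[of "weight \<zeta> / Y" "p - 1" 1] Y W_nonneg[of \<zeta>] p True by simp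
      qed (use L in auto)
      finally have "flux_bound \<zeta> \<le> (L + 1) * (Y powr (p - 1) * (1 + weight \<zeta> / Y))" .
      then show "flux_bound \<zeta> \<le> (L + 1) * Y powr (p - 1) + (L + 1) * Y powr (p - 1) / Y * weight \<zeta>"
        by (simp add: distrib_left mult.assoc)
    qed (use L Y in auto)
    then have 2: "avg_le S flux_bound (2 * (L + 1) * Y powr (p - 1)) z"
      by (rule avg_le_mono) (use Y in simp)
    show ?thesis using 1 2 True by (simp add: controlled_def hY)
  next
    case False
    then have p2: "2 < p" using p by simp
    define m where "m = Y powr (1 / (p - 1))"
    define V where "V \<zeta> = vnorm N (u \<zeta>) / r + vnorm N (Du \<zeta>) + vnorm N (F \<zeta>)" for \<zeta>
    have hY: "height Y = m" using False by (simp add: height_def m_def)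
    have W: "weight \<zeta> = V \<zeta> powr (p - 1)" for \<zeta> using False by (simp add: weight_def V_def)
    have m: "1 \<le> m" using Y p by (simp add: m_def ge_one_powr_ge_zero)
    have mp: "m powr (p - 1) = Y" using Y p by (simp add: m_def powr_powr)
    have V_nonneg: "0 \<le> V \<zeta>" for \<zeta> using nonneg r by (simp add: V_def)
    have V_le: "V \<zeta> \<le> m + m / Y * weight \<zeta>" for \<zeta>
    proof -
      have "V \<zeta> / m \<le> 1 + (V \<zeta> / m) powr (p - 1)"
        using V_nonneg m p2 by (intro le_one_plus_powr) auto
      also have "(V \<zeta> / m) powr (p - 1) = weight \<zeta> / Y" using V_nonneg m by (simp add: powr_divide mp W)
      finally have "V \<zeta> \<le> (1 + weight \<zeta> / Y) * m" using m by (simp add: pos_divide_le_eq)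
      then show ?thesis by (simp add: algebra_simps)
    qed
    have "avg_le S (\<lambda>z. vnorm N (Du z)) (m + m / Y * Y) z"
    proof (rule avg[OF vnorm_Du_integrable vnorm_nonneg])
      show "vnorm N (Du \<zeta>) \<le> m + m / Y * weight \<zeta>" for \<zeta>
        using V_le[of \<zeta>] nonneg[of \<zeta>] r divide_nonneg_pos[OF nonneg(1) r, of \<zeta>] unfolding V_def by linarith
    qed (use m Y in auto)
    then have 1: "avg_le S (\<lambda>z. vnorm N (Du z)) (2 * m) z" by (rule avg_le_mono) (use Y in simp)
    have "avg_le S flux_bound (0 + (L + 1) * Y) z"
    proof (rule avg[OF flux_bound_integrable flux_bound_nonneg])
      fix \<zeta>
      have "flux_bound \<zeta> \<le> L * V \<zeta> powr (p - 1) + V \<zeta> powr (p - 1)"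
        unfolding flux_bound_def V_def using L p r nonneg by (intro add_mono mult_left_mono powr_mono2) auto
      then show "flux_bound \<zeta> \<le> 0 + (L + 1) * weight \<zeta>" by (simp add: W distrib_right)
    qed (use L Y in auto)
    then have 2: "avg_le S flux_bound (2 * (L + 1) * m powr (p - 1)) z"
      by (rule avg_le_mono) (use Y L mp in auto)
    have 3: "avg_le S (\<lambda>z. \<bar>component e z\<bar>) (2 * r * m) z" if e: "L2_set e {..<N} \<le> 1" for e
    proof -
      have "avg_le S (\<lambda>z. \<bar>component e z\<bar>) (r * m + r * m / Y * Y) z"
      proof (rule avg)
        show "integrable (lebesgue_on S) (\<lambda>z. \<bar>component e z\<bar>)" using component_integrable by (rule integrable_abs)
        show "\<bar>component e \<zeta>\<bar> \<le> r * m + r * m / Y * weight \<zeta>" for \<zeta>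
        proof -
          have "\<bar>component e \<zeta>\<bar> \<le> vnorm N (u \<zeta>)"
            using norm_combination_le_vnorm[OF e, of "u \<zeta>"] by (simp add: component_def)
          also have "\<dots> = r * (vnorm N (u \<zeta>) / r)" using r by simp
          also have "\<dots> \<le> r * (m + m / Y * weight \<zeta>)"
            using V_le[of \<zeta>] nonneg[of \<zeta>] r unfolding V_def by (intro mult_left_mono) linarith+
          finally show ?thesis by (simp add: distrib_left)
        qed
      qed (use r m Y in auto)
      then show ?thesis by (rule avg_le_mono) (use Y in simp)
    qed
    show ?thesis using 1 2 3 by (simp add: controlled_def hY)
  qed
qed

text \<open>
  Both points are controlled by the larger of the two values of the maximal function, and the power of a
  maximum is at most the sum of the powers.
\<close>

lemma pointwise_oscillation:
  fixes x :: "real^'n"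
  defines "g \<equiv> \<lambda>t. majorant N p u Du F x0 t0 r (x, t)"
  assumes x: "x \<in> ball x0 r" and t: "s \<in> time_interval t0 r" "t \<in> time_interval t0 r" "s < t"
    and lp: "\<And>i. i < N \<Longrightarrow> lebesgue_point S (\<lambda>z. u z i) (x, s)" "\<And>i. i < N \<Longrightarrow> lebesgue_point S (\<lambda>z. u z i) (x, t)"
  shows "ennreal (vnorm N (\<lambda>i. u (x, s) i - u (x, t) i)) \<le> ennreal (C_osc CARD('n) L * sqrt (2 * r\<^sup>2)) * (g s + g t)"
proof -
  let ?M = "strong_maximal (\<lambda>\<zeta>. weight \<zeta> * indicator S \<zeta>)"
  let ?K = "C_osc CARD('n) L * sqrt (2 * r\<^sup>2)"
  have K: "0 < ?K" using C_osc_pos[OF L] r by simp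
  have g: "g \<tau> = epowr (?M (x, \<tau>) + 1) weight_exponent" for \<tau> by (simp add: g_def majorant_eq)
  show ?thesis
  proof (cases "?M (x, s) = \<infinity> \<or> ?M (x, t) = \<infinity>")
    case True
    then have "g s + g t = \<infinity>" by (auto simp: g epowr_def)
    then have "ennreal ?K * (g s + g t) = \<infinity>"
      using C_osc_pos[OF L, of "CARD('n)"] r by (simp add: ennreal_mult_eq_top_iff)
    then show ?thesis by (simp only: infinity_ennreal_def top_greatest)
  next
    case False
    define X where "X \<tau> = enn2real (?M (x, \<tau>) + 1)" for \<tau>
    have MX: "?M (x, \<tau>) + 1 = ennreal (X \<tau>)" if "\<tau> \<in> {s, t}" for \<tau>
      using False that by (auto simp: X_def less_top)
    have X1: "1 \<le> X \<tau>" if "\<tau> \<in> {s, t}" for \<tau>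
    proof -
      have "ennreal 1 \<le> ennreal (X \<tau>)" unfolding MX[OF that, symmetric] by simp
      then show ?thesis by (subst (asm) ennreal_le_iff) (auto simp: X_def)
    qed
    \<comment> \<open>one bound for both points, since the scale \<open>\<rho>\<close> has to be the same for both\<close>
    define Y where "Y = max (X s) (X t)"
    have Y: "1 \<le> Y" using X1[of s] by (simp add: Y_def)
    have MY: "?M (x, \<tau>) \<le> ennreal Y" if "\<tau> \<in> {s, t}" for \<tau>
    proof -
      have "?M (x, \<tau>) \<le> ?M (x, \<tau>) + 1" by simp
      also have "\<dots> \<le> ennreal Y" unfolding MX[OF that] using that by (intro ennreal_leI) (auto simp: Y_def)
      finally show ?thesis .
    qed
    have "vnorm N (\<lambda>i. u (x, s) i - u (x, t) i) \<le> C_osc CARD('n) L * (sqrt (t - s) * height Y powr (p / 2))"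
      by (rule time_oscillation[OF x t lp height(1)[OF Y]]) (use controlled_of_maximal[OF Y] MY in auto)
    also have "\<dots> \<le> C_osc CARD('n) L * (sqrt (2 * r\<^sup>2) * (X s powr weight_exponent + X t powr weight_exponent))"
    proof (intro mult_left_mono mult_mono)
      show "sqrt (t - s) \<le> sqrt (2 * r\<^sup>2)" using t by (simp add: time_interval_def)
      show "height Y powr (p / 2) \<le> X s powr weight_exponent + X t powr weight_exponent"
        unfolding height(2)[OF Y] by (simp add: Y_def max_def)
    qed (use C_osc_pos[OF L, of "CARD('n)"] in auto)
    finally have "ennreal (vnorm N (\<lambda>i. u (x, s) i - u (x, t) i)) \<le> ennreal (?K * (X s powr weight_exponent + X t powr weight_exponent))"
      by (intro ennreal_leI) (simp add: mult.assoc)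
    also have "\<dots> = ennreal ?K * (ennreal (X s powr weight_exponent) + ennreal (X t powr weight_exponent))"
      using K by (simp add: ennreal_mult ennreal_plus)
    also have "ennreal (X \<tau> powr weight_exponent) = g \<tau>" if "\<tau> \<in> {s, t}" for \<tau>
      using that X1[OF that] by (simp add: g MX[OF that] epowr_def)
    then have "ennreal (X s powr weight_exponent) + ennreal (X t powr weight_exponent) = g s + g t" by simp
    finally show ?thesis .
  qed
qed

lemma inner_cylinder_subset:
  assumes "x \<in> ball x0 r" "t \<in> time_interval t0 r"
  shows "(x, t) \<in> S"
proof -
  have "r\<^sup>2 \<le> (2 * r)\<^sup>2" by (simp add: power_mult_distrib)
  then show ?thesis using assms r by (auto simp: cylinder_def time_interval_def)
qed

lemma AE_slices_integrable:
  "AE x in lebesgue. x \<in> ball x0 r \<longrightarrow> (\<forall>i<N. integrable (lebesgue_on (time_interval t0 r)) (\<lambda>t. u (x, t) i))"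
proof -
  have "AE x in lebesgue. \<forall>i\<in>{..<N}. integrable lebesgue (\<lambda>t. indicator S (x, t) *\<^sub>R u (x, t) i)"
  proof (rule AE_finite_allI)
    fix i assume "i \<in> {..<N}"
    then have u_i: "integrable (lebesgue_on S) (\<lambda>z. u z i)" using u_integrable by simp
    have "S \<inter> space lebesgue \<in> sets lebesgue" using S_sets by simp
    from iffD1[OF integrable_restrict_space[OF this] u_i]
    have "integrable lebesgue (\<lambda>z. indicator S z *\<^sub>R u z i)" .
    from AE_integrable_slice[OF this] show "AE x in lebesgue. integrable lebesgue (\<lambda>t. indicator S (x, t) *\<^sub>R u (x, t) i)" .
  qed simp
  then show ?thesis
  proof eventually_elim
    case (elim x)
    show ?case
    proof (intro impI allI)
      fix i assume x: "x \<in> ball x0 r" and i: "i < N"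
      let ?I = "time_interval t0 r"
      have I: "?I \<in> sets lebesgue" by (simp add: time_interval_def)
      have sub: "(x, t) \<in> S" if "t \<in> ?I" for t using inner_cylinder_subset[OF x that] .
      have "integrable lebesgue (\<lambda>t. indicator ?I t *\<^sub>R (indicator S (x, t) *\<^sub>R u (x, t) i))"
        using elim i I by (intro integrable_mult_indicator) auto
      also have "(\<lambda>t. indicator ?I t *\<^sub>R (indicator S (x, t) *\<^sub>R u (x, t) i)) = (\<lambda>t. indicator ?I t *\<^sub>R u (x, t) i)"
        using sub by (auto simp: indicator_def fun_eq_iff)
      finally show "integrable (lebesgue_on ?I) (\<lambda>t. u (x, t) i)"
        using I by (subst integrable_restrict_space) auto
    qed
  qed
qed

lemma AE_slices_lebesgue_point:
  "AE x in lebesgue. x \<in> ball x0 r \<longrightarrow>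
     (AE t in lebesgue_on (time_interval t0 r). \<forall>i<N. lebesgue_point S (\<lambda>z. u z i) (x, t))"
proof -
  have "AE z in lebesgue. \<forall>i\<in>{..<N}. z \<in> S \<longrightarrow> lebesgue_point S (\<lambda>z. u z i) z"
    by (rule AE_finite_allI) (auto intro!: AE_lebesgue_point[OF S_sets] u_integrable)
  from AE_lebesgue_slices[OF this] show ?thesis
  proof eventually_elim
    case (elim x)
    show ?case
    proof
      assume x: "x \<in> ball x0 r"
      let ?I = "time_interval t0 r"
      have I: "?I \<in> sets lebesgue" by (simp add: time_interval_def)
      have sub: "(x, t) \<in> S" if "t \<in> ?I" for t using inner_cylinder_subset[OF x that] .
      have "AE t in lebesgue. t \<in> ?I \<longrightarrow> (\<forall>i<N. lebesgue_point S (\<lambda>z. u z i) (x, t))"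
        using elim by eventually_elim (use sub in auto)
      then show "AE t in lebesgue_on ?I. \<forall>i<N. lebesgue_point S (\<lambda>z. u z i) (x, t)"
        using I by (subst AE_restrict_space_iff) auto
    qed
  qed
qed

lemma mean_oscillation:
  "AE x in lebesgue_on (ball x0 r).
     eavg (time_interval t0 r) (\<lambda>t. ennreal (vnorm N (\<lambda>i. u (x,t) i - time_mean (time_interval t0 r) u x i) powr q))
     \<le> ennreal ((6 * C_osc CARD('n) L) powr q * measure lebesgue (time_interval t0 r) powr (q / 2))
        * eavg (time_interval t0 r) (\<lambda>t. epowr (majorant N p u Du F x0 t0 r (x,t)) q)"
proof -
  let ?I = "time_interval t0 r" and ?K = "C_osc CARD('n) L * sqrt (2 * r\<^sup>2)"
  have r2: "0 < r\<^sup>2" using r by simp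
  have K: "0 < ?K" using C_osc_pos[OF L] r by simp
  have mI: "measure lebesgue ?I = 2 * r\<^sup>2" using r2 by (simp add: time_interval_def measure_def)
  have "(6 * ?K) powr q = (6 * C_osc CARD('n) L) powr q * sqrt (2 * r\<^sup>2) powr q"
    using C_osc_pos[OF L, of "CARD('n)"] by (subst powr_mult[symmetric]) (auto simp: mult.assoc)
  also have "sqrt (2 * r\<^sup>2) powr q = (2 * r\<^sup>2) powr (q / 2)"
    using r2 by (simp only: powr_half_sqrt[symmetric] powr_powr) simp
  finally have const: "(6 * ?K) powr q = (6 * C_osc CARD('n) L) powr q * measure lebesgue ?I powr (q / 2)" by (simp only: mI)
  have "AE x in lebesgue. x \<in> ball x0 r \<longrightarrow>
     eavg ?I (\<lambda>t. ennreal (vnorm N (\<lambda>i. u (x,t) i - time_mean ?I u x i) powr q))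
     \<le> ennreal ((6 * ?K) powr q) * eavg ?I (\<lambda>t. epowr (majorant N p u Du F x0 t0 r (x,t)) q)"
    using AE_slices_integrable AE_slices_lebesgue_point
  proof eventually_elim
    case (elim x)
    show ?case
    proof
      assume x: "x \<in> ball x0 r"
      let ?E = "\<lambda>t. \<forall>i<N. lebesgue_point S (\<lambda>z. u z i) (x, t)"
      let ?g = "\<lambda>t. majorant N p u Du F x0 t0 r (x, t)"
      have osc: "ennreal (vnorm N (\<lambda>i. u (x, t) i - u (x, s) i)) \<le> ennreal ?K * (?g t + ?g s)"
        if "s \<in> ?I" "t \<in> ?I" "?E s" "?E t" for s t
      proof -
        consider "s = t" | "s < t" | "t < s" by linarith
        then show ?thesis
        proof cases
          case 1
          then show ?thesis by (simp add: vnorm_def L2_set_def)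
        next
          case 2
          from pointwise_oscillation[OF x that(1,2) 2] that(3,4) show ?thesis
            by (simp add: vnorm_minus_commute[where a="\<lambda>i. u (x, t) i"] add.commute)
        next
          case 3
          from pointwise_oscillation[OF x that(2,1) 3] that(3,4) show ?thesis by simp
        qed
      qed
      have "eavg {t0 - r\<^sup>2<..<t0 + r\<^sup>2} (\<lambda>t. ennreal (vnorm N (\<lambda>i. u (x,t) i
          - (\<integral>s. u (x,s) i \<partial>lebesgue_on {t0 - r\<^sup>2<..<t0 + r\<^sup>2}) / measure lebesgue {t0 - r\<^sup>2<..<t0 + r\<^sup>2}) powr q))
        \<le> ennreal ((6 * ?K) powr q) * eavg {t0 - r\<^sup>2<..<t0 + r\<^sup>2} (\<lambda>t. epowr (?g t) q)"
      proof (rule mean_oscillation_le[where E="?E"])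
        show "AE t in lebesgue_on {t0 - r\<^sup>2<..<t0 + r\<^sup>2}. ?E t"
          using elim(2) x unfolding time_interval_def by blast
        show "integrable (lebesgue_on {t0 - r\<^sup>2<..<t0 + r\<^sup>2}) (\<lambda>t. u (x, t) i)" if "i < N" for i
          using elim(1) x that unfolding time_interval_def by blast
      qed (use r2 q K p osc in \<open>auto simp: majorant_slice_measurable majorant_ge_1 time_interval_def\<close>)
      then show "eavg ?I (\<lambda>t. ennreal (vnorm N (\<lambda>i. u (x,t) i - time_mean ?I u x i) powr q))
         \<le> ennreal ((6 * ?K) powr q) * eavg ?I (\<lambda>t. epowr (?g t) q)"
        unfolding time_mean_def time_interval_def .
    qed
  qed
  then show ?thesis unfolding const by (subst AE_restrict_space_iff) auto
qed

end

theorem theorem8p6: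
  fixes p L :: real
  assumes "1 < p" and "p \<noteq> 2" and "0 < L"
  shows "\<exists>c>0. \<forall>(N::nat) (\<nu>::real) (q::real) (\<Omega>::(real^'n) set) (T::real) A F u Du.
      1 \<le> N \<and> 0 < \<nu> \<and> \<nu> < L \<and> max 1 (p - 1) < q \<and>
      open \<Omega> \<and> connected \<Omega> \<and> bounded \<Omega> \<and> \<Omega> \<noteq> {} \<and> 0 < T \<and>
      caratheodory_field N p \<nu> L (spacetime \<Omega> T) A \<and>
      F \<in> spacetime \<Omega> T \<rightarrow> vecs N \<and> F \<in> borel_measurable (lebesgue_on (spacetime \<Omega> T)) \<and>
      Lloc (p * q / 2) (spacetime \<Omega> T) (\<lambda>z. vnorm N (F z)) \<and>
      LW_loc (p * q / 2) N \<Omega> T u Du \<and>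
      weak_solution N p (spacetime \<Omega> T) A F u Du \<longrightarrow>
      (\<forall>x0 t0 r. 0 < r \<and> cpt_contained (cylinder x0 t0 (2 * r)) (spacetime \<Omega> T) \<longrightarrow>
        (let I = time_interval t0 r in
         AE x in lebesgue_on (ball x0 r).
           eavg I (\<lambda>t. ennreal (vnorm N (\<lambda>i. u (x,t) i - time_mean I u x i) powr q))
           \<le> ennreal (c powr q * measure lebesgue I powr (q / 2))
              * eavg I (\<lambda>t. epowr (majorant N p u Du F x0 t0 r (x,t)) q)))"
proof (intro exI[of _ "6 * C_osc CARD('n) L"] conjI allI impI)
  show "0 < 6 * C_osc CARD('n) L" using C_osc_pos[OF assms(3)] by simp
  fix N :: nat and \<nu> q :: real and \<Omega> :: "(real^'n) set" and T :: real and A F u Du x0 t0 r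
  assume H: "1 \<le> N \<and> 0 < \<nu> \<and> \<nu> < L \<and> max 1 (p - 1) < q \<and>
      open \<Omega> \<and> connected \<Omega> \<and> bounded \<Omega> \<and> \<Omega> \<noteq> {} \<and> 0 < T \<and>
      caratheodory_field N p \<nu> L (spacetime \<Omega> T) A \<and>
      F \<in> spacetime \<Omega> T \<rightarrow> vecs N \<and> F \<in> borel_measurable (lebesgue_on (spacetime \<Omega> T)) \<and>
      Lloc (p * q / 2) (spacetime \<Omega> T) (\<lambda>z. vnorm N (F z)) \<and>
      LW_loc (p * q / 2) N \<Omega> T u Du \<and>
      weak_solution N p (spacetime \<Omega> T) A F u Du"
    and C: "0 < r \<and> cpt_contained (cylinder x0 t0 (2 * r)) (spacetime \<Omega> T)"
  interpret solution N p \<nu> L q \<Omega> T A F u Du x0 t0 r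
    by unfold_locales (use assms H C in auto)
  show "let I = time_interval t0 r in
         AE x in lebesgue_on (ball x0 r).
           eavg I (\<lambda>t. ennreal (vnorm N (\<lambda>i. u (x,t) i - time_mean I u x i) powr q))
           \<le> ennreal ((6 * C_osc CARD('n) L) powr q * measure lebesgue I powr (q / 2))
              * eavg I (\<lambda>t. epowr (majorant N p u Du F x0 t0 r (x,t)) q)"
    unfolding Let_def by (rule mean_oscillation)
qed

end
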